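(* Let $\Omega\subset\mathbb{R}^d$ ($d=2,3$) be a Lipschitz polygon/polyhedron and let $s\in(1/2,1]$ be such that for every $f\in L^2(\Omega)$ the solution $u\in H^1_0(\Omega)$ of $-\Delta u=f$ belongs to $H^{1+s}(\Omega)$. Let $\Sigma_h\subset\mathbf{H}(\mathrm{div};\Omega)$ and $U_h\subset H^1_0(\Omega)$ be families of finite dimensional (finite element) spaces indexed by $h>0$, and assume that there is a constant $C$ independent of $h$ such that $$\inf_{\boldsymbol{\tau}\in\Sigma_h}\|\boldsymbol{\chi}-\boldsymbol{\tau}\|_{\mathbf{H}(\mathrm{div};\Omega)}\le Ch^s\big(\|\boldsymbol{\chi}\|_{\mathbf{H}^s(\Omega)}+\|\mathrm{div}\,\boldsymbol{\chi}\|_{H^{1+s}(\Omega)}\big),\qquad \inf_{v\in U_h}\|p-v\|_{H^1(\Omega)}\le Ch^s\|p\|_{H^{1+s}(\Omega)}$$ for all $\boldsymbol{\chi}\in\mathbf{H}^s(\Omega)$ with $\mathrm{div}\,\boldsymbol{\chi}\in H^{1+s}(\Omega)$ and all $p\in H^{1+s}(\Omega)\cap H^1_0(\Omega)$. Then there is a function $\rho(h)$, tending to zero as $h\to0$, such that $$\|T_{F1}f-T_{F1,h}f\|_{L^2(\Omega)}\le\rho(h)\|f\|_{L^2(\Omega)}\qquad\forall f\in L^2(\Omega),$$ where $T_{F1}$ and $T_{F1,h}$ are the continuous and discrete solution operators defined in the context.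
   Context: $(\cdot,\cdot)$ is the $L^2(\Omega)$ (or $L^2(\Omega)^d$) inner product; $\mathbf{H}(\mathrm{div};\Omega)=\{\boldsymbol{\tau}\in L^2(\Omega)^d:\mathrm{div}\,\boldsymbol{\tau}\in L^2(\Omega)\}$ with the graph norm; $\mathbf{H}^s(\Omega)=H^s(\Omega)^d$. The operator $T_{F1}:L^2(\Omega)\to L^2(\Omega)$ maps $f$ to $T_{F1}f=u\in H^1_0(\Omega)$, where $(\boldsymbol{\sigma},u)\in\mathbf{H}(\mathrm{div};\Omega)\times H^1_0(\Omega)$ is the solution of $$\begin{cases}(\boldsymbol{\sigma},\boldsymbol{\tau})+(\mathrm{div}\,\boldsymbol{\sigma},\mathrm{div}\,\boldsymbol{\tau})-(\nabla u,\boldsymbol{\tau})=-(f,\mathrm{div}\,\boldsymbol{\tau})&\forall\boldsymbol{\tau}\in\mathbf{H}(\mathrm{div};\Omega)\\ -(\boldsymbol{\sigma},\nabla v)+(\nabla u,\nabla v)=0&\forall v\in H^1_0(\Omega).\end{cases}$$ The operator $T_{F1,h}:L^2(\Omega)\to L^2(\Omega)$ maps $f$ to $T_{F1,h}f=u_h\in U_h$, where $(\boldsymbol{\sigma}_h,u_h)\in\Sigma_h\times U_h$ solves the same equations with test functions $\boldsymbol{\tau}\in\Sigma_h$, $v\in U_h$. *)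

theory Defs
  imports "HOL-Analysis.Analysis"
begin

(* Elements of L2, of the Sobolev spaces, and of the finite element spaces are represented by
   genuine functions on the whole space; only their values on Omega, up to null sets, matter. *)

(* Locally, after rotation, the domain lies strictly above the graph of a Lipschitz function:
   "height" is the component along the unit vector \<nu>, and g depends only on the components
   orthogonal to \<nu>. *)
definition lipschitz_boundary :: "(real ^ 'd) set \<Rightarrow> bool" where
  "lipschitz_boundary \<Omega> \<longleftrightarrow>
     (\<forall>x0 \<in> frontier \<Omega>. \<exists>r>0. \<exists>\<nu> g L. norm \<nu> = 1 \<and> L-lipschitz_on UNIV (g :: real ^ 'd \<Rightarrow> real) \<and>
        (\<forall>y t. g (y + t *\<^sub>R \<nu>) = g y) \<and>
        \<Omega> \<inter> ball x0 r = {y \<in> ball x0 r. y \<bullet> \<nu> > g y})"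

definition lipschitz_polyhedron :: "(real ^ 'd) set \<Rightarrow> bool" where
  "lipschitz_polyhedron \<Omega> \<longleftrightarrow>
     \<Omega> \<noteq> {} \<and> open \<Omega> \<and> connected \<Omega> \<and> bounded \<Omega> \<and> lipschitz_boundary \<Omega> \<and>
     (\<exists>P. finite P \<and> (\<forall>p\<in>P. polytope p) \<and> closure \<Omega> = \<Union>P)"

definition partial :: "'d \<Rightarrow> (real ^ 'd \<Rightarrow> real) \<Rightarrow> real ^ 'd \<Rightarrow> real" where
  "partial i \<phi> x = frechet_derivative \<phi> (at x) (axis i 1)"

primrec k_times_diff :: "nat \<Rightarrow> (real ^ 'd \<Rightarrow> real) \<Rightarrow> bool" where
  "k_times_diff 0 \<phi> \<longleftrightarrow> continuous_on UNIV \<phi>"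
| "k_times_diff (Suc k) \<phi> \<longleftrightarrow> \<phi> differentiable_on UNIV \<and> (\<forall>i. k_times_diff k (partial i \<phi>))"

definition test_functions :: "(real ^ 'd) set \<Rightarrow> (real ^ 'd \<Rightarrow> real) set" where
  "test_functions \<Omega> =
     {\<phi>. (\<forall>k. k_times_diff k \<phi>) \<and> compact (closure {x. \<phi> x \<noteq> 0}) \<and> closure {x. \<phi> x \<noteq> 0} \<subseteq> \<Omega>}"

definition L2 :: "(real ^ 'd) set \<Rightarrow> (real ^ 'd \<Rightarrow> 'b::euclidean_space) set" where
  "L2 \<Omega> = {f. f \<in> borel_measurable (lebesgue_on \<Omega>) \<and> integrable (lebesgue_on \<Omega>) (\<lambda>x. (norm (f x))\<^sup>2)}"

definition L2_inner :: "(real ^ 'd) set \<Rightarrow> (real ^ 'd \<Rightarrow> 'b::euclidean_space) \<Rightarrow> (real ^ 'd \<Rightarrow> 'b) \<Rightarrow> real" where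
  "L2_inner \<Omega> f g = (LINT x|lebesgue_on \<Omega>. f x \<bullet> g x)"

definition L2_norm :: "(real ^ 'd) set \<Rightarrow> (real ^ 'd \<Rightarrow> 'b::euclidean_space) \<Rightarrow> real" where
  "L2_norm \<Omega> f = sqrt (L2_inner \<Omega> f f)"

definition has_weak_partial ::
    "(real ^ 'd) set \<Rightarrow> 'd \<Rightarrow> (real ^ 'd \<Rightarrow> real) \<Rightarrow> (real ^ 'd \<Rightarrow> real) \<Rightarrow> bool" where
  "has_weak_partial \<Omega> i u g \<longleftrightarrow>
     g \<in> L2 \<Omega> \<and> (\<forall>\<phi> \<in> test_functions \<Omega>. L2_inner \<Omega> u (partial i \<phi>) = - L2_inner \<Omega> g \<phi>)"

definition weak_partial :: "(real ^ 'd) set \<Rightarrow> 'd \<Rightarrow> (real ^ 'd \<Rightarrow> real) \<Rightarrow> real ^ 'd \<Rightarrow> real" where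
  "weak_partial \<Omega> i u = (SOME g. has_weak_partial \<Omega> i u g)"

definition weak_grad :: "(real ^ 'd) set \<Rightarrow> (real ^ 'd \<Rightarrow> real) \<Rightarrow> real ^ 'd \<Rightarrow> real ^ 'd" where
  "weak_grad \<Omega> u x = (\<chi> i. weak_partial \<Omega> i u x)"

definition has_weak_div ::
    "(real ^ 'd) set \<Rightarrow> (real ^ 'd \<Rightarrow> real ^ 'd) \<Rightarrow> (real ^ 'd \<Rightarrow> real) \<Rightarrow> bool" where
  "has_weak_div \<Omega> \<tau> g \<longleftrightarrow>
     g \<in> L2 \<Omega> \<and>
     (\<forall>\<phi> \<in> test_functions \<Omega>. L2_inner \<Omega> \<tau> (\<lambda>x. \<chi> i. partial i \<phi> x) = - L2_inner \<Omega> g \<phi>)"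

definition weak_div :: "(real ^ 'd) set \<Rightarrow> (real ^ 'd \<Rightarrow> real ^ 'd) \<Rightarrow> real ^ 'd \<Rightarrow> real" where
  "weak_div \<Omega> \<tau> = (SOME g. has_weak_div \<Omega> \<tau> g)"

(* Square of the Sobolev-Slobodeckij seminorm of order \<theta>, for 0 < \<theta> < 1.  The integrand is 0 on
   the diagonal, by the convention on division by zero. *)
definition slobodeckij_integrand :: "real \<Rightarrow> (real ^ 'd \<Rightarrow> real) \<Rightarrow> (real ^ 'd) \<times> (real ^ 'd) \<Rightarrow> real" where
  "slobodeckij_integrand \<theta> u =
     (\<lambda>(x, y). (u x - u y)\<^sup>2 / norm (x - y) powr (real CARD('d) + 2 * \<theta>))"

(* The space of order m + \<theta>, with m an integer and 0 \<le> \<theta> < 1.  Its norm has, in the case m = 1,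
   the form |u|^2 + |grad u|^2 + |grad u|_\<theta>^2 (without the last term if \<theta> = 0). *)
primrec sobolev_aux :: "nat \<Rightarrow> real \<Rightarrow> (real ^ 'd) set \<Rightarrow> (real ^ 'd \<Rightarrow> real) set" where
  "sobolev_aux 0 \<theta> \<Omega> =
     {u \<in> L2 \<Omega>. \<theta> \<noteq> 0 \<longrightarrow>
        integrable (lebesgue_on \<Omega> \<Otimes>\<^sub>M lebesgue_on \<Omega>) (slobodeckij_integrand \<theta> u)}"
| "sobolev_aux (Suc m) \<theta> \<Omega> =
     {u \<in> L2 \<Omega>. \<forall>i. \<exists>g \<in> sobolev_aux m \<theta> \<Omega>. has_weak_partial \<Omega> i u g}"

primrec sobolev_norm_aux :: "nat \<Rightarrow> real \<Rightarrow> (real ^ 'd) set \<Rightarrow> (real ^ 'd \<Rightarrow> real) \<Rightarrow> real" where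
  "sobolev_norm_aux 0 \<theta> \<Omega> u =
     sqrt ((L2_norm \<Omega> u)\<^sup>2 +
       (if \<theta> = 0 then 0
        else (LINT z|(lebesgue_on \<Omega> \<Otimes>\<^sub>M lebesgue_on \<Omega>). slobodeckij_integrand \<theta> u z)))"
| "sobolev_norm_aux (Suc m) \<theta> \<Omega> u =
     sqrt ((L2_norm \<Omega> u)\<^sup>2 + (\<Sum>i\<in>UNIV. (sobolev_norm_aux m \<theta> \<Omega> (weak_partial \<Omega> i u))\<^sup>2))"

definition sobolev :: "real \<Rightarrow> (real ^ 'd) set \<Rightarrow> (real ^ 'd \<Rightarrow> real) set" where
  "sobolev r \<Omega> = sobolev_aux (nat \<lfloor>r\<rfloor>) (frac r) \<Omega>"

definition sobolev_norm :: "real \<Rightarrow> (real ^ 'd) set \<Rightarrow> (real ^ 'd \<Rightarrow> real) \<Rightarrow> real" where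
  "sobolev_norm r \<Omega> u = sobolev_norm_aux (nat \<lfloor>r\<rfloor>) (frac r) \<Omega> u"

definition sobolev_vec :: "real \<Rightarrow> (real ^ 'd) set \<Rightarrow> (real ^ 'd \<Rightarrow> real ^ 'd) set" where
  "sobolev_vec r \<Omega> = {\<tau>. \<forall>i. (\<lambda>x. \<tau> x $ i) \<in> sobolev r \<Omega>}"

definition sobolev_vec_norm :: "real \<Rightarrow> (real ^ 'd) set \<Rightarrow> (real ^ 'd \<Rightarrow> real ^ 'd) \<Rightarrow> real" where
  "sobolev_vec_norm r \<Omega> \<tau> = sqrt (\<Sum>i\<in>UNIV. (sobolev_norm r \<Omega> (\<lambda>x. \<tau> x $ i))\<^sup>2)"

definition H10 :: "(real ^ 'd) set \<Rightarrow> (real ^ 'd \<Rightarrow> real) set" where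
  "H10 \<Omega> = {u \<in> sobolev 1 \<Omega>. \<exists>\<phi> :: nat \<Rightarrow> real ^ 'd \<Rightarrow> real.
      (\<forall>n. \<phi> n \<in> test_functions \<Omega>) \<and> (\<lambda>n. sobolev_norm 1 \<Omega> (\<lambda>x. u x - \<phi> n x)) \<longlonglongrightarrow> 0}"

definition Hdiv :: "(real ^ 'd) set \<Rightarrow> (real ^ 'd \<Rightarrow> real ^ 'd) set" where
  "Hdiv \<Omega> = {\<tau> \<in> L2 \<Omega>. \<exists>g. has_weak_div \<Omega> \<tau> g}"

definition Hdiv_norm :: "(real ^ 'd) set \<Rightarrow> (real ^ 'd \<Rightarrow> real ^ 'd) \<Rightarrow> real" where
  "Hdiv_norm \<Omega> \<tau> = sqrt ((L2_norm \<Omega> \<tau>)\<^sup>2 + (L2_norm \<Omega> (weak_div \<Omega> \<tau>))\<^sup>2)"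

definition finite_dim_space :: "('a \<Rightarrow> 'b::real_vector) set \<Rightarrow> bool" where
  "finite_dim_space V \<longleftrightarrow>
     (\<exists>B. finite B \<and> V = range (\<lambda>c :: ('a \<Rightarrow> 'b) \<Rightarrow> real. \<lambda>x. \<Sum>b\<in>B. c b *\<^sub>R b x))"

definition poisson_solution :: "(real ^ 'd) set \<Rightarrow> (real ^ 'd \<Rightarrow> real) \<Rightarrow> (real ^ 'd \<Rightarrow> real) \<Rightarrow> bool" where
  "poisson_solution \<Omega> f u \<longleftrightarrow>
     u \<in> H10 \<Omega> \<and> (\<forall>v \<in> H10 \<Omega>. L2_inner \<Omega> (weak_grad \<Omega> u) (weak_grad \<Omega> v) = L2_inner \<Omega> f v)"

definition fosls_solution ::
    "(real ^ 'd) set \<Rightarrow> (real ^ 'd \<Rightarrow> real ^ 'd) set \<Rightarrow> (real ^ 'd \<Rightarrow> real) set \<Rightarrow>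
     (real ^ 'd \<Rightarrow> real) \<Rightarrow> (real ^ 'd \<Rightarrow> real ^ 'd) \<Rightarrow> (real ^ 'd \<Rightarrow> real) \<Rightarrow> bool" where
  "fosls_solution \<Omega> S V f \<sigma> u \<longleftrightarrow>
     \<sigma> \<in> S \<and> u \<in> V \<and>
     (\<forall>\<tau> \<in> S. L2_inner \<Omega> \<sigma> \<tau> + L2_inner \<Omega> (weak_div \<Omega> \<sigma>) (weak_div \<Omega> \<tau>)
                - L2_inner \<Omega> (weak_grad \<Omega> u) \<tau> = - L2_inner \<Omega> f (weak_div \<Omega> \<tau>)) \<and>
     (\<forall>v \<in> V. - L2_inner \<Omega> \<sigma> (weak_grad \<Omega> v)
                + L2_inner \<Omega> (weak_grad \<Omega> u) (weak_grad \<Omega> v) = 0)"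

(* The solution is unique only up to null sets, so a representative is chosen. *)
definition T_F1 :: "(real ^ 'd) set \<Rightarrow> (real ^ 'd \<Rightarrow> real) \<Rightarrow> real ^ 'd \<Rightarrow> real" where
  "T_F1 \<Omega> f = (SOME u. \<exists>\<sigma>. fosls_solution \<Omega> (Hdiv \<Omega>) (H10 \<Omega>) f \<sigma> u)"

definition T_F1_h ::
    "(real ^ 'd) set \<Rightarrow> (real ^ 'd \<Rightarrow> real ^ 'd) set \<Rightarrow> (real ^ 'd \<Rightarrow> real) set \<Rightarrow>
     (real ^ 'd \<Rightarrow> real) \<Rightarrow> real ^ 'd \<Rightarrow> real" where
  "T_F1_h \<Omega> Sh Uh f = (SOME u. \<exists>\<sigma>. fosls_solution \<Omega> Sh Uh f \<sigma> u)"

end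

theory Submission
  imports Defs "HOL-Library.Function_Algebras"
begin

text \<open>The least squares form is symmetric, and the error \<open>e = (\<sigma> - \<sigma>\<^sub>h, u - u\<^sub>h)\<close> is orthogonal to the
  discrete spaces in it and bounded by \<open>2 \<parallel>f\<parallel>\<close> in the associated seminorm. For \<open>g\<close> in \<open>L\<^sup>2\<close>, the solution of
  the dual problem with right hand side \<open>g\<close> is obtained from two Poisson problems and is regular enough
  to be approximated, so that \<open>(u - u\<^sub>h, g)\<close> is at most \<open>M(g) h\<^sup>s \<parallel>f\<parallel>\<close>. The regularity hypothesis is
  only qualitative, so nothing is known about how \<open>M(g)\<close> depends on \<open>g\<close>; the uniform boundedness
  principle, applied to the errors divided by \<open>h\<^sup>s \<parallel>f\<parallel>\<close>, nevertheless bounds their \<open>L\<^sup>2\<close> norms, which gives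
  \<open>\<rho>(h) = K h\<^sup>s\<close>.\<close>

text \<open>Since div \<sigma> = -f with f merely square integrable, the energy error cannot tend to
  zero uniformly over the unit ball of \<open>L2\<close>. Stability is therefore all that is asked
  of the primal error, and the whole factor \<open>h powr s\<close> comes from the dual side, where
  one needs a flux whose divergence lies in \<open>sobolev (1 + s) \<Omega>\<close>. A second
  obstacle is that elements of the spaces are functions rather than classes: inner products are only
  semidefinite, and \<open>weak_grad\<close> and \<open>weak_div\<close> are choices that are linear
  only up to null sets. Hence the abstract part works with seminorms on carrier sets, and equalities
  between elements are expressed through inner products. The error estimate is proved for every pair
  of a continuous and a discrete solution, so it covers the pair selected by \<open>SOME\<close>,
  once existence is known. The continuous solution comes from a Poisson problem, the discrete one
  from a Riesz theorem on spans of finite sets. The constant K is obtained by contradiction and is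
  not explicit.\<close>

section \<open>Pointwise vector space structure on functions\<close>

instantiation "fun" :: (type, real_vector) real_vector
begin

definition scaleR_fun :: "real \<Rightarrow> ('a \<Rightarrow> 'b) \<Rightarrow> 'a \<Rightarrow> 'b"
  where "c *\<^sub>R f = (\<lambda>x. c *\<^sub>R f x)"

instance
  by standard (simp_all add: scaleR_fun_def fun_eq_iff algebra_simps)

end

lemma scaleR_fun_apply [simp]: "(c *\<^sub>R f) x = c *\<^sub>R f x"
  by (simp add: scaleR_fun_def)

lemma sum_fun_apply [simp]: "(\<Sum>i\<in>I. f i) x = (\<Sum>i\<in>I. f i x)"
  for f :: "'i \<Rightarrow> 'a \<Rightarrow> 'b::comm_monoid_add"
  by (induction I rule: infinite_finite_induct) auto

text \<open>Translates the pointwise combinations in \<open>finite_dim_space\<close> into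
  combinations in the function space, so that the discrete spaces become values of
  \<open>span\<close>.\<close>

lemma sum_scaleR_fun_eq: "(\<lambda>x. \<Sum>b\<in>B. c b *\<^sub>R b x) = (\<Sum>b\<in>B. c b *\<^sub>R b)"
  for c :: "('a \<Rightarrow> 'b::real_vector) \<Rightarrow> real"
  by (auto simp: fun_eq_iff)

section \<open>Semi-inner product spaces\<close>

text \<open>Definiteness is left out because functions that differ on a null set have distance 0,
  and V is a set because the spaces sit inside the type of all functions. The instances are
  \<open>L2\<close>, \<open>H10\<close> with the gradient form, and the pairs carrying the least
  squares form.\<close>

locale semi_inner_space =
  fixes V :: "'v::real_vector set" and ip :: "'v \<Rightarrow> 'v \<Rightarrow> real"
  assumes subspace_V: "subspace V"
    and ip_commute: "\<lbrakk>x \<in> V; y \<in> V\<rbrakk> \<Longrightarrow> ip x y = ip y x"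
    and ip_add_left: "\<lbrakk>x \<in> V; y \<in> V; z \<in> V\<rbrakk> \<Longrightarrow> ip (x + y) z = ip x z + ip y z"
    and ip_scale_left: "\<lbrakk>x \<in> V; y \<in> V\<rbrakk> \<Longrightarrow> ip (c *\<^sub>R x) y = c * ip x y"
    and ip_self_nonneg: "x \<in> V \<Longrightarrow> 0 \<le> ip x x"
begin

abbreviation nm :: "'v \<Rightarrow> real" where "nm x \<equiv> sqrt (ip x x)"

definition seq_complete :: bool where
  "seq_complete \<longleftrightarrow> (\<forall>X. (\<forall>n. X n \<in> V) \<longrightarrow>
     (\<forall>e>0. \<exists>N. \<forall>m\<ge>N. \<forall>n\<ge>N. nm (X m - X n) < e) \<longrightarrow>
     (\<exists>x\<in>V. (\<lambda>n. nm (X n - x)) \<longlonglongrightarrow> 0))"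

lemma seq_completeD:
  assumes "seq_complete" "\<And>n. X n \<in> V" "\<forall>e>0. \<exists>N. \<forall>m\<ge>N. \<forall>n\<ge>N. nm (X m - X n) < e"
  shows "\<exists>x\<in>V. (\<lambda>n. nm (X n - x)) \<longlonglongrightarrow> 0"
  using assms unfolding seq_complete_def by simp

lemma V_zero [simp]: "0 \<in> V"
  and V_add [simp]: "\<lbrakk>x \<in> V; y \<in> V\<rbrakk> \<Longrightarrow> x + y \<in> V"
  and V_scale [simp]: "x \<in> V \<Longrightarrow> c *\<^sub>R x \<in> V"
  and V_diff [simp]: "\<lbrakk>x \<in> V; y \<in> V\<rbrakk> \<Longrightarrow> x - y \<in> V"
  using subspace_V by (auto simp: subspace_def subspace_diff)

lemma V_uminus [simp]: "x \<in> V \<Longrightarrow> - x \<in> V"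
  using V_diff[of 0 x] by simp

lemma ip_uminus_left: "\<lbrakk>x \<in> V; y \<in> V\<rbrakk> \<Longrightarrow> ip (- x) y = - ip x y"
  using ip_scale_left[of x y "-1"] by simp

lemma ip_diff_left: "\<lbrakk>x \<in> V; y \<in> V; z \<in> V\<rbrakk> \<Longrightarrow> ip (x - y) z = ip x z - ip y z"
  using ip_add_left[of x "- y" z] ip_uminus_left[of y z] by simp

lemma ip_zero_left: "x \<in> V \<Longrightarrow> ip 0 x = 0"
  using ip_scale_left[of 0 x 0] by simp

lemma ip_zero_right: "x \<in> V \<Longrightarrow> ip x 0 = 0"
  using ip_zero_left ip_commute by fastforce

lemma ip_add_right: "\<lbrakk>x \<in> V; y \<in> V; z \<in> V\<rbrakk> \<Longrightarrow> ip z (x + y) = ip z x + ip z y"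
  using ip_add_left[of x y z] ip_commute[of z] by simp

lemma ip_diff_right: "\<lbrakk>x \<in> V; y \<in> V; z \<in> V\<rbrakk> \<Longrightarrow> ip z (x - y) = ip z x - ip z y"
  using ip_diff_left[of x y z] ip_commute[of z] by simp

lemma ip_scale_right: "\<lbrakk>x \<in> V; y \<in> V\<rbrakk> \<Longrightarrow> ip y (c *\<^sub>R x) = c * ip y x"
  using ip_scale_left[of x y c] ip_commute[of y] by simp

lemma ip_uminus_right: "\<lbrakk>x \<in> V; y \<in> V\<rbrakk> \<Longrightarrow> ip y (- x) = - ip y x"
  using ip_scale_right[of x y "-1"] by simp

lemmas ip_left = ip_add_left ip_diff_left ip_uminus_left ip_scale_left ip_zero_left
lemmas ip_right = ip_add_right ip_diff_right ip_uminus_right ip_scale_right ip_zero_right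

lemma nm_sq: "x \<in> V \<Longrightarrow> (nm x)\<^sup>2 = ip x x"
  by (simp add: ip_self_nonneg)

lemma Cauchy_Schwarz_sq:
  assumes "x \<in> V" "y \<in> V"
  shows "(ip x y)\<^sup>2 \<le> ip x x * ip y y"
proof -
  have *: "0 \<le> t\<^sup>2 * ip y y - 2 * t * ip x y + ip x x" for t
  proof -
    have "0 \<le> ip (x - t *\<^sub>R y) (x - t *\<^sub>R y)"
      using assms by (simp add: ip_self_nonneg)
    also have "\<dots> = t\<^sup>2 * ip y y - 2 * t * ip x y + ip x x"
      using assms ip_commute[of y x] by (simp add: ip_left ip_right algebra_simps power2_eq_square)
    finally show ?thesis .
  qed
  show ?thesis
  \<comment> \<open>The minimiser \<open>ip x y / ip y y\<close> of the quadratic is available only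
    if \<open>ip y y\<close> is nonzero. Otherwise the quadratic is affine in t, and if its slope
    were nonzero the value of t chosen below would make it equal to -1.\<close>
  proof (cases "ip y y = 0")
    case True
    have "ip x y = 0"
    proof (rule ccontr)
      assume "ip x y \<noteq> 0"
      then show False
        using *[of "(ip x x + 1) / (2 * ip x y)"] True by simp
    qed
    then show ?thesis using True by simp
  next
    case False
    then have "ip y y > 0" using ip_self_nonneg[OF assms(2)] by simp
    moreover have "0 \<le> ip x x - (ip x y)\<^sup>2 / ip y y"
      using *[of "ip x y / ip y y"] False by (simp add: field_simps power2_eq_square)
    ultimately show ?thesis by (simp add: field_simps)
  qed
qed

lemma Cauchy_Schwarz: "\<lbrakk>x \<in> V; y \<in> V\<rbrakk> \<Longrightarrow> \<bar>ip x y\<bar> \<le> nm x * nm y"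
  using Cauchy_Schwarz_sq[of x y] by (metis real_sqrt_abs real_sqrt_le_iff real_sqrt_mult)

lemma nm_add_le:
  assumes "x \<in> V" "y \<in> V"
  shows "nm (x + y) \<le> nm x + nm y"
proof (rule real_le_lsqrt)
  show "0 \<le> nm x + nm y" using assms by (simp add: ip_self_nonneg)
  have "ip (x + y) (x + y) = ip x x + 2 * ip x y + ip y y"
    using assms ip_commute[of y x] by (simp add: ip_left ip_right)
  also have "\<dots> \<le> (nm x)\<^sup>2 + 2 * (nm x * nm y) + (nm y)\<^sup>2"
    using Cauchy_Schwarz[OF assms] by (simp add: nm_sq assms del: real_sqrt_pow2)
  finally show "ip (x + y) (x + y) \<le> (nm x + nm y)\<^sup>2"
    by (simp add: power2_sum)
qed

lemma nm_scale: "x \<in> V \<Longrightarrow> nm (c *\<^sub>R x) = \<bar>c\<bar> * nm x"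
  by (simp add: ip_left ip_right real_sqrt_mult flip: mult.assoc)

lemma nm_uminus: "x \<in> V \<Longrightarrow> nm (- x) = nm x"
  by (simp add: ip_left ip_right)

lemma nm_diff_commute: "\<lbrakk>x \<in> V; y \<in> V\<rbrakk> \<Longrightarrow> nm (x - y) = nm (y - x)"
  using nm_uminus[of "x - y"] by simp

lemma nm_diff_le: "\<lbrakk>x \<in> V; y \<in> V\<rbrakk> \<Longrightarrow> nm (x - y) \<le> nm x + nm y"
  using nm_add_le[of x "- y"] nm_uminus[of y] by simp

lemma nm_triangle: "\<lbrakk>x \<in> V; y \<in> V; z \<in> V\<rbrakk> \<Longrightarrow> nm (x - z) \<le> nm (x - y) + nm (y - z)"
  using nm_add_le[of "x - y" "y - z"] by simp

text \<open>Takes the place of passing to the quotient: null vectors are invisible to the form, so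
  representatives can be exchanged inside inner products.\<close>

lemma ip_null_left: "\<lbrakk>x \<in> V; y \<in> V; nm x = 0\<rbrakk> \<Longrightarrow> ip x y = 0"
  using Cauchy_Schwarz[of x y] by simp

lemma ip_tendsto:
  assumes "\<And>n. X n \<in> V" "x \<in> V" "y \<in> V" "(\<lambda>n. nm (X n - x)) \<longlonglongrightarrow> 0"
  shows "(\<lambda>n. ip (X n) y) \<longlonglongrightarrow> ip x y"
proof -
  have "(\<lambda>n. ip (X n) y - ip x y) \<longlonglongrightarrow> 0"
  proof (rule Lim_null_comparison)
    show "\<forall>\<^sub>F n in sequentially. norm (ip (X n) y - ip x y) \<le> nm (X n - x) * nm y"
      using assms Cauchy_Schwarz[of "X _ - x" y] by (simp add: ip_left)
    show "(\<lambda>n. nm (X n - x) * nm y) \<longlonglongrightarrow> 0"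
      using assms(4) tendsto_mult_left_zero by blast
  qed
  then show ?thesis by (simp add: LIM_zero_iff)
qed

lemma nm_tendsto:
  assumes "\<And>n. X n \<in> V" "x \<in> V" "(\<lambda>n. nm (X n - x)) \<longlonglongrightarrow> 0"
  shows "(\<lambda>n. nm (X n)) \<longlonglongrightarrow> nm x"
proof -
  have "(\<lambda>n. nm (X n) - nm x) \<longlonglongrightarrow> 0"
  proof (rule Lim_null_comparison[OF _ assms(3)], intro always_eventually allI)
    fix n
    show "norm (nm (X n) - nm x) \<le> nm (X n - x)"
      using nm_add_le[of "X n - x" x] nm_add_le[of "x - X n" "X n"] nm_diff_commute[of x "X n"] assms
      by (simp add: abs_le_iff)
  qed
  then show ?thesis by (simp add: LIM_zero_iff)
qed

text \<open>The representing vector minimises the energy \<open>J\<close>. Minimising sequences are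
  Cauchy by the parallelogram identity, completeness supplies a limit, and the first variation of
  \<open>J\<close> vanishes there.\<close>

lemma riesz_complete:
  assumes compl: "seq_complete"
    and l_add: "\<And>x y. \<lbrakk>x \<in> V; y \<in> V\<rbrakk> \<Longrightarrow> l (x + y) = l x + l y"
    and l_scale: "\<And>c x. x \<in> V \<Longrightarrow> l (c *\<^sub>R x) = c * l x"
    and l_bound: "\<And>x. x \<in> V \<Longrightarrow> \<bar>l x\<bar> \<le> M * nm x"
  shows "\<exists>u\<in>V. \<forall>v\<in>V. ip u v = l v"
proof -
  define J where "J v = ip v v - 2 * l v" for v
  have J_lower: "- M\<^sup>2 \<le> J v" if "v \<in> V" for v
  proof -
    \<comment> \<open>Completing the square absorbs the linear term, which is at most
      \<open>2 * M * nm v\<close>.\<close>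
    have "0 \<le> (nm v - M)\<^sup>2" by simp
    then have "2 * (M * nm v) \<le> ip v v + M\<^sup>2"
      using nm_sq[OF that] by (simp add: power2_diff mult_ac del: real_sqrt_pow2)
    then show ?thesis using l_bound[OF that] unfolding J_def by linarith
  qed
  define m where "m = Inf (J ` V)"
  have bdd: "bdd_below (J ` V)" using J_lower by (auto intro!: bdd_belowI2)
  have m_le: "m \<le> J v" if "v \<in> V" for v
    unfolding m_def using bdd that by (simp add: cInf_lower)
  have "\<exists>v\<in>V. J v < m + inverse (real (Suc n))" for n
  proof -
    have "Inf (J ` V) < m + inverse (real (Suc n))" by (simp add: m_def)
    moreover have "J ` V \<noteq> {}" using V_zero by blast
    ultimately obtain y where "y \<in> J ` V" "y < m + inverse (real (Suc n))"
      using cInf_lessD[of "J ` V"] by metis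
    then show ?thesis by blast
  qed
  then obtain X where XV: "\<And>n. X n \<in> V" and XJ: "\<And>n. J (X n) < m + inverse (real (Suc n))"
    by metis
  \<comment> \<open>The linear parts of \<open>J\<close> cancel at the midpoint, leaving the usual
    parallelogram law. As \<open>J\<close> is at least m at the midpoint, almost minimal points lie
    close together.\<close>
  have parallelogram: "ip (x - y) (x - y) = 2 * J x + 2 * J y - 4 * J ((1/2) *\<^sub>R (x + y))"
    if "x \<in> V" "y \<in> V" for x y
    using that ip_commute[of y x] l_add[of x y] l_scale[of "x + y" "1/2"]
    by (simp add: J_def ip_left ip_right algebra_simps)
  have close: "ip (X i - X j) (X i - X j) \<le> 2 * inverse (real (Suc i)) + 2 * inverse (real (Suc j))" for i j
    using parallelogram[OF XV XV, of i j] XJ[of i] XJ[of j] m_le[of "(1/2) *\<^sub>R (X i + X j)"] XV by simp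
  have cauchy: "\<forall>e>0. \<exists>N. \<forall>i\<ge>N. \<forall>j\<ge>N. nm (X i - X j) < e"
  proof (intro allI impI)
    fix e :: real assume "e > 0"
    then obtain N where N: "inverse (real (Suc N)) < e\<^sup>2 / 4"
      using reals_Archimedean[of "e\<^sup>2 / 4"] by auto
    have "nm (X i - X j) < e" if "i \<ge> N" "j \<ge> N" for i j
    proof -
      have "inverse (real (Suc i)) \<le> inverse (real (Suc N))" "inverse (real (Suc j)) \<le> inverse (real (Suc N))"
        using that by (auto intro!: le_imp_inverse_le)
      then have "ip (X i - X j) (X i - X j) < e\<^sup>2" using close[of i j] N by linarith
      then show ?thesis using \<open>e > 0\<close> by (simp add: real_less_lsqrt)
    qed
    then show "\<exists>N. \<forall>i\<ge>N. \<forall>j\<ge>N. nm (X i - X j) < e" by blast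
  qed
  then obtain u where u: "u \<in> V" and lim: "(\<lambda>n. nm (X n - u)) \<longlonglongrightarrow> 0"
    using seq_completeD[OF compl XV cauchy] by blast
  have l_diff: "l (x - y) = l x - l y" if "x \<in> V" "y \<in> V" for x y
    using l_add[of x "- y"] l_scale[of y "-1"] that by simp
  have "(\<lambda>n. l (X n) - l u) \<longlonglongrightarrow> 0"
  proof (rule Lim_null_comparison)
    show "\<forall>\<^sub>F n in sequentially. norm (l (X n) - l u) \<le> M * nm (X n - u)"
      using l_bound[of "X _ - u"] XV u by (simp add: l_diff)
    show "(\<lambda>n. M * nm (X n - u)) \<longlonglongrightarrow> 0"
      using lim tendsto_mult_right_zero by blast
  qed
  then have lim_l: "(\<lambda>n. l (X n)) \<longlonglongrightarrow> l u" by (simp add: LIM_zero_iff)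
  have lim_J: "(\<lambda>n. J (X n)) \<longlonglongrightarrow> J u"
  proof -
    have "(\<lambda>n. (nm (X n))\<^sup>2 - 2 * l (X n)) \<longlonglongrightarrow> (nm u)\<^sup>2 - 2 * l u"
      by (intro tendsto_intros nm_tendsto lim_l XV u lim)
    then show ?thesis using XV u by (simp add: J_def nm_sq del: real_sqrt_pow2)
  qed
  have "(\<lambda>n. m + inverse (real (Suc n))) \<longlonglongrightarrow> m + 0"
    by (intro tendsto_intros LIMSEQ_inverse_real_of_nat)
  then have "J u \<le> m + 0"
  proof (rule LIMSEQ_le[OF lim_J])
    show "\<exists>N. \<forall>n\<ge>N. J (X n) \<le> m + inverse (real (Suc n))"
      by (intro exI[of _ 0] allI impI less_imp_le XJ)
  qed
  then have Ju: "J u \<le> m" by simp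
  have "ip u v = l v" if v: "v \<in> V" for v
  proof (rule ccontr)
    assume ne: "ip u v \<noteq> l v"
    define d where "d = ip u v - l v"
    \<comment> \<open>Minimiser of \<open>2 * t * d + t\<^sup>2 * (ip v v + 1)\<close>. The added 1
      keeps the denominator positive when v is a null vector.\<close>
    define t where "t = - d / (ip v v + 1)"
    have pos: "ip v v + 1 > 0" using ip_self_nonneg[OF v] by simp
    have "J (u + t *\<^sub>R v) = J u + 2 * t * d + t\<^sup>2 * ip v v"
      using u v ip_commute[of v u] l_add[of u "t *\<^sub>R v"] l_scale[of v t]
      by (simp add: J_def d_def ip_left ip_right algebra_simps power2_eq_square)
    moreover have "m \<le> J (u + t *\<^sub>R v)" using m_le u v by simp
    ultimately have "0 \<le> 2 * t * d + t\<^sup>2 * ip v v" using Ju by linarith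
    also have "\<dots> \<le> 2 * t * d + t\<^sup>2 * (ip v v + 1)" by (simp add: distrib_left)
    also have "\<dots> = - d\<^sup>2 / (ip v v + 1)"
    proof -
      have "t * (ip v v + 1) = - d" using pos by (simp add: t_def)
      then have "t\<^sup>2 * (ip v v + 1) = - t * d" by (simp add: power2_eq_square mult.assoc)
      then show ?thesis by (simp add: t_def power2_eq_square)
    qed
    also have "\<dots> < 0" using ne pos by (simp add: d_def)
    finally show False by simp
  qed
  then show ?thesis using u by blast
qed

text \<open>By induction on the spanning set, orthogonalising each new vector against the previous ones.
  A null vector that appears in this way is harmless, because the functional vanishes on it.\<close>

lemma riesz_finite_dim:
  assumes "finite B" "B \<subseteq> V"
    and l_add: "\<And>x y. \<lbrakk>x \<in> V; y \<in> V\<rbrakk> \<Longrightarrow> l (x + y) = l x + l y"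
    and l_scale: "\<And>c x. x \<in> V \<Longrightarrow> l (c *\<^sub>R x) = c * l x"
    and l_bound: "\<And>x. x \<in> V \<Longrightarrow> \<bar>l x\<bar> \<le> M * nm x"
  shows "\<exists>u\<in>span B. \<forall>v\<in>span B. ip u v = l v"
  using assms
proof (induction B arbitrary: l M rule: finite_induct)
  case empty
  then show ?case using empty.prems(3)[of 0 0] by (simp add: ip_zero_left)
next
  case (insert b B)
  have bV: "b \<in> V" and BV: "B \<subseteq> V" using insert.prems by auto
  have spanV: "span B \<subseteq> V" using BV subspace_V by (simp add: span_minimal)
  have "\<exists>u\<in>span B. \<forall>v\<in>span B. ip u v = l v"
    by (rule insert.IH[OF BV insert.prems(2-4)])
  then obtain u0 where u0: "u0 \<in> span B" "\<And>v. v \<in> span B \<Longrightarrow> ip u0 v = l v" by blast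
  \<comment> \<open>The induction hypothesis for the functional \<open>ip b\<close>, bounded with
    constant \<open>nm b\<close>, yields an orthogonal projection p of b onto
    \<open>span B\<close>.\<close>
  have "\<exists>u\<in>span B. \<forall>v\<in>span B. ip u v = ip b v"
    by (rule insert.IH[OF BV]) (auto simp: ip_right bV intro: Cauchy_Schwarz)
  then obtain p where p: "p \<in> span B" "\<And>v. v \<in> span B \<Longrightarrow> ip p v = ip b v" by blast
  define d where "d = b - p"
  have dV: "d \<in> V" using bV p spanV by (auto simp: d_def)
  have u0V: "u0 \<in> V" using u0 spanV by auto
  have d_orth: "ip d v = 0" if "v \<in> span B" for v
  proof -
    have "v \<in> V" "p \<in> V" using that p(1) spanV by auto
    then show ?thesis using p(2)[OF that] bV by (simp add: d_def ip_left)
  qed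
  have d_span: "d \<in> span (insert b B)"
    unfolding d_def using p(1) span_mono[OF subset_insertI[of B b]]
    by (intro span_diff span_base[of b]) auto
  have decomp: "\<exists>k w. w \<in> span B \<and> v = w + k *\<^sub>R d" if v: "v \<in> span (insert b B)" for v
  proof -
    obtain k where k: "v - k *\<^sub>R b \<in> span B" using v by (auto simp: span_insert)
    then have "(v - k *\<^sub>R b) + k *\<^sub>R p \<in> span B" using p(1) by (intro span_add span_scale)
    moreover have "v = ((v - k *\<^sub>R b) + k *\<^sub>R p) + k *\<^sub>R d" by (simp add: d_def algebra_simps)
    ultimately show ?thesis by blast
  qed
  have span_sub: "span B \<subseteq> span (insert b B)" by (simp add: span_mono subset_insertI)
  show ?case
  proof (cases "ip d d = 0")
    case True
    have "l d = 0" using True insert.prems(4)[OF dV] by simp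
    have "ip u0 d = 0" using d_orth[OF u0(1)] ip_commute[OF dV u0V] by simp
    have "ip u0 v = l v" if v: "v \<in> span (insert b B)" for v
    proof -
      obtain k w where w: "w \<in> span B" "v = w + k *\<^sub>R d" using decomp[OF v] by blast
      then have "w \<in> V" using spanV by auto
      then show ?thesis
        using w u0 u0V dV \<open>l d = 0\<close> \<open>ip u0 d = 0\<close> insert.prems(2)[of w "k *\<^sub>R d"] insert.prems(3)[of d k]
        by (simp add: ip_right)
    qed
    then show ?thesis using u0(1) span_sub by blast
  next
    case False
    \<comment> \<open>The coefficient gives \<open>ip u d = l d\<close>, because
      \<open>ip u0 d = 0\<close>. Values against \<open>span B\<close> are not disturbed, since d is
      orthogonal to it.\<close>
    define u where "u = u0 + (l d / ip d d) *\<^sub>R d"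
    have "ip u0 d = 0" using d_orth[OF u0(1)] ip_commute[OF dV u0V] by simp
    have "ip u v = l v" if v: "v \<in> span (insert b B)" for v
    proof -
      obtain k w where w: "w \<in> span B" "v = w + k *\<^sub>R d" using decomp[OF v] by blast
      then have "w \<in> V" using spanV by auto
      then show ?thesis
        using w u0 u0V dV \<open>ip u0 d = 0\<close> d_orth[OF w(1)] False
          insert.prems(2)[of w "k *\<^sub>R d"] insert.prems(3)[of d k]
        by (simp add: u_def ip_right ip_left)
    qed
    moreover have "u \<in> span (insert b B)"
      unfolding u_def using u0(1) span_sub d_span by (auto intro!: span_add span_scale)
    ultimately show ?thesis by blast
  qed
qed

text \<open>The uniform boundedness principle by Sokal's argument: the vector at which the functionals are unbounded is the
  sum of steps of length \<open>3\<^sup>-\<^sup>n\<close>: at least one of the two signs of the step makes the \<open>n\<close>-th functional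
  large, and the later steps are too short to undo this.\<close>

lemma weakly_bounded_imp_bounded:
  assumes compl: "seq_complete" and EV: "E \<subseteq> V"
    and weak: "\<And>g. g \<in> V \<Longrightarrow> \<exists>M. \<forall>e\<in>E. \<bar>ip e g\<bar> \<le> M"
  shows "\<exists>K. \<forall>e\<in>E. nm e \<le> K"
proof (rule ccontr)
  assume "\<not> ?thesis"
  \<comment> \<open>Growth rate 4 is chosen to beat the step length \<open>(1/3) ^ n\<close>: the
    product still grows like \<open>(4/3) ^ n\<close>.\<close>
  then have "\<forall>n. \<exists>e\<in>E. nm e > 4 ^ n" by (meson not_le)
  then obtain e where eE: "\<And>n. e n \<in> E" and e_large: "\<And>n. nm (e n) > 4 ^ n" by metis
  have eV [simp]: "e n \<in> V" for n using eE EV by auto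
  have e_pos: "nm (e n) > 0" for n using e_large[of n] by (meson less_trans zero_less_numeral zero_less_power)
  define r where "r n = (1/3::real) ^ n" for n
  define st where "st n = (r n / nm (e n)) *\<^sub>R e n" for n
  have stV [simp]: "st n \<in> V" for n by (simp add: st_def)
  have st_nm: "nm (st n) = r n" for n
    using e_pos[of n] nm_scale[OF eV[of n], of "r n / nm (e n)"] by (simp add: st_def r_def)
  have st_ip: "ip (e n) (st n) = r n * nm (e n)" for n
    using nm_sq[OF eV[of n]] e_pos[of n]
    by (simp add: st_def ip_right field_simps power2_eq_square del: real_sqrt_pow2)
  have step: "\<exists>y. (y = x + st n \<or> y = x - st n) \<and> \<bar>ip (e n) y\<bar> \<ge> r n * nm (e n)" if "x \<in> V" for x n
  proof -
    have "ip (e n) (x + st n) - ip (e n) (x - st n) = 2 * (r n * nm (e n))"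
      using that by (simp add: ip_right st_ip)
    moreover have "r n * nm (e n) \<ge> 0" using e_pos[of n] by (simp add: r_def)
    ultimately have "\<bar>ip (e n) (x + st n)\<bar> \<ge> r n * nm (e n) \<or> \<bar>ip (e n) (x - st n)\<bar> \<ge> r n * nm (e n)" by linarith
    then show ?thesis by blast
  qed
  have "\<exists>x. \<forall>n. x n \<in> V \<and> ((x (Suc n) = x n + st n \<or> x (Suc n) = x n - st n) \<and>
      \<bar>ip (e n) (x (Suc n))\<bar> \<ge> r n * nm (e n))"
  proof (rule dependent_nat_choice)
    show "\<exists>x. x \<in> V" using V_zero by blast
    fix x n assume "x \<in> V"
    then show "\<exists>y. y \<in> V \<and> (y = x + st n \<or> y = x - st n) \<and> \<bar>ip (e n) y\<bar> \<ge> r n * nm (e n)"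
      using step[of x n] stV V_add V_diff by metis
  qed
  then obtain x where xV [simp]: "\<And>n. x n \<in> V"
    and x_step: "\<And>n. x (Suc n) = x n + st n \<or> x (Suc n) = x n - st n"
    and x_large: "\<And>n. \<bar>ip (e n) (x (Suc n))\<bar> \<ge> r n * nm (e n)" by blast
  have x_step_nm: "nm (x (Suc n) - x n) = r n" for n
    using x_step[of n] st_nm[of n] nm_uminus[OF stV, of n] by auto
  \<comment> \<open>The right-hand side is exactly the geometric sum of the k step lengths starting
    with \<open>r n\<close>, which makes the induction go through.\<close>
  have x_dist: "nm (x (n + k) - x n) \<le> 3 / 2 * r n - 3 / 2 * r (n + k)" for n k
  proof (induction k)
    case 0
    then show ?case by (simp add: ip_zero_left)
  next
    case (Suc k)
    have "nm (x (Suc (n + k)) - x n) \<le> nm (x (Suc (n + k)) - x (n + k)) + nm (x (n + k) - x n)"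
      by (intro nm_triangle) auto
    also have "\<dots> \<le> r (n + k) + (3 / 2 * r n - 3 / 2 * r (n + k))"
      using Suc x_step_nm[of "n + k"] by simp
    finally show ?case by (simp add: r_def)
  qed
  have r_lim: "r \<longlonglongrightarrow> 0" unfolding r_def by (rule LIMSEQ_realpow_zero) auto
  have x_dist': "nm (x m - x n) \<le> 3 / 2 * r n" if "n \<le> m" for n m
  proof -
    have "r m \<ge> 0" by (simp add: r_def)
    then show ?thesis using x_dist[of n "m - n"] that by simp
  qed
  have x_cauchy: "\<forall>\<epsilon>>0. \<exists>N. \<forall>m\<ge>N. \<forall>n\<ge>N. nm (x m - x n) < \<epsilon>"
  proof (intro allI impI)
    fix \<epsilon> :: real assume "\<epsilon> > 0"
    then have "\<forall>\<^sub>F n in sequentially. r n < \<epsilon> / 3"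
      using order_tendstoD(2)[OF r_lim, of "\<epsilon> / 3"] by simp
    then obtain N where N: "\<And>n. n \<ge> N \<Longrightarrow> r n < \<epsilon> / 3" by (auto simp: eventually_sequentially)
    have "nm (x m - x n) < \<epsilon>" if "m \<ge> N" "n \<ge> N" for m n
      using x_dist'[of m n] x_dist'[of n m] nm_diff_commute[of "x m" "x n"] N[OF that(1)] N[OF that(2)]  \<open>\<epsilon> > 0\<close>
      by (cases "m \<le> n") auto
    then show "\<exists>N. \<forall>m\<ge>N. \<forall>n\<ge>N. nm (x m - x n) < \<epsilon>" by blast
  qed
  then obtain y where y [simp]: "y \<in> V" and y_lim: "(\<lambda>n. nm (x n - y)) \<longlonglongrightarrow> 0"
    using seq_completeD[OF compl xV x_cauchy] by blast
  have y_dist: "nm (x n - y) \<le> 3 / 2 * r n" for n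
  proof (rule LIMSEQ_le_const)
    show "(\<lambda>m. 3 / 2 * r n + nm (x m - y)) \<longlonglongrightarrow> 3 / 2 * r n"
      using tendsto_add[OF tendsto_const y_lim, of "3 / 2 * r n"] by simp
    show "\<exists>N. \<forall>m\<ge>N. nm (x n - y) \<le> 3 / 2 * r n + nm (x m - y)"
    proof (intro exI[of _ n] allI impI)
      fix m assume "m \<ge> n"
      show "nm (x n - y) \<le> 3 / 2 * r n + nm (x m - y)"
        using nm_triangle[of "x n" "x m" y] x_dist'[OF \<open>m \<ge> n\<close>] nm_diff_commute[of "x n" "x m"] by simp
    qed
  qed
  obtain M where M: "\<And>n. \<bar>ip (e n) y\<bar> \<le> M" using weak[OF y] eE by blast
  \<comment> \<open>All steps after the n-th move the point by at most
    \<open>3 / 2 * r (Suc n) = r n / 2\<close>, so at least half of the value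
    \<open>r n * nm (e n)\<close> secured by that step survives in the limit y.\<close>
  have "1 / 2 * (4/3) ^ n \<le> M" for n
  proof -
    have "r n * nm (e n) \<le> \<bar>ip (e n) (x (Suc n))\<bar>" by (rule x_large)
    also have "\<dots> \<le> \<bar>ip (e n) (x (Suc n) - y)\<bar> + \<bar>ip (e n) y\<bar>" by (simp add: ip_right)
    also have "\<dots> \<le> nm (e n) * (3 / 2 * r (Suc n)) + M"
    proof (intro add_mono M)
      have "\<bar>ip (e n) (x (Suc n) - y)\<bar> \<le> nm (e n) * nm (x (Suc n) - y)" by (rule Cauchy_Schwarz) auto
      also have "\<dots> \<le> nm (e n) * (3 / 2 * r (Suc n))"
        using y_dist e_pos[of n] by (intro mult_left_mono) auto
      finally show "\<bar>ip (e n) (x (Suc n) - y)\<bar> \<le> nm (e n) * (3 / 2 * r (Suc n))" .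
    qed
    finally have "1 / 2 * (r n * nm (e n)) \<le> M" by (simp add: r_def mult.commute)
    moreover have "(4/3) ^ n \<le> r n * nm (e n)"
    proof -
      have "r n * 4 ^ n \<le> r n * nm (e n)"
        using e_large[of n] by (intro mult_left_mono) (auto simp: r_def)
      then show ?thesis by (simp add: r_def power_divide)
    qed
    ultimately show ?thesis by linarith
  qed
  moreover obtain n where n: "2 * M < (4/3) ^ n" using real_arch_pow[of "4/3" "2 * M"] by auto
  moreover from this have "M < 1 / 2 * (4/3) ^ n" by linarith
  ultimately show False by (meson not_le)
qed

end

section \<open>The space of square integrable functions\<close>

lemma L2_inner_integrable:
  assumes "f \<in> L2 \<Omega>" "g \<in> L2 \<Omega>"
  shows "integrable (lebesgue_on \<Omega>) (\<lambda>x. f x \<bullet> g x)"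
proof (rule Bochner_Integration.integrable_bound)
  show "integrable (lebesgue_on \<Omega>) (\<lambda>x. (norm (f x))\<^sup>2 + (norm (g x))\<^sup>2)"
    using assms by (auto simp: L2_def)
  show "(\<lambda>x. f x \<bullet> g x) \<in> borel_measurable (lebesgue_on \<Omega>)"
    using assms by (auto simp: L2_def)
  show "AE x in lebesgue_on \<Omega>. norm (f x \<bullet> g x) \<le> norm ((norm (f x))\<^sup>2 + (norm (g x))\<^sup>2)"
  proof (intro AE_I2)
    fix x
    have "norm (f x \<bullet> g x) \<le> norm (f x) * norm (g x)"
      using Cauchy_Schwarz_ineq2[of "f x" "g x"] by simp
    also have "\<dots> \<le> (norm (f x))\<^sup>2 + (norm (g x))\<^sup>2"
      using sum_squares_bound[of "norm (f x)" "norm (g x)"] mult_nonneg_nonneg[OF norm_ge_zero[of "f x"] norm_ge_zero[of "g x"]]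
      by linarith
    finally show "norm (f x \<bullet> g x) \<le> norm ((norm (f x))\<^sup>2 + (norm (g x))\<^sup>2)" by simp
  qed
qed

lemma L2_measurable [measurable_dest]: "f \<in> L2 \<Omega> \<Longrightarrow> f \<in> borel_measurable (lebesgue_on \<Omega>)"
  by (simp add: L2_def)

lemma subspace_L2: "subspace (L2 \<Omega> :: (real ^ 'd \<Rightarrow> 'b::euclidean_space) set)"
proof (rule subspaceI)
  show "(0 :: real ^ 'd \<Rightarrow> 'b) \<in> L2 \<Omega>" by (simp add: L2_def zero_fun_def)
next
  fix f g :: "real ^ 'd \<Rightarrow> 'b" assume fg: "f \<in> L2 \<Omega>" "g \<in> L2 \<Omega>"
  have "integrable (lebesgue_on \<Omega>) (\<lambda>x. (norm (f x))\<^sup>2 + 2 * (f x \<bullet> g x) + (norm (g x))\<^sup>2)"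
    using fg L2_inner_integrable[OF fg] by (auto simp: L2_def)
  also have "(\<lambda>x. (norm (f x))\<^sup>2 + 2 * (f x \<bullet> g x) + (norm (g x))\<^sup>2) = (\<lambda>x. (norm (f x + g x))\<^sup>2)"
    by (auto simp: fun_eq_iff power2_norm_eq_inner inner_add inner_commute)
  finally show "f + g \<in> L2 \<Omega>" using fg by (auto simp: L2_def plus_fun_def)
next
  fix c and f :: "real ^ 'd \<Rightarrow> 'b" assume "f \<in> L2 \<Omega>"
  then show "c *\<^sub>R f \<in> L2 \<Omega>"
    by (auto simp: L2_def scaleR_fun_def power_mult_distrib)
qed

interpretation L2: semi_inner_space "L2 \<Omega>" "L2_inner \<Omega>"
  rewrites "\<And>f. sqrt (L2_inner \<Omega> f f) = L2_norm \<Omega> f"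
  for \<Omega> :: "(real ^ 'd) set"
proof -
  show "semi_inner_space (L2 \<Omega> :: (real ^ 'd \<Rightarrow> 'b::euclidean_space) set) (L2_inner \<Omega>)"
  proof
    show "subspace (L2 \<Omega> :: (real ^ 'd \<Rightarrow> 'b::euclidean_space) set)" by (rule subspace_L2)
    show "L2_inner \<Omega> f g = L2_inner \<Omega> g f" for f g :: "real ^ 'd \<Rightarrow> 'b::euclidean_space"
      by (simp add: L2_inner_def inner_commute)
  qed (simp_all add: L2_inner_def inner_add_left L2_inner_integrable)
  show "sqrt (L2_inner \<Omega> f f) = L2_norm \<Omega> f" for f :: "real ^ 'd \<Rightarrow> 'b::euclidean_space"
    by (simp add: L2_norm_def)
qed

lemma L2_norm_nonneg [simp]: "0 \<le> L2_norm \<Omega> f"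
  by (simp add: L2_norm_def L2_inner_def)

lemma L2_norm_zero [simp]: "L2_norm \<Omega> 0 = 0"
  by (simp add: L2_norm_def L2_inner_def)

lemma L2_norm_sq: "(L2_norm \<Omega> f)\<^sup>2 = (LINT x|lebesgue_on \<Omega>. (norm (f x))\<^sup>2)"
  by (simp add: L2_norm_def L2_inner_def power2_norm_eq_inner)

lemma L2_norm_norm: "L2_norm \<Omega> (\<lambda>x. norm (f x)) = L2_norm \<Omega> f"
  by (simp add: L2_norm_def L2_inner_def power2_norm_eq_inner flip: power2_eq_square)

lemma L2_norm_mem: "f \<in> L2 \<Omega> \<Longrightarrow> (\<lambda>x. norm (f x)) \<in> L2 \<Omega>"
  by (auto simp: L2_def)

lemma L2_norm_nn_integral:
  assumes "f \<in> L2 \<Omega>"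
  shows "(\<integral>\<^sup>+x. ennreal ((norm (f x))\<^sup>2) \<partial>lebesgue_on \<Omega>) = ennreal ((L2_norm \<Omega> f)\<^sup>2)"
  using assms by (simp add: L2_norm_sq nn_integral_eq_integral L2_def)

text \<open>Stated with the nonnegative integral because Fatou's lemma bounds it before the function
  is known to be square integrable; membership and norm bound then come together.\<close>

lemma L2_if_nn_integral_le:
  assumes f: "f \<in> borel_measurable (lebesgue_on \<Omega>)"
    and le: "(\<integral>\<^sup>+x. ennreal ((norm (f x))\<^sup>2) \<partial>lebesgue_on \<Omega>) \<le> ennreal (e\<^sup>2)" and "0 \<le> e"
  shows "f \<in> L2 \<Omega>" "L2_norm \<Omega> f \<le> e"
proof -
  have "integrable (lebesgue_on \<Omega>) (\<lambda>x. (norm (f x))\<^sup>2)"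
    using f le by (intro integrableI_bounded) (auto simp: le_less_trans)
  then show "f \<in> L2 \<Omega>" using f by (simp add: L2_def)
  then have "ennreal ((L2_norm \<Omega> f)\<^sup>2) \<le> ennreal (e\<^sup>2)"
    using le by (simp add: L2_norm_nn_integral)
  then show "L2_norm \<Omega> f \<le> e" using \<open>0 \<le> e\<close> by (simp add: power2_le_iff_abs_le)
qed

text \<open>The Riesz-Fischer argument. A subsequence with summable steps converges almost
  everywhere: on a set of finite measure Cauchy-Schwarz against the constant 1 turns the
  \<open>L2\<close> bounds on the steps into \<open>L1\<close> bounds. Fatou's lemma then gives norm
  convergence of the whole sequence.\<close>

lemma L2_complete:
  fixes \<Omega> :: "(real ^ 'd) set"
  assumes "\<Omega> \<in> lmeasurable"
  shows "semi_inner_space.seq_complete (L2 \<Omega> :: (real ^ 'd \<Rightarrow> 'b::euclidean_space) set) (L2_inner \<Omega>)"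
  unfolding L2.seq_complete_def
proof (intro allI impI)
  fix X :: "nat \<Rightarrow> real ^ 'd \<Rightarrow> 'b"
  assume X: "\<forall>n. X n \<in> L2 \<Omega>" and cauchy: "\<forall>e>0. \<exists>N. \<forall>m\<ge>N. \<forall>n\<ge>N. L2_norm \<Omega> (X m - X n) < e"
  let ?M = "lebesgue_on \<Omega>"
  interpret finite_measure ?M by (rule finite_measure_lebesgue_on[OF assms])
  have XL [simp]: "X n \<in> L2 \<Omega>" for n using X by simp
  have [measurable]: "X n \<in> borel_measurable ?M" for n using X by (simp add: L2_measurable)
  have "\<forall>k. \<exists>N. \<forall>m\<ge>N. \<forall>n\<ge>N. L2_norm \<Omega> (X m - X n) < (1/2) ^ k"
    using cauchy by simp
  then obtain N where N: "\<And>k m n. \<lbrakk>m \<ge> N k; n \<ge> N k\<rbrakk> \<Longrightarrow> L2_norm \<Omega> (X m - X n) < (1/2) ^ k"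
    by metis
  \<comment> \<open>The sum makes r monotone and at least \<open>N k\<close>. The summand k also
    makes r at least the identity, which is used when X n is compared with the tail of the
    subsequence.\<close>
  define r where "r k = k + (\<Sum>j\<le>k. N j)" for k
  have r_ge: "r k \<ge> N k" for k unfolding r_def by (intro trans_le_add2 member_le_sum) auto
  have r_mono: "mono r" unfolding r_def by (auto simp: mono_iff_le_Suc)
  define d where "d k = X (r (Suc k)) - X (r k)" for k
  have dL: "d k \<in> L2 \<Omega>" for k by (simp add: d_def)
  have [measurable]: "d k \<in> borel_measurable ?M" for k using dL by (simp add: L2_measurable)
  have d_small: "L2_norm \<Omega> (d k) < (1/2) ^ k" for k
    unfolding d_def using r_ge[of k] monoD[OF r_mono, of k "Suc k"] by (intro N) auto
  have oneL: "(\<lambda>x. 1 :: real) \<in> L2 \<Omega>" by (simp add: L2_def)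
  define c where "c = L2_norm \<Omega> (\<lambda>x. 1 :: real)"
  have c: "c \<ge> 0" by (simp add: c_def)
  have d_L1: "(\<integral>\<^sup>+x. ennreal (norm (d k x)) \<partial>?M) \<le> ennreal (c * (1/2) ^ k)" for k
  proof -
    have int: "integrable ?M (\<lambda>x. norm (d k x))"
      using L2_inner_integrable[OF L2_norm_mem[OF dL] oneL] by simp
    have "(\<integral>x. norm (d k x) \<partial>?M) = L2_inner \<Omega> (\<lambda>x. norm (d k x)) (\<lambda>x. 1)"
      by (simp add: L2_inner_def)
    also have "\<dots> \<le> L2_norm \<Omega> (d k) * c"
      using L2.Cauchy_Schwarz[OF L2_norm_mem[OF dL[of k]] oneL] by (simp add: L2_norm_norm c_def)
    also have "\<dots> \<le> c * (1/2) ^ k" using d_small[of k] c by (simp add: mult.commute mult_left_mono)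
    finally show ?thesis using int by (simp add: nn_integral_eq_integral ennreal_leI)
  qed
  have "(\<integral>\<^sup>+x. (\<Sum>k. ennreal (norm (d k x))) \<partial>?M) = (\<Sum>k. \<integral>\<^sup>+x. ennreal (norm (d k x)) \<partial>?M)"
    by (rule nn_integral_suminf) auto
  also have "\<dots> \<le> (\<Sum>k. ennreal (c * (1/2) ^ k))"
    by (intro suminf_le d_L1) auto
  also have "\<dots> = ennreal (\<Sum>k. c * (1/2) ^ k)"
    using c by (intro suminf_ennreal2) (auto intro!: summable_mult summable_geometric)
  finally have "(\<integral>\<^sup>+x. (\<Sum>k. ennreal (norm (d k x))) \<partial>?M) < \<infinity>"
    by (simp add: le_less_trans)
  then have "AE x in ?M. (\<Sum>k. ennreal (norm (d k x))) \<noteq> \<infinity>"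
    by (intro nn_integral_PInf_AE) auto
  then have AE_conv: "AE x in ?M. convergent (\<lambda>k. X (r k) x)"
  proof eventually_elim
    case (elim x)
    then have "summable (\<lambda>k. norm (d k x))"
      by (intro summable_suminf_not_top) auto
    then have "summable (\<lambda>k. d k x)" by (rule summable_norm_cancel)
    then have "convergent (\<lambda>n. \<Sum>k<n. d k x)" by (simp add: summable_iff_convergent)
    moreover have "(\<Sum>k<n. d k x) = X (r n) x - X (r 0) x" for n
      by (simp add: d_def sum_lessThan_telescope[of "\<lambda>k. X (r k) x"])
    ultimately have "convergent (\<lambda>n. X (r n) x - X (r 0) x)" by simp
    then show ?case
      using convergent_add_const_right_iff[of "\<lambda>n. X (r n) x" "- X (r 0) x"] by simp
  qed
  define f where "f x = lim (\<lambda>k. X (r k) x)" for x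
  have f_meas [measurable]: "f \<in> borel_measurable ?M"
    unfolding f_def by (rule borel_measurable_lim_metric) simp
  have AE_lim: "AE x in ?M. (\<lambda>k. X (r k) x) \<longlonglongrightarrow> f x"
    using AE_conv by eventually_elim (simp add: f_def convergent_LIMSEQ_iff)
  have tail: "X n - f \<in> L2 \<Omega> \<and> L2_norm \<Omega> (X n - f) \<le> e"
    if "e > 0" and K: "\<And>k. k \<ge> n \<Longrightarrow> L2_norm \<Omega> (X n - X k) \<le> e" for n e
  proof -
    have ev: "\<forall>\<^sub>F k in sequentially. L2_norm \<Omega> (X n - X (r k)) \<le> e"
      using eventually_ge_at_top[of n]
    proof eventually_elim
      case (elim k)
      then have "n \<le> r k" by (simp add: r_def)
      then show ?case by (rule K)
    qed
    have "(\<integral>\<^sup>+x. ennreal ((norm ((X n - f) x))\<^sup>2) \<partial>?M)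
        = (\<integral>\<^sup>+x. liminf (\<lambda>k. ennreal ((norm (X n x - X (r k) x))\<^sup>2)) \<partial>?M)"
    proof (rule nn_integral_cong_AE)
      show "AE x in ?M. ennreal ((norm ((X n - f) x))\<^sup>2) = liminf (\<lambda>k. ennreal ((norm (X n x - X (r k) x))\<^sup>2))"
        using AE_lim
      proof eventually_elim
        case (elim x)
        have "(\<lambda>k. ennreal ((norm (X n x - X (r k) x))\<^sup>2)) \<longlonglongrightarrow> ennreal ((norm (X n x - f x))\<^sup>2)"
          by (intro tendsto_intros tendsto_ennrealI elim)
        then show ?case by (simp add: lim_imp_Liminf del: tendsto_ennreal_iff)
      qed
    qed
    \<comment> \<open>Fatou's lemma: n stays fixed while the other index runs along the
      subsequence.\<close>
    also have "\<dots> \<le> liminf (\<lambda>k. \<integral>\<^sup>+x. ennreal ((norm (X n x - X (r k) x))\<^sup>2) \<partial>?M)"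
      by (rule nn_integral_liminf) simp
    also have "\<dots> = liminf (\<lambda>k. ennreal ((L2_norm \<Omega> (X n - X (r k)))\<^sup>2))"
      using L2_norm_nn_integral[of "X n - X (r _)" \<Omega>] by simp
    also have "\<dots> \<le> ennreal (e\<^sup>2)"
    proof (rule Liminf_le)
      show "\<forall>\<^sub>F k in sequentially. ennreal ((L2_norm \<Omega> (X n - X (r k)))\<^sup>2) \<le> ennreal (e\<^sup>2)"
        using ev by eventually_elim (simp add: power_mono)
    qed auto
    finally show ?thesis
      using L2_if_nn_integral_le[of "X n - f" \<Omega> e] \<open>e > 0\<close> by (simp add: fun_diff_def)
  qed
  show "\<exists>x\<in>L2 \<Omega>. (\<lambda>n. L2_norm \<Omega> (X n - x)) \<longlonglongrightarrow> 0"
  proof (rule bexI)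
    obtain n0 where "\<And>m n. \<lbrakk>m \<ge> n0; n \<ge> n0\<rbrakk> \<Longrightarrow> L2_norm \<Omega> (X m - X n) < 1"
      using cauchy by (metis zero_less_one)
    then have "X n0 - f \<in> L2 \<Omega>" using tail[of 1 n0] by (simp add: less_imp_le)
    then have "X n0 - (X n0 - f) \<in> L2 \<Omega>" by (rule L2.V_diff[OF XL])
    moreover have "X n0 - (X n0 - f) = f" by (simp add: fun_eq_iff)
    ultimately show "f \<in> L2 \<Omega>" by metis
    show "(\<lambda>n. L2_norm \<Omega> (X n - f)) \<longlonglongrightarrow> 0"
    proof (rule LIMSEQ_I)
      fix e :: real assume "e > 0"
      then obtain n1 where n1: "\<And>m n. \<lbrakk>m \<ge> n1; n \<ge> n1\<rbrakk> \<Longrightarrow> L2_norm \<Omega> (X m - X n) < e / 2"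
        using cauchy by (metis half_gt_zero)
      have "L2_norm \<Omega> (X n - f) < e" if "n \<ge> n1" for n
      proof -
        have "L2_norm \<Omega> (X n - f) \<le> e / 2"
          using tail[of "e / 2" n] n1[of n] that \<open>e > 0\<close> by (simp add: less_imp_le)
        then show ?thesis using \<open>e > 0\<close> by simp
      qed
      then show "\<exists>n1. \<forall>n\<ge>n1. norm (L2_norm \<Omega> (X n - f) - 0) < e" by auto
    qed
  qed
qed

section \<open>Test functions\<close>

lemma partial_eqI: "(\<phi> has_derivative D) (at x) \<Longrightarrow> partial i \<phi> x = D (axis i 1)"
  by (simp add: partial_def flip: frechet_derivative_at)

lemma partial_const [simp]: "partial i (\<lambda>x. c) = (\<lambda>x. 0)"
  by (rule ext) (rule partial_eqI[THEN trans], rule has_derivative_const, simp)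

lemma
  assumes "\<phi> differentiable at x" "\<psi> differentiable at x"
  shows partial_add: "partial i (\<lambda>x. \<phi> x + \<psi> x) x = partial i \<phi> x + partial i \<psi> x"
    and partial_mult: "partial i (\<lambda>x. \<phi> x * \<psi> x) x = \<phi> x * partial i \<psi> x + partial i \<phi> x * \<psi> x"
proof -
  note D = assms[unfolded frechet_derivative_works]
  show "partial i (\<lambda>x. \<phi> x + \<psi> x) x = partial i \<phi> x + partial i \<psi> x"
    using partial_eqI[OF has_derivative_add[OF D]] by (simp add: partial_def)
  show "partial i (\<lambda>x. \<phi> x * \<psi> x) x = \<phi> x * partial i \<psi> x + partial i \<phi> x * \<psi> x"
    using partial_eqI[OF has_derivative_mult[OF D]] by (simp add: partial_def)
qed

lemma partial_component: "partial i (\<lambda>x. x $ j) x = (if i = j then 1 else 0)"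
proof -
  have "((\<lambda>x. x $ j) has_derivative (\<lambda>x. x $ j)) (at x)"
    by (rule bounded_linear.has_derivative[OF bounded_linear_vec_nth]) (rule has_derivative_ident)
  then show ?thesis by (simp add: partial_eqI axis_def)
qed

lemma partial_comp_affine:
  assumes "(e has_real_derivative e') (at (a * x $ j + b))"
  shows "(\<lambda>x. e (a * x $ j + b)) differentiable at x"
    and "partial i (\<lambda>x. e (a * x $ j + b)) x = (if i = j then a * e' else 0)"
proof -
  have "((\<lambda>x. x $ j) has_derivative (\<lambda>x. x $ j)) (at x)"
    by (rule bounded_linear.has_derivative[OF bounded_linear_vec_nth]) (rule has_derivative_ident)
  then have "((\<lambda>x. a * x $ j + b) has_derivative (\<lambda>x. a * x $ j)) (at x)"
    by (auto intro!: derivative_eq_intros)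
  then have D: "((\<lambda>x. e (a * x $ j + b)) has_derivative (\<lambda>h. a * h $ j * e')) (at x)"
    using has_derivative_compose[of "\<lambda>x. a * x $ j + b" "\<lambda>x. a * x $ j" x UNIV e "(*) e'"] assms
    by (simp add: has_field_derivative_def mult.commute[of e'])
  then show "(\<lambda>x. e (a * x $ j + b)) differentiable at x" by (rule differentiableI)
  show "partial i (\<lambda>x. e (a * x $ j + b)) x = (if i = j then a * e' else 0)"
    using partial_eqI[OF D] by (simp add: axis_def)
qed

lemma k_times_diff_add:
  "k_times_diff k \<phi> \<Longrightarrow> k_times_diff k \<psi> \<Longrightarrow> k_times_diff k (\<lambda>x. \<phi> x + \<psi> x)"
proof (induction k arbitrary: \<phi> \<psi>)
  case (Suc k)
  have "partial i (\<lambda>x. \<phi> x + \<psi> x) = (\<lambda>x. partial i \<phi> x + partial i \<psi> x)" for i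
    using Suc.prems by (auto simp: fun_eq_iff differentiable_on_def intro!: partial_add)
  then show ?case using Suc by (auto intro: differentiable_on_add)
qed (auto intro: continuous_intros)

lemma k_times_diff_scale:
  "k_times_diff k \<phi> \<Longrightarrow> k_times_diff k (\<lambda>x. c * \<phi> x)"
proof (induction k arbitrary: \<phi>)
  case (Suc k)
  have "partial i (\<lambda>x. c * \<phi> x) = (\<lambda>x. c * partial i \<phi> x)" for i
    using Suc.prems partial_mult[of "\<lambda>x. c" _ \<phi> i] by (auto simp: fun_eq_iff differentiable_on_def)
  then show ?case using Suc by (auto intro: differentiable_on_mult differentiable_on_const)
qed (auto intro: continuous_intros)

lemma subspace_test_functions: "subspace (test_functions (\<Omega> :: (real ^ 'd) set))"
proof (rule subspaceI)
  show "(0 :: real ^ 'd \<Rightarrow> real) \<in> test_functions \<Omega>"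
  proof -
    have "k_times_diff k (\<lambda>x :: real ^ 'd. 0)" for k by (induction k) auto
    then show ?thesis by (simp add: test_functions_def zero_fun_def)
  qed
next
  fix \<phi> \<psi> assume \<phi>\<psi>: "\<phi> \<in> test_functions \<Omega>" "\<psi> \<in> test_functions \<Omega>"
  have "closure {x. \<phi> x + \<psi> x \<noteq> 0} \<subseteq> closure ({x. \<phi> x \<noteq> 0} \<union> {x. \<psi> x \<noteq> 0})"
    by (intro closure_mono) auto
  moreover have "bounded {x. \<phi> x + \<psi> x \<noteq> 0}"
    by (rule bounded_subset[of "{x. \<phi> x \<noteq> 0} \<union> {x. \<psi> x \<noteq> 0}"])
      (use \<phi>\<psi> in \<open>auto simp: test_functions_def\<close>)
  ultimately show "\<phi> + \<psi> \<in> test_functions \<Omega>"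
    using \<phi>\<psi> by (auto simp: test_functions_def plus_fun_def closure_Un intro: k_times_diff_add)
next
  fix c \<phi> assume \<phi>: "\<phi> \<in> test_functions \<Omega>"
  have sub: "{x. c * \<phi> x \<noteq> 0} \<subseteq> {x. \<phi> x \<noteq> 0}" by auto
  then have "bounded {x. c * \<phi> x \<noteq> 0}"
    using \<phi> bounded_subset[OF _ sub] by (auto simp: test_functions_def)
  then show "c *\<^sub>R \<phi> \<in> test_functions \<Omega>"
    using \<phi> closure_mono[OF sub] by (auto simp: test_functions_def scaleR_fun_def intro: k_times_diff_scale)
qed

lemma test_function_C1:
  assumes "\<phi> \<in> test_functions \<Omega>"
  shows test_function_differentiable: "\<phi> differentiable at x"
    and test_function_continuous: "continuous_on UNIV \<phi>"
    and test_function_partial_continuous: "continuous_on UNIV (partial i \<phi>)"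
proof -
  have k: "k_times_diff k \<phi>" for k using assms by (simp add: test_functions_def)
  show "\<phi> differentiable at x" "continuous_on UNIV \<phi>" "continuous_on UNIV (partial i \<phi>)"
    using k[of 0] k[of "Suc 0"] by (simp_all add: differentiable_on_def)
qed

lemma test_function_support_bounded: "\<phi> \<in> test_functions \<Omega> \<Longrightarrow> bounded {x. \<phi> x \<noteq> 0}"
  and test_function_zero_outside: "\<phi> \<in> test_functions \<Omega> \<Longrightarrow> x \<notin> \<Omega> \<Longrightarrow> \<phi> x = 0"
  using closure_subset[of "{x. \<phi> x \<noteq> 0}"] by (auto simp: test_functions_def)

text \<open>Off the closed support the function vanishes on a whole neighbourhood, so its derivative
  vanishes too. With the pointwise set of nonzeros alone this would need a separate argument at its
  boundary.\<close>

lemma partial_zero_outside_support: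
  assumes "x \<notin> closure {x. \<phi> x \<noteq> 0}"
  shows "partial i \<phi> x = 0"
proof -
  have "(\<phi> has_derivative (\<lambda>h. 0)) (at x)"
  proof (rule has_derivative_transform_within_open)
    show "((\<lambda>x. 0) has_derivative (\<lambda>h. 0)) (at x)" by simp
    show "open (- closure {x. \<phi> x \<noteq> 0})" by (simp only: open_Compl closed_closure)
    show "x \<in> - closure {x. \<phi> x \<noteq> 0}" using assms by simp
    show "0 = \<phi> y" if "y \<in> - closure {x. \<phi> x \<noteq> 0}" for y
      using that closure_subset[of "{x. \<phi> x \<noteq> 0}"] by auto
  qed
  then show ?thesis by (simp add: partial_eqI)
qed

lemma test_function_partial_zero_outside: "\<phi> \<in> test_functions \<Omega> \<Longrightarrow> x \<notin> \<Omega> \<Longrightarrow> partial i \<phi> x = 0"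
  by (rule partial_zero_outside_support) (auto simp: test_functions_def)

section \<open>Integration by parts for test functions\<close>

text \<open>The integral of the difference quotient vanishes by translation invariance; let the increment
  tend to zero.\<close>

lemma integral_partial_eq_0:
  fixes \<psi> :: "real ^ 'd \<Rightarrow> real"
  assumes diff: "\<And>x. \<psi> differentiable at x" and cont: "continuous_on UNIV (partial i \<psi>)"
    and bdd: "bounded {x. \<psi> x \<noteq> 0}"
  shows "(LINT x|lborel. partial i \<psi> x) = 0"
proof -
  let ?e = "axis i 1 :: real ^ 'd"
  have line: "((\<lambda>t. \<psi> (x + t *\<^sub>R ?e)) has_real_derivative partial i \<psi> (x + t *\<^sub>R ?e)) (at t)" for x t
  proof -
    have "(\<psi> has_derivative frechet_derivative \<psi> (at (x + t *\<^sub>R ?e))) (at (x + t *\<^sub>R ?e))"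
      using diff frechet_derivative_works by blast
    moreover have "((\<lambda>t. x + t *\<^sub>R ?e) has_derivative (\<lambda>h. h *\<^sub>R ?e)) (at t)"
      by (auto intro!: derivative_eq_intros)
    ultimately have D: "((\<lambda>t. \<psi> (x + t *\<^sub>R ?e)) has_derivative
        (\<lambda>h. frechet_derivative \<psi> (at (x + t *\<^sub>R ?e)) (h *\<^sub>R ?e))) (at t)"
      by (rule has_derivative_compose[rotated])
    have "linear (frechet_derivative \<psi> (at (x + t *\<^sub>R ?e)))"
      using diff by (rule linear_frechet_derivative)
    then show ?thesis
      using D by (simp add: has_field_derivative_def partial_def linear_cmul mult_commute_abs)
  qed
  have \<psi>_cont: "continuous_on UNIV \<psi>"
    using diff by (auto simp: continuous_on_eq_continuous_at intro: differentiable_imp_continuous_within)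
  obtain R where R: "\<And>x. \<psi> x \<noteq> 0 \<Longrightarrow> norm x \<le> R"
    using bdd by (auto simp: bounded_iff)
  \<comment> \<open>Increments are at most 1, so the difference quotients vanish outside radius R +
    1; a mean value point seen from inside that ball lies within radius R + 2.\<close>
  obtain M where M: "\<And>x. x \<in> cball 0 (R + 2) \<Longrightarrow> \<bar>partial i \<psi> x\<bar> \<le> M"
    using compact_continuous_image[OF continuous_on_subset[OF cont subset_UNIV] compact_cball[of 0 "R + 2"]]
    by (metis compact_imp_bounded bounded_iff imageI real_norm_def)
  define q where "q n x = (\<psi> (x + inverse (real (Suc n)) *\<^sub>R ?e) - \<psi> x) * real (Suc n)" for n x
  have int\<psi>: "integrable lborel \<psi>"
  proof -
    have "integrable lborel (\<lambda>x. indicator (cball 0 R) x *\<^sub>R \<psi> x)"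
      by (rule borel_integrable_compact) (auto intro: continuous_on_subset[OF \<psi>_cont])
    also have "(\<lambda>x. indicator (cball 0 R) x *\<^sub>R \<psi> x) = \<psi>"
      using R by (force simp: fun_eq_iff indicator_def)
    finally show ?thesis .
  qed
  have [measurable]: "\<psi> \<in> borel_measurable borel" using \<psi>_cont by (rule borel_measurable_continuous_onI)
  have [measurable]: "partial i \<psi> \<in> borel_measurable borel" using cont by (rule borel_measurable_continuous_onI)
  have shift: "integrable lborel (\<lambda>x. \<psi> (x + c))" "(LINT x|lborel. \<psi> (x + c)) = (LINT x|lborel. \<psi> x)" for c
  proof -
    have "integrable (distr lborel borel ((+) c)) \<psi>" using int\<psi> by (simp add: lborel_distr_plus)
    then show "integrable lborel (\<lambda>x. \<psi> (x + c))"
      by (subst (asm) integrable_distr_eq) (auto simp: add.commute)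
    have "(LINT x|lborel. \<psi> x) = (LINT x|distr lborel borel ((+) c). \<psi> x)"
      by (simp add: lborel_distr_plus)
    also have "\<dots> = (LINT x|lborel. \<psi> (x + c))"
      by (subst integral_distr) (auto simp: add.commute)
    finally show "(LINT x|lborel. \<psi> (x + c)) = (LINT x|lborel. \<psi> x)" by simp
  qed
  have q0: "(LINT x|lborel. q n x) = 0" for n
    unfolding q_def using shift int\<psi> by simp
  have "(\<lambda>n. LINT x|lborel. q n x) \<longlonglongrightarrow> (LINT x|lborel. partial i \<psi> x)"
  proof (rule integral_dominated_convergence)
    show "integrable lborel (\<lambda>x. indicator (cball 0 (R + 1) :: (real ^ 'd) set) x *\<^sub>R M)"
      by (rule borel_integrable_compact) auto
    show "AE x in lborel. (\<lambda>n. q n x) \<longlonglongrightarrow> partial i \<psi> x"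
    proof (rule AE_I2)
      fix x
      have "((\<lambda>h. (\<psi> (x + h *\<^sub>R ?e) - \<psi> x) / h) \<longlongrightarrow> partial i \<psi> x) (at 0)"
        using line[of x 0] by (simp add: DERIV_def)
      moreover have "filterlim (\<lambda>n. inverse (real (Suc n))) (at 0) sequentially"
        using LIMSEQ_inverse_real_of_nat by (simp add: filterlim_at del: of_nat_Suc)
      ultimately have "(\<lambda>n. (\<psi> (x + inverse (real (Suc n)) *\<^sub>R ?e) - \<psi> x) / inverse (real (Suc n))) \<longlonglongrightarrow> partial i \<psi> x"
        by (rule filterlim_compose)
      then show "(\<lambda>n. q n x) \<longlonglongrightarrow> partial i \<psi> x"
        by (simp add: q_def divide_inverse)
    qed
    fix n
    show "AE x in lborel. norm (q n x) \<le> indicator (cball 0 (R + 1)) x *\<^sub>R M"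
    proof (rule AE_I2)
      fix x
      define t where "t = inverse (real (Suc n))"
      have t: "0 < t" "t \<le> 1" by (auto simp: t_def field_simps)
      show "norm (q n x) \<le> indicator (cball 0 (R + 1)) x *\<^sub>R M"
      proof (cases "x \<in> cball 0 (R + 1)")
        case False
        have "norm x \<le> norm (x + t *\<^sub>R ?e) + norm (t *\<^sub>R ?e)" by (metis add_diff_cancel_right' norm_triangle_ineq4)
        then have "norm (x + t *\<^sub>R ?e) > R" "norm x > R" using False t by (auto simp: norm_axis_1)
        then have "\<psi> (x + t *\<^sub>R ?e) = 0" "\<psi> x = 0" using R by (meson not_le)+
        then show ?thesis using False by (simp add: q_def t_def)
      next
        case True
        \<comment> \<open>The mean value theorem gives a bound on the quotient that does not depend
          on the increment, as domination requires.\<close>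
        obtain z where z: "0 < z" "z < t" "\<psi> (x + t *\<^sub>R ?e) - \<psi> (x + 0 *\<^sub>R ?e) = (t - 0) * partial i \<psi> (x + z *\<^sub>R ?e)"
          using MVT2[OF t(1), of "\<lambda>t. \<psi> (x + t *\<^sub>R ?e)" "\<lambda>z. partial i \<psi> (x + z *\<^sub>R ?e)"] line by blast
        have "norm (x + z *\<^sub>R ?e) \<le> norm x + norm (z *\<^sub>R ?e)" by (rule norm_triangle_ineq)
        then have "x + z *\<^sub>R ?e \<in> cball 0 (R + 2)" using z t True by (simp add: norm_axis_1)
        moreover have "q n x = partial i \<psi> (x + z *\<^sub>R ?e)"
          using z(3) t by (simp add: q_def t_def)
        ultimately show ?thesis using M True by simp
      qed
    qed
  qed (auto simp: q_def)
  then show ?thesis using q0 by (simp add: LIMSEQ_const_iff)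
qed

section \<open>Smooth bump functions\<close>

text \<open>The classical flat function \<open>exp (- 1 / t)\<close>, multiplied by negative powers
  of t so that derivatives of members of the family are combinations of members.\<close>

definition flat_exp :: "nat \<Rightarrow> real \<Rightarrow> real" where
  "flat_exp m t = (if t > 0 then exp (- inverse t) * inverse t ^ m else 0)"

lemma flat_exp_tendsto_0: "(flat_exp m \<longlongrightarrow> 0) (at 0)"
proof -
  have "((\<lambda>t. inverse t ^ m / exp (inverse t)) \<longlongrightarrow> (0::real)) (at_right 0)"
    by (rule filterlim_compose[OF tendsto_power_div_exp_0 filterlim_inverse_at_top_right])
  moreover have "\<forall>\<^sub>F t in at_right 0. inverse t ^ m / exp (inverse t) = flat_exp m t"
    by (auto simp: eventually_at_filter flat_exp_def exp_minus divide_inverse mult.commute)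
  ultimately have "(flat_exp m \<longlongrightarrow> 0) (at_right 0)"
    by (rule Lim_transform_eventually)
  moreover have "(flat_exp m \<longlongrightarrow> 0) (at_left 0)"
    by (rule tendsto_eventually) (auto simp: eventually_at_filter flat_exp_def)
  ultimately show ?thesis by (simp add: filterlim_split_at)
qed

lemma flat_exp_deriv:
  "(flat_exp m has_real_derivative (flat_exp (m + 2) t - real m * flat_exp (m + 1) t)) (at t)"
proof -
  consider "t > 0" | "t < 0" | "t = 0" by linarith
  then show ?thesis
  proof cases
    case 1
    have inv: "(inverse has_real_derivative - (inverse t)\<^sup>2) (at t)"
      using DERIV_inverse[of t] 1 by (simp add: numeral_2_eq_2)
    have "((\<lambda>t. exp (- inverse t)) has_real_derivative exp (- inverse t) * - (- (inverse t)\<^sup>2)) (at t)"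
      by (rule DERIV_fun_exp[OF DERIV_minus[OF inv]])
    from DERIV_mult[OF this DERIV_power[OF inv, of m]]
    have "((\<lambda>t. exp (- inverse t) * inverse t ^ m) has_real_derivative
        (flat_exp (m + 2) t - real m * flat_exp (m + 1) t)) (at t)"
      using 1 by (cases m) (simp_all add: flat_exp_def power2_eq_square algebra_simps)
    then show ?thesis
      by (rule has_field_derivative_transform_within_open[where S = "{0<..}"])
        (use 1 in \<open>auto simp: flat_exp_def\<close>)
  next
    case 2
    have "((\<lambda>t. 0) has_real_derivative 0) (at t)" by simp
    then have "(flat_exp m has_real_derivative 0) (at t)"
      by (rule has_field_derivative_transform_within_open[where S = "{..<0}"])
        (use 2 in \<open>auto simp: flat_exp_def\<close>)
    then show ?thesis using 2 by (simp add: flat_exp_def)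
  next
    case 3
    have "((\<lambda>h. (flat_exp m (0 + h) - flat_exp m 0) / h) \<longlongrightarrow> 0) (at 0)"
    proof (rule Lim_transform_eventually[OF flat_exp_tendsto_0])
      \<comment> \<open>Dividing by h raises the power by one, so the difference quotient at 0 is
        again a member of the family and tends to 0.\<close>
      show "\<forall>\<^sub>F h in at 0. flat_exp (Suc m) h = (flat_exp m (0 + h) - flat_exp m 0) / h"
        by (auto simp: eventually_at_filter flat_exp_def divide_inverse)
    qed
    then show ?thesis using 3 by (simp add: DERIV_def flat_exp_def)
  qed
qed

lemma flat_exp_0_bounds: "0 \<le> flat_exp 0 t" "flat_exp 0 t \<le> 1"
  by (auto simp: flat_exp_def)

text \<open>A class of functions that is closed under \<open>partial\<close>, so that its elements are smooth.\<close>

inductive_set flat_exp_algebra :: "(real ^ 'd \<Rightarrow> real) set" where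
  const: "(\<lambda>x. c) \<in> flat_exp_algebra"
| flat: "(\<lambda>x. flat_exp m (a * x $ j + b)) \<in> flat_exp_algebra"
| add: "\<lbrakk>\<phi> \<in> flat_exp_algebra; \<psi> \<in> flat_exp_algebra\<rbrakk> \<Longrightarrow> (\<lambda>x. \<phi> x + \<psi> x) \<in> flat_exp_algebra"
| mult: "\<lbrakk>\<phi> \<in> flat_exp_algebra; \<psi> \<in> flat_exp_algebra\<rbrakk> \<Longrightarrow> (\<lambda>x. \<phi> x * \<psi> x) \<in> flat_exp_algebra"

lemma flat_exp_algebra_partial:
  assumes "\<phi> \<in> flat_exp_algebra"
  shows "(\<forall>x. \<phi> differentiable at x) \<and> partial i \<phi> \<in> flat_exp_algebra"
  using assms
proof induction
  case (const c)
  then show ?case by (auto intro: flat_exp_algebra.const)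
next
  case (flat m a j b)
  have "partial i (\<lambda>x. flat_exp m (a * x $ j + b)) =
      (\<lambda>x. (if i = j then a else 0) *
        (flat_exp (m + 2) (a * x $ j + b) + (- real m) * flat_exp (m + 1) (a * x $ j + b)))"
    by (rule ext) (subst partial_comp_affine(2)[OF flat_exp_deriv], simp)
  also have "\<dots> \<in> flat_exp_algebra" by (intro flat_exp_algebra.intros)
  finally show ?case using partial_comp_affine(1)[OF flat_exp_deriv] by blast
next
  case (add \<phi> \<psi>)
  then have "partial i (\<lambda>x. \<phi> x + \<psi> x) = (\<lambda>x. partial i \<phi> x + partial i \<psi> x)"
    by (auto simp: partial_add)
  then show ?case using add by (auto intro: flat_exp_algebra.add)
next
  case (mult \<phi> \<psi>)
  then have "partial i (\<lambda>x. \<phi> x * \<psi> x) = (\<lambda>x. \<phi> x * partial i \<psi> x + partial i \<phi> x * \<psi> x)"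
    by (auto simp: partial_mult)
  then show ?case using mult by (auto intro: flat_exp_algebra.add flat_exp_algebra.mult)
qed

lemma flat_exp_algebra_smooth: "\<phi> \<in> flat_exp_algebra \<Longrightarrow> k_times_diff k \<phi>"
proof (induction k arbitrary: \<phi>)
  case 0
  then show ?case
    using flat_exp_algebra_partial[OF 0]
    by (auto simp: continuous_on_eq_continuous_at intro: differentiable_imp_continuous_within)
next
  case (Suc k)
  then show ?case
    using flat_exp_algebra_partial[OF Suc.prems] by (auto simp: differentiable_on_def)
qed

lemma flat_exp_algebra_prod:
  assumes "finite I" "\<And>i. i \<in> I \<Longrightarrow> \<phi> i \<in> flat_exp_algebra"
  shows "(\<lambda>x. \<Prod>i\<in>I. \<phi> i x) \<in> flat_exp_algebra"
  using assms by (induction I) (auto intro: flat_exp_algebra.const flat_exp_algebra.mult)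

text \<open>The parameter n steepens the walls and leaves the support inside the fixed box; as n
  grows the bumps tend to the indicator of the open box. The arguments are written in the affine
  form expected by \<open>flat_exp_algebra\<close>.\<close>

definition box_bump :: "real ^ 'd \<Rightarrow> real ^ 'd \<Rightarrow> real \<Rightarrow> real ^ 'd \<Rightarrow> real" where
  "box_bump a b n x =
     (\<Prod>i\<in>UNIV. flat_exp 0 (n * x $ i + (- n * a $ i)) * flat_exp 0 (- n * x $ i + n * b $ i))"

lemma box_bump_bounds: "0 \<le> box_bump a b n x" "box_bump a b n x \<le> 1"
  unfolding box_bump_def
  by (auto intro!: prod_nonneg prod_le_1 mult_nonneg_nonneg mult_le_one flat_exp_0_bounds)

lemma box_bump_outside:
  assumes "n \<ge> 0" "x \<notin> box a b"
  shows "box_bump a b n x = 0"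
proof -
  obtain i where "x $ i \<le> a $ i \<or> b $ i \<le> x $ i" using assms(2) by (auto simp: mem_box_cart not_less)
  then have "n * x $ i + (- n * a $ i) \<le> 0 \<or> - n * x $ i + n * b $ i \<le> 0"
    using assms(1) by (auto simp: mult_left_mono)
  then have "flat_exp 0 (n * x $ i + (- n * a $ i)) * flat_exp 0 (- n * x $ i + n * b $ i) = 0"
    by (auto simp: flat_exp_def)
  then show ?thesis unfolding box_bump_def by (meson finite prod_zero UNIV_I)
qed

lemma box_bump_test_function:
  assumes "cbox a b \<subseteq> \<Omega>" "n \<ge> 0"
  shows "box_bump a b n \<in> test_functions \<Omega>"
proof -
  have "{x. box_bump a b n x \<noteq> 0} \<subseteq> box a b" using box_bump_outside[OF assms(2)] by blast
  then have sub: "{x. box_bump a b n x \<noteq> 0} \<subseteq> cbox a b"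
    using box_subset_cbox[of a b] by (rule order_trans)
  have "closure {x. box_bump a b n x \<noteq> 0} \<subseteq> cbox a b" "bounded {x. box_bump a b n x \<noteq> 0}"
    by (rule closure_minimal[OF sub closed_cbox], rule bounded_subset[OF bounded_cbox sub])
  moreover have "k_times_diff k (box_bump a b n)" for k
    unfolding box_bump_def
    by (intro flat_exp_algebra_smooth flat_exp_algebra_prod flat_exp_algebra.mult flat_exp_algebra.flat) simp
  ultimately show ?thesis using assms(1) by (auto simp: test_functions_def)
qed

lemma flat_exp_tendsto_1:
  assumes "c > 0"
  shows "(\<lambda>n. flat_exp 0 (real n * c)) \<longlonglongrightarrow> 1"
proof -
  have "(\<lambda>n. - inverse (real n) * inverse c) \<longlonglongrightarrow> - 0 * inverse c"
    by (intro tendsto_intros lim_inverse_n)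
  then have "(\<lambda>n. exp (- inverse (real n) * inverse c)) \<longlonglongrightarrow> exp 0"
    by (intro tendsto_exp) simp
  moreover have "\<forall>\<^sub>F n in sequentially. exp (- inverse (real n) * inverse c) = flat_exp 0 (real n * c)"
    using eventually_gt_at_top[of 0] by eventually_elim (use assms in \<open>simp add: flat_exp_def\<close>)
  ultimately show ?thesis by (simp add: tendsto_cong)
qed

lemma box_bump_tendsto: "(\<lambda>n. box_bump a b (real n) x) \<longlonglongrightarrow> indicator (box a b) x"
proof (cases "x \<in> box a b")
  case True
  have "(\<lambda>n. box_bump a b (real n) x) \<longlonglongrightarrow> (\<Prod>i\<in>(UNIV :: 'a set). 1 * 1)"
    unfolding box_bump_def
  proof (intro tendsto_prod tendsto_mult)
    fix i :: 'a
    have "x $ i - a $ i > 0" "b $ i - x $ i > 0" using True by (auto simp: mem_box_cart)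
    from this[THEN flat_exp_tendsto_1]
    show "(\<lambda>n. flat_exp 0 (real n * x $ i + (- real n * a $ i))) \<longlonglongrightarrow> 1"
      "(\<lambda>n. flat_exp 0 (- real n * x $ i + real n * b $ i)) \<longlonglongrightarrow> 1"
      by (simp_all add: algebra_simps)
  qed
  then show ?thesis using True by simp
next
  case False
  then show ?thesis by (simp add: box_bump_outside)
qed

section \<open>The fundamental lemma of the calculus of variations\<close>

locale bounded_open_set =
  fixes \<Omega> :: "(real ^ 'd) set"
  assumes open_\<Omega>: "open \<Omega>" and bounded_\<Omega>: "bounded \<Omega>"
begin

lemma lmeasurable_\<Omega>: "\<Omega> \<in> lmeasurable"
  using open_\<Omega> bounded_\<Omega> by (rule lmeasurable_open[rotated])

lemma sets_\<Omega> [simp, measurable]: "\<Omega> \<in> sets lebesgue"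
  using lmeasurable_\<Omega> by blast

lemma continuous_L2:
  fixes f :: "real ^ 'd \<Rightarrow> 'b::euclidean_space"
  assumes "continuous_on UNIV f"
  shows "f \<in> L2 \<Omega>"
proof -
  interpret finite_measure "lebesgue_on \<Omega>" by (rule finite_measure_lebesgue_on[OF lmeasurable_\<Omega>])
  have [measurable]: "f \<in> borel_measurable (lebesgue_on \<Omega>)"
    by (rule continuous_imp_measurable_on_sets_lebesgue[OF continuous_on_subset[OF assms]]) auto
  have "compact (f ` closure \<Omega>)"
    using bounded_\<Omega> continuous_on_subset[OF assms] by (intro compact_continuous_image) auto
  then obtain M where M: "\<And>x. x \<in> closure \<Omega> \<Longrightarrow> norm (f x) \<le> M"
    by (metis compact_imp_bounded bounded_iff imageI)
  have "integrable (lebesgue_on \<Omega>) (\<lambda>x. (norm (f x))\<^sup>2)"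
  proof (rule integrable_const_bound)
    show "AE x in lebesgue_on \<Omega>. norm ((norm (f x))\<^sup>2) \<le> M\<^sup>2"
      using M closure_subset[of \<Omega>] by (intro AE_I2) (auto intro!: power_mono)
  qed simp
  then show ?thesis by (simp add: L2_def)
qed

lemma test_function_L2: "\<phi> \<in> test_functions \<Omega> \<Longrightarrow> \<phi> \<in> L2 \<Omega>"
  and test_function_partial_L2: "\<phi> \<in> test_functions \<Omega> \<Longrightarrow> partial i \<phi> \<in> L2 \<Omega>"
  by (auto intro: continuous_L2 test_function_C1)

text \<open>The bumps are test functions with values between 0 and 1 and converge to the indicator,
  so dominated convergence applies with majorant |g|, which is integrable because \<Omega> has
  finite measure.\<close>

lemma box_integral_eq_0:
  assumes g: "g \<in> L2 \<Omega>" and orth: "\<And>\<phi>. \<phi> \<in> test_functions \<Omega> \<Longrightarrow> L2_inner \<Omega> g \<phi> = 0"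
    and sub: "cbox a b \<subseteq> \<Omega>"
  shows "(LINT x|lebesgue_on \<Omega>. g x * indicator (box a b) x) = 0"
proof -
  have one: "(\<lambda>x. 1 :: real) \<in> L2 \<Omega>" by (intro continuous_L2) simp
  have [measurable]: "g \<in> borel_measurable (lebesgue_on \<Omega>)" using g by (rule L2_measurable)
  have "(\<lambda>n. LINT x|lebesgue_on \<Omega>. g x * box_bump a b (real n) x) \<longlonglongrightarrow>
      (LINT x|lebesgue_on \<Omega>. g x * indicator (box a b) x)"
  proof (rule integral_dominated_convergence)
    show "integrable (lebesgue_on \<Omega>) (\<lambda>x. \<bar>g x\<bar>)"
      using L2_inner_integrable[OF g one] by simp
    show "(\<lambda>x. g x * indicator (box a b) x) \<in> borel_measurable (lebesgue_on \<Omega>)"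
      using fmeasurableD[OF lmeasurable_box[of a b]]
      by (intro borel_measurable_times L2_measurable[OF g] measurable_restrict_space1[OF borel_measurable_indicator])
    show "(\<lambda>x. g x * box_bump a b (real n) x) \<in> borel_measurable (lebesgue_on \<Omega>)" for n
      using L2_measurable[OF test_function_L2[OF box_bump_test_function[OF sub]], of "real n"] by measurable
    show "AE x in lebesgue_on \<Omega>. (\<lambda>n. g x * box_bump a b (real n) x) \<longlonglongrightarrow> g x * indicator (box a b) x"
      by (intro AE_I2 tendsto_intros box_bump_tendsto)
    show "AE x in lebesgue_on \<Omega>. norm (g x * box_bump a b (real n) x) \<le> \<bar>g x\<bar>" for n
      using box_bump_bounds[of a b "real n"] by (intro AE_I2) (simp add: abs_mult mult_left_le)
  qed
  moreover have "(LINT x|lebesgue_on \<Omega>. g x * box_bump a b (real n) x) = 0" for n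
    using orth[OF box_bump_test_function[OF sub]] by (simp add: L2_inner_def)
  ultimately show ?thesis by (simp add: LIMSEQ_const_iff)
qed

text \<open>Integrals over boxes inside \<Omega> vanish, and by Lebesgue's differentiation theorem
  averages over shrinking cubes recover g almost everywhere.\<close>

lemma L2_null_if_orthogonal_test_functions:
  assumes g: "g \<in> L2 \<Omega>" and orth: "\<And>\<phi>. \<phi> \<in> test_functions \<Omega> \<Longrightarrow> L2_inner \<Omega> g \<phi> = 0"
  shows "L2_norm \<Omega> g = 0"
proof -
  define G where "G x = indicator \<Omega> x * g x" for x
  have one: "(\<lambda>x. 1 :: real) \<in> L2 \<Omega>" by (intro continuous_L2) simp
  have "integrable (lebesgue_on \<Omega>) g" using L2_inner_integrable[OF g one] by simp
  then have intG: "integrable lebesgue G"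
    by (simp add: integrable_restrict_space G_def[abs_def])
  then have intG_on: "integrable (lebesgue_on S) G" if "S \<in> sets lebesgue" for S
    using integrable_mult_indicator[OF that intG] that by (simp add: integrable_restrict_space)
  have "G integrable_on cbox a b" for a b
    using has_integral_integral_lebesgue_on[OF intG_on, of "cbox a b"]
      fmeasurableD[OF lmeasurable_cbox[of a b]] by (auto simp: integrable_on_def)
  \<comment> \<open>Lebesgue differentiation along cubes with lower corner x, applied to the
    extension of g by zero.\<close>
  then obtain N where N: "negligible N"
    and conv: "\<And>x e. \<lbrakk>x \<notin> N; 0 < e\<rbrakk> \<Longrightarrow> \<exists>d>0. \<forall>h. 0 < h \<and> h < d \<longrightarrow>
        norm (integral (cbox x (x + h *\<^sub>R One)) G /\<^sub>R h ^ DIM(real ^ 'd) - G x) < e"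
    by (rule integrable_ccontinuous_explicit) blast
  have box0: "integral (cbox a b) G = 0" if sub: "cbox a b \<subseteq> \<Omega>" for a b
  proof -
    have "integral (cbox a b) G = integral (box a b) G"
      by (rule integral_subset_negligible[symmetric, OF box_subset_cbox])
        (simp add: negligible_frontier_interval)
    also have "\<dots> = (LINT x|lebesgue_on (box a b). G x)"
      by (rule lebesgue_integral_eq_integral[symmetric]) (auto intro: intG_on)
    also have "\<dots> = (LINT x|lebesgue. indicator (box a b) x * G x)"
      by (simp add: integral_restrict_space)
    also have "\<dots> = (LINT x|lebesgue_on \<Omega>. g x * indicator (box a b) x)"
      by (simp add: integral_restrict_space G_def mult_ac)
    also have "\<dots> = 0" by (rule box_integral_eq_0[OF g orth sub])
    finally show ?thesis .
  qed
  have zero: "g x = 0" if x: "x \<in> \<Omega>" "x \<notin> N" for x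
  proof (rule ccontr)
    assume "g x \<noteq> 0"
    obtain d where d: "d > 0" "\<And>h. \<lbrakk>0 < h; h < d\<rbrakk> \<Longrightarrow>
        norm (integral (cbox x (x + h *\<^sub>R One)) G /\<^sub>R h ^ DIM(real ^ 'd) - G x) < norm (g x)"
      using conv[OF x(2), of "norm (g x)"] \<open>g x \<noteq> 0\<close> by auto
    obtain r where r: "r > 0" "cball x r \<subseteq> \<Omega>"
      using open_\<Omega> x(1) open_contains_cball by blast
    define c where "c = norm (One :: real ^ 'd)"
    have c: "c > 0" by (simp add: c_def)
    \<comment> \<open>A cube of side h has diameter \<open>h * c\<close>, so it stays in the ball of
      radius r inside \<Omega>, and h is below the threshold d.\<close>
    define h where "h = min (d / 2) (r / c)"
    have h: "0 < h" "h < d" "h * c \<le> r"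
      using d(1) r(1) c by (auto simp: h_def field_simps min_def)
    have "cbox x (x + h *\<^sub>R One) \<subseteq> cball x r"
    proof
      fix y assume "y \<in> cbox x (x + h *\<^sub>R One)"
      then have "\<forall>i. x \<bullet> axis i 1 \<le> y \<bullet> axis i 1 \<and> y \<bullet> axis i 1 \<le> x \<bullet> axis i 1 + h"
        by (simp add: mem_box_cart cart_eq_inner_axis inner_add_left)
      then have "0 \<le> y \<bullet> axis i 1 - x \<bullet> axis i 1 \<and> y \<bullet> axis i 1 - x \<bullet> axis i 1 \<le> h" for i
        by (metis diff_ge_0_iff_ge diff_le_eq add.commute)
      then have "norm (y - x) \<le> norm (h *\<^sub>R (One :: real ^ 'd))"
        using h(1) by (intro norm_le_componentwise_cart) (simp add: cart_eq_inner_axis inner_diff_left)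
      then show "y \<in> cball x r" using h by (simp add: dist_norm norm_minus_commute c_def)
    qed
    then have "integral (cbox x (x + h *\<^sub>R One)) G = 0" using r box0 by blast
    then show False using d(2)[OF h(1,2)] x(1) by (simp add: G_def)
  qed
  have "AE x in lebesgue. x \<notin> N"
    using N by (simp add: AE_not_in negligible_iff_null_sets)
  then have "AE x in lebesgue_on \<Omega>. g x = 0"
    by (subst AE_restrict_space_iff) (auto elim!: eventually_mono dest: zero)
  then have "L2_inner \<Omega> g g = 0"
    unfolding L2_inner_def by (intro integral_eq_zero_AE) auto
  then show ?thesis by (simp add: L2_norm_def)
qed

section \<open>Integration by parts and Friedrichs' inequality\<close>

lemma integral_lebesgue_on_eq_lborel:
  fixes f :: "real ^ 'd \<Rightarrow> real"
  assumes "continuous_on UNIV f" "\<And>x. x \<notin> \<Omega> \<Longrightarrow> f x = 0"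
  shows "(LINT x|lebesgue_on \<Omega>. f x) = (LINT x|lborel. f x)"
proof -
  have "f \<in> borel_measurable borel" using assms(1) by (rule borel_measurable_continuous_onI)
  then have "(LINT x|lborel. f x) = (LINT x|lebesgue. f x)" by (simp add: integral_completion)
  also have "\<dots> = (LINT x|lebesgue_on \<Omega>. f x)"
    using assms(2) by (auto simp: integral_restrict_space indicator_def intro!: Bochner_Integration.integral_cong)
  finally show ?thesis by simp
qed

text \<open>The product with \<phi> has bounded support even if \<psi> has not, so the integral of
  its derivative vanishes; the product rule splits it. Asking only for a C1 factor admits \<psi>
  such as x_i times a test function.\<close>

lemma L2_inner_partial_test_function:
  fixes \<psi> :: "real ^ 'd \<Rightarrow> real"
  assumes \<phi>: "\<phi> \<in> test_functions \<Omega>"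
    and \<psi>: "\<And>x. \<psi> differentiable at x" "continuous_on UNIV (partial i \<psi>)"
  shows "L2_inner \<Omega> \<psi> (partial i \<phi>) = - L2_inner \<Omega> (partial i \<psi>) \<phi>"
proof -
  let ?p = "\<lambda>x. \<psi> x * partial i \<phi> x + partial i \<psi> x * \<phi> x"
  note C1 = test_function_C1[OF \<phi>]
  have \<psi>c: "continuous_on UNIV \<psi>"
    using \<psi>(1) by (auto simp: continuous_on_eq_continuous_at intro: differentiable_imp_continuous_within)
  have p: "partial i (\<lambda>x. \<psi> x * \<phi> x) = ?p"
    using C1(1) \<psi>(1) by (intro ext partial_mult)
  have pc: "continuous_on UNIV ?p" by (intro continuous_intros \<psi>c \<psi>(2) C1)
  have "(LINT x|lborel. partial i (\<lambda>x. \<psi> x * \<phi> x) x) = 0"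
  proof (rule integral_partial_eq_0)
    show "(\<lambda>x. \<psi> x * \<phi> x) differentiable at x" for x by (intro differentiable_mult \<psi>(1) C1(1))
    show "continuous_on UNIV (partial i (\<lambda>x. \<psi> x * \<phi> x))" using pc p by simp
    show "bounded {x. \<psi> x * \<phi> x \<noteq> 0}"
      by (rule bounded_subset[OF test_function_support_bounded[OF \<phi>]]) auto
  qed
  then have "(LINT x|lebesgue_on \<Omega>. ?p x) = 0"
    using integral_lebesgue_on_eq_lborel[OF pc] test_function_zero_outside[OF \<phi>]
      test_function_partial_zero_outside[OF \<phi>] p by simp
  moreover have "(LINT x|lebesgue_on \<Omega>. ?p x) = L2_inner \<Omega> \<psi> (partial i \<phi>) + L2_inner \<Omega> (partial i \<psi>) \<phi>"
    unfolding L2_inner_def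
    using L2_inner_integrable[OF continuous_L2[OF \<psi>c] test_function_partial_L2[OF \<phi>]]
      L2_inner_integrable[OF continuous_L2[OF \<psi>(2)] test_function_L2[OF \<phi>]]
    by simp
  ultimately show ?thesis by simp
qed

text \<open>Integration by parts of \<open>x\<^sub>i \<phi>\<close> against the derivative of \<open>\<phi>\<close> produces the square of the norm of \<open>\<phi>\<close>.\<close>

lemma friedrichs_test_function:
  "\<exists>c. \<forall>\<phi>\<in>test_functions \<Omega>. \<forall>i. L2_norm \<Omega> \<phi> \<le> c * L2_norm \<Omega> (partial i \<phi>)"
proof -
  obtain R where R: "R > 0" "\<And>x. x \<in> \<Omega> \<Longrightarrow> norm x \<le> R"
    using bounded_\<Omega> by (auto simp: bounded_pos)
  have "L2_norm \<Omega> \<phi> \<le> (2 * R) * L2_norm \<Omega> (partial i \<phi>)" if \<phi>: "\<phi> \<in> test_functions \<Omega>" for \<phi> i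
  proof -
    note C1 = test_function_C1[OF \<phi>]
    let ?\<psi> = "\<lambda>x :: real ^ 'd. x $ i * \<phi> x"
    have d: "(\<lambda>x :: real ^ 'd. x $ i) differentiable at x" for x
      by (rule bounded_linear_imp_differentiable[OF bounded_linear_vec_nth])
    have p: "partial i ?\<psi> = (\<lambda>x. x $ i * partial i \<phi> x + \<phi> x)"
      using partial_mult[OF d C1(1)] by (simp add: fun_eq_iff partial_component)
    have \<psi>L: "?\<psi> \<in> L2 \<Omega>" "(\<lambda>x. x $ i * partial i \<phi> x) \<in> L2 \<Omega>"
      by (intro continuous_L2 continuous_intros C1)+
    have \<phi>L: "\<phi> \<in> L2 \<Omega>" using \<phi> by (rule test_function_L2)
    have "L2_inner \<Omega> ?\<psi> (partial i \<phi>) = - L2_inner \<Omega> (partial i ?\<psi>) \<phi>"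
    proof (rule L2_inner_partial_test_function[OF \<phi>])
      show "?\<psi> differentiable at x" for x by (intro differentiable_mult d C1)
      show "continuous_on UNIV (partial i ?\<psi>)" unfolding p by (intro continuous_intros C1)
    qed
    also have "L2_inner \<Omega> (partial i ?\<psi>) \<phi> = L2_inner \<Omega> (\<lambda>x. x $ i * partial i \<phi> x) \<phi> + L2_inner \<Omega> \<phi> \<phi>"
      using L2.ip_add_left[OF \<psi>L(2) \<phi>L \<phi>L] by (simp add: p plus_fun_def)
    \<comment> \<open>This is the left-hand side of the chain again; collecting both copies produces
      the factor 2 in the constant \<open>2 * R\<close>.\<close>
    also have "L2_inner \<Omega> (\<lambda>x. x $ i * partial i \<phi> x) \<phi> = L2_inner \<Omega> ?\<psi> (partial i \<phi>)"
      by (simp add: L2_inner_def mult_ac)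
    finally have eq: "(L2_norm \<Omega> \<phi>)\<^sup>2 = - 2 * L2_inner \<Omega> ?\<psi> (partial i \<phi>)"
      using L2.nm_sq[OF \<phi>L] by simp
    have "(L2_norm \<Omega> ?\<psi>)\<^sup>2 \<le> R\<^sup>2 * (L2_norm \<Omega> \<phi>)\<^sup>2"
    proof -
      have "(LINT x|lebesgue_on \<Omega>. (norm (?\<psi> x))\<^sup>2) \<le> (LINT x|lebesgue_on \<Omega>. R\<^sup>2 * (norm (\<phi> x))\<^sup>2)"
      proof (rule integral_mono)
        show "integrable (lebesgue_on \<Omega>) (\<lambda>x. (norm (?\<psi> x))\<^sup>2)"
          "integrable (lebesgue_on \<Omega>) (\<lambda>x. R\<^sup>2 * (norm (\<phi> x))\<^sup>2)"
          using \<psi>L \<phi>L by (auto simp: L2_def)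
        fix x assume "x \<in> space (lebesgue_on \<Omega>)"
        then have "\<bar>x $ i\<bar> \<le> R" using R(2)[of x] component_le_norm_cart[of x i] by simp
        then have "\<bar>x $ i\<bar>\<^sup>2 \<le> R\<^sup>2" by (intro power_mono) auto
        then show "(norm (?\<psi> x))\<^sup>2 \<le> R\<^sup>2 * (norm (\<phi> x))\<^sup>2"
          by (simp add: power_mult_distrib mult_right_mono abs_mult)
      qed
      then show ?thesis by (simp add: L2_norm_sq)
    qed
    then have \<psi>n: "L2_norm \<Omega> ?\<psi> \<le> R * L2_norm \<Omega> \<phi>"
      using R(1) by (metis power_mult_distrib power2_le_imp_le mult_nonneg_nonneg L2_norm_nonneg less_imp_le)
    have "\<bar>L2_inner \<Omega> ?\<psi> (partial i \<phi>)\<bar> \<le> L2_norm \<Omega> ?\<psi> * L2_norm \<Omega> (partial i \<phi>)"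
      by (rule L2.Cauchy_Schwarz[OF \<psi>L(1) test_function_partial_L2[OF \<phi>]])
    also have "\<dots> \<le> (R * L2_norm \<Omega> \<phi>) * L2_norm \<Omega> (partial i \<phi>)"
      by (intro mult_right_mono \<psi>n) auto
    finally have "(L2_norm \<Omega> \<phi>)\<^sup>2 \<le> 2 * ((R * L2_norm \<Omega> \<phi>) * L2_norm \<Omega> (partial i \<phi>))"
      using eq by linarith
    then have "L2_norm \<Omega> \<phi> * L2_norm \<Omega> \<phi> \<le> L2_norm \<Omega> \<phi> * (2 * R * L2_norm \<Omega> (partial i \<phi>))"
      by (simp add: power2_eq_square mult_ac)
    moreover have "L2_norm \<Omega> \<phi> = 0 \<or> L2_norm \<Omega> \<phi> > 0" by (simp add: order_less_le)
    ultimately show ?thesis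
      using R(1) by (auto simp: mult_le_cancel_left_pos)
  qed
  then show ?thesis by blast
qed

end

section \<open>Weak derivatives\<close>

lemma L2_vec_iff:
  fixes \<tau> :: "real ^ 'd \<Rightarrow> real ^ 'n"
  shows "\<tau> \<in> L2 \<Omega> \<longleftrightarrow> (\<forall>i. (\<lambda>x. \<tau> x $ i) \<in> L2 \<Omega>)"
proof
  assume \<tau>: "\<tau> \<in> L2 \<Omega>"
  show "\<forall>i. (\<lambda>x. \<tau> x $ i) \<in> L2 \<Omega>"
  proof
    fix i
    have [measurable]: "\<tau> \<in> borel_measurable (lebesgue_on \<Omega>)" using \<tau> by (rule L2_measurable)
    have m: "(\<lambda>x. \<tau> x $ i) \<in> borel_measurable (lebesgue_on \<Omega>)"
      using borel_measurable_inner[of \<tau> _ "\<lambda>x. axis i 1"] by (simp add: cart_eq_inner_axis)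
    have "integrable (lebesgue_on \<Omega>) (\<lambda>x. (norm (\<tau> x $ i))\<^sup>2)"
    proof (rule Bochner_Integration.integrable_bound)
      show "integrable (lebesgue_on \<Omega>) (\<lambda>x. (norm (\<tau> x))\<^sup>2)" using \<tau> by (simp add: L2_def)
      show "AE x in lebesgue_on \<Omega>. norm ((norm (\<tau> x $ i))\<^sup>2) \<le> norm ((norm (\<tau> x))\<^sup>2)"
        using component_le_norm_cart by (intro AE_I2) (auto intro!: power_mono simp: abs_le_square_iff[symmetric])
    qed (use m in measurable)
    then show "(\<lambda>x. \<tau> x $ i) \<in> L2 \<Omega>" using m by (simp add: L2_def)
  qed
next
  assume \<tau>: "\<forall>i. (\<lambda>x. \<tau> x $ i) \<in> L2 \<Omega>"
  have m: "\<tau> \<in> borel_measurable (lebesgue_on \<Omega>)"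
    using \<tau> L2_measurable by (subst borel_measurable_euclidean_space)
      (auto simp: Basis_vec_def simp flip: cart_eq_inner_axis)
  have "integrable (lebesgue_on \<Omega>) (\<lambda>x. \<Sum>i\<in>UNIV. (norm (\<tau> x $ i))\<^sup>2)"
    using \<tau> by (auto simp: L2_def)
  also have "(\<lambda>x. \<Sum>i\<in>UNIV. (norm (\<tau> x $ i))\<^sup>2) = (\<lambda>x. (norm (\<tau> x))\<^sup>2)"
    by (simp only: fun_eq_iff power2_norm_eq_inner inner_vec_def) simp
  finally show "\<tau> \<in> L2 \<Omega>" using m by (simp add: L2_def)
qed

lemma L2_inner_vec:
  fixes \<sigma> \<tau> :: "real ^ 'd \<Rightarrow> real ^ 'n"
  assumes "\<sigma> \<in> L2 \<Omega>" "\<tau> \<in> L2 \<Omega>"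
  shows "L2_inner \<Omega> \<sigma> \<tau> = (\<Sum>i\<in>UNIV. L2_inner \<Omega> (\<lambda>x. \<sigma> x $ i) (\<lambda>x. \<tau> x $ i))"
proof -
  have "L2_inner \<Omega> \<sigma> \<tau> = (LINT x|lebesgue_on \<Omega>. (\<Sum>i\<in>UNIV. \<sigma> x $ i \<bullet> \<tau> x $ i))"
    by (simp add: L2_inner_def inner_vec_def)
  also have "\<dots> = (\<Sum>i\<in>UNIV. L2_inner \<Omega> (\<lambda>x. \<sigma> x $ i) (\<lambda>x. \<tau> x $ i))"
    unfolding L2_inner_def
    by (rule Bochner_Integration.integral_sum)
      (intro L2_inner_integrable L2_vec_iff[THEN iffD1, rule_format] assms)
  finally show ?thesis .
qed

text \<open>Equality of elements of \<open>L2\<close> is written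
  \<open>L2_norm \<Omega> (f - g) = 0\<close>. These rules exchange such representatives inside
  inner products and norms.\<close>

lemma
  assumes "f \<in> L2 \<Omega>" "g \<in> L2 \<Omega>" "L2_norm \<Omega> (f - g) = 0"
  shows L2_inner_cong_left: "k \<in> L2 \<Omega> \<Longrightarrow> L2_inner \<Omega> f k = L2_inner \<Omega> g k"
    and L2_inner_cong_right: "k \<in> L2 \<Omega> \<Longrightarrow> L2_inner \<Omega> k f = L2_inner \<Omega> k g"
    and L2_norm_cong: "L2_norm \<Omega> f = L2_norm \<Omega> g"
proof -
  have *: "L2_inner \<Omega> f k = L2_inner \<Omega> g k" if "k \<in> L2 \<Omega>" for k
    using L2.ip_null_left[of "f - g" \<Omega> k] that assms by (simp add: L2.ip_left)
  have **: "L2_inner \<Omega> k f = L2_inner \<Omega> k g" if "k \<in> L2 \<Omega>" for k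
    using *[OF that] L2.ip_commute[OF that assms(1)] L2.ip_commute[OF that assms(2)] by simp
  show "k \<in> L2 \<Omega> \<Longrightarrow> L2_inner \<Omega> f k = L2_inner \<Omega> g k" "k \<in> L2 \<Omega> \<Longrightarrow> L2_inner \<Omega> k f = L2_inner \<Omega> k g"
    using * ** by blast+
  show "L2_norm \<Omega> f = L2_norm \<Omega> g"
    using *[of f] **[of g] assms by (simp add: L2_norm_def)
qed

text \<open>Test against \<open>f - g\<close> itself. This turns identities between inner products
  back into equality almost everywhere.\<close>

lemma L2_norm_diff_eq_0I:
  assumes "f \<in> L2 \<Omega>" "g \<in> L2 \<Omega>" "\<And>k. k \<in> L2 \<Omega> \<Longrightarrow> L2_inner \<Omega> f k = L2_inner \<Omega> g k"
  shows "L2_norm \<Omega> (f - g) = 0"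
  using assms by (simp add: L2_norm_def L2.ip_left)

definition cgrad :: "(real ^ 'd \<Rightarrow> real) \<Rightarrow> real ^ 'd \<Rightarrow> real ^ 'd" where
  "cgrad \<phi> = (\<lambda>x. \<chi> i. partial i \<phi> x)"

text \<open>A relation beside the chosen \<open>weak_grad\<close>, so that a convenient
  representative of the gradient can be used, such as one with components in a fractional
  space.\<close>

definition is_weak_grad :: "(real ^ 'd) set \<Rightarrow> (real ^ 'd \<Rightarrow> real) \<Rightarrow> (real ^ 'd \<Rightarrow> real ^ 'd) \<Rightarrow> bool" where
  "is_weak_grad \<Omega> u \<gamma> \<longleftrightarrow> (\<forall>i. has_weak_partial \<Omega> i u (\<lambda>x. \<gamma> x $ i))"

lemma sobolev_1_iff: "u \<in> sobolev 1 \<Omega> \<longleftrightarrow> u \<in> L2 \<Omega> \<and> (\<exists>\<gamma>. is_weak_grad \<Omega> u \<gamma>)"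
proof -
  have "(\<forall>i. \<exists>g. has_weak_partial \<Omega> i u g) \<longleftrightarrow> (\<exists>\<gamma>. is_weak_grad \<Omega> u \<gamma>)"
  proof
    assume "\<forall>i. \<exists>g. has_weak_partial \<Omega> i u g"
    then obtain g where "\<And>i. has_weak_partial \<Omega> i u (g i)" by metis
    then have "is_weak_grad \<Omega> u (\<lambda>x. \<chi> i. g i x)" by (simp add: is_weak_grad_def)
    then show "\<exists>\<gamma>. is_weak_grad \<Omega> u \<gamma>" by blast
  qed (auto simp: is_weak_grad_def)
  moreover have "(\<exists>g \<in> L2 \<Omega>. has_weak_partial \<Omega> i u g) \<longleftrightarrow> (\<exists>g. has_weak_partial \<Omega> i u g)" for i
    by (auto simp: has_weak_partial_def)
  ultimately show ?thesis by (simp add: sobolev_def)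
qed

lemma is_weak_grad_L2: "is_weak_grad \<Omega> u \<gamma> \<Longrightarrow> \<gamma> \<in> L2 \<Omega>"
  by (subst L2_vec_iff) (simp add: is_weak_grad_def has_weak_partial_def)

lemma is_weak_grad_weak_grad:
  assumes "u \<in> sobolev 1 \<Omega>"
  shows "is_weak_grad \<Omega> u (weak_grad \<Omega> u)"
proof -
  have "has_weak_partial \<Omega> i u (weak_partial \<Omega> i u)" for i
    unfolding weak_partial_def using assms
    by (intro someI_ex[of "has_weak_partial \<Omega> i u"]) (auto simp: sobolev_1_iff is_weak_grad_def)
  then show ?thesis by (simp add: is_weak_grad_def weak_grad_def)
qed

lemma has_weak_div_weak_div: "\<tau> \<in> Hdiv \<Omega> \<Longrightarrow> has_weak_div \<Omega> \<tau> (weak_div \<Omega> \<tau>)"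
  using someI_ex[of "has_weak_div \<Omega> \<tau>"] by (auto simp: Hdiv_def weak_div_def)

lemma Hdiv_L2: "\<tau> \<in> Hdiv \<Omega> \<Longrightarrow> \<tau> \<in> L2 \<Omega>"
  and weak_div_L2: "\<tau> \<in> Hdiv \<Omega> \<Longrightarrow> weak_div \<Omega> \<tau> \<in> L2 \<Omega>"
  using has_weak_div_weak_div by (auto simp: Hdiv_def has_weak_div_def)

lemma sobolev_1_L2: "u \<in> sobolev 1 \<Omega> \<Longrightarrow> u \<in> L2 \<Omega>"
  and weak_grad_L2: "u \<in> sobolev 1 \<Omega> \<Longrightarrow> weak_grad \<Omega> u \<in> L2 \<Omega>"
  using is_weak_grad_L2[OF is_weak_grad_weak_grad] by (simp_all add: sobolev_1_iff)

lemma sobolev_norm_1: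
  assumes "u \<in> sobolev 1 \<Omega>"
  shows "sobolev_norm 1 \<Omega> u = sqrt ((L2_norm \<Omega> u)\<^sup>2 + (L2_norm \<Omega> (weak_grad \<Omega> u))\<^sup>2)"
proof -
  have "(L2_norm \<Omega> (weak_grad \<Omega> u))\<^sup>2 = (\<Sum>i\<in>UNIV. (L2_norm \<Omega> (weak_partial \<Omega> i u))\<^sup>2)"
    using L2_inner_vec[OF weak_grad_L2[OF assms] weak_grad_L2[OF assms]]
      weak_grad_L2[OF assms] L2_vec_iff[of "weak_grad \<Omega> u" \<Omega>]
    by (simp add: L2.nm_sq weak_grad_def)
  then show ?thesis by (simp add: sobolev_norm_def)
qed

section \<open>Uniqueness and linearity of weak gradients and divergences up to null sets\<close>

context bounded_open_set
begin

lemma cgrad_L2: "\<phi> \<in> test_functions \<Omega> \<Longrightarrow> cgrad \<phi> \<in> L2 \<Omega>"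
  by (subst L2_vec_iff) (simp add: cgrad_def test_function_partial_L2)

text \<open>Each component of the difference is orthogonal to all test functions, so the fundamental
  lemma applies to it.\<close>

lemma is_weak_grad_unique:
  assumes "is_weak_grad \<Omega> u \<gamma>" "is_weak_grad \<Omega> u \<delta>"
  shows "L2_norm \<Omega> (\<gamma> - \<delta>) = 0"
proof -
  have L: "\<gamma> - \<delta> \<in> L2 \<Omega>" using assms by (simp add: is_weak_grad_L2)
  have "L2_norm \<Omega> (\<lambda>x. (\<gamma> - \<delta>) x $ i) = 0" for i
  proof (rule L2_null_if_orthogonal_test_functions)
    show "(\<lambda>x. (\<gamma> - \<delta>) x $ i) \<in> L2 \<Omega>" using L by (simp only: L2_vec_iff)
    fix \<phi> assume \<phi>: "\<phi> \<in> test_functions \<Omega>"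
    have eq: "(\<lambda>x. (\<gamma> - \<delta>) x $ i) = (\<lambda>x. \<gamma> x $ i) - (\<lambda>x. \<delta> x $ i)" by (simp add: fun_eq_iff)
    show "L2_inner \<Omega> (\<lambda>x. (\<gamma> - \<delta>) x $ i) \<phi> = 0"
      unfolding eq using assms \<phi> test_function_L2[OF \<phi>]
      by (subst L2.ip_diff_left) (auto simp: is_weak_grad_def has_weak_partial_def)
  qed
  then have "L2_inner \<Omega> (\<lambda>x. (\<gamma> - \<delta>) x $ i) (\<lambda>x. (\<gamma> - \<delta>) x $ i) = 0" for i
    by (simp only: L2_norm_def real_sqrt_eq_zero_cancel_iff)
  then show ?thesis unfolding L2_norm_def L2_inner_vec[OF L L] by simp
qed

lemma has_weak_div_unique:
  assumes "has_weak_div \<Omega> \<tau> f" "has_weak_div \<Omega> \<tau> g"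
  shows "L2_norm \<Omega> (f - g) = 0"
proof (rule L2_null_if_orthogonal_test_functions)
  show "f - g \<in> L2 \<Omega>" using assms by (simp add: has_weak_div_def)
  show "L2_inner \<Omega> (f - g) \<phi> = 0" if "\<phi> \<in> test_functions \<Omega>" for \<phi>
    using assms that test_function_L2[OF that] by (auto simp: has_weak_div_def L2.ip_left)
qed

lemma weak_gradI:
  assumes "u \<in> L2 \<Omega>" "is_weak_grad \<Omega> u \<gamma>"
  shows "u \<in> sobolev 1 \<Omega>" "L2_norm \<Omega> (weak_grad \<Omega> u - \<gamma>) = 0"
proof -
  show u: "u \<in> sobolev 1 \<Omega>" using assms by (auto simp: sobolev_1_iff)
  show "L2_norm \<Omega> (weak_grad \<Omega> u - \<gamma>) = 0"
    using is_weak_grad_unique[OF is_weak_grad_weak_grad[OF u] assms(2)] .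
qed

lemma weak_divI:
  assumes "\<tau> \<in> L2 \<Omega>" "has_weak_div \<Omega> \<tau> g"
  shows "\<tau> \<in> Hdiv \<Omega>" "L2_norm \<Omega> (weak_div \<Omega> \<tau> - g) = 0"
proof -
  show \<tau>: "\<tau> \<in> Hdiv \<Omega>" using assms by (auto simp: Hdiv_def)
  show "L2_norm \<Omega> (weak_div \<Omega> \<tau> - g) = 0"
    using has_weak_div_unique[OF has_weak_div_weak_div[OF \<tau>] assms(2)] .
qed

lemma is_weak_grad_add:
  assumes "u \<in> L2 \<Omega>" "v \<in> L2 \<Omega>" "is_weak_grad \<Omega> u \<gamma>" "is_weak_grad \<Omega> v \<delta>"
  shows "is_weak_grad \<Omega> (u + v) (\<gamma> + \<delta>)"
proof -
  have "has_weak_partial \<Omega> i (u + v) ((\<lambda>x. \<gamma> x $ i) + (\<lambda>x. \<delta> x $ i))" for i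
    using assms test_function_L2 test_function_partial_L2
    by (auto simp: is_weak_grad_def has_weak_partial_def L2.ip_left)
  then show ?thesis by (simp add: is_weak_grad_def plus_fun_def)
qed

lemma is_weak_grad_scale:
  assumes "u \<in> L2 \<Omega>" "is_weak_grad \<Omega> u \<gamma>"
  shows "is_weak_grad \<Omega> (c *\<^sub>R u) (c *\<^sub>R \<gamma>)"
proof -
  have "has_weak_partial \<Omega> i (c *\<^sub>R u) (c *\<^sub>R (\<lambda>x. \<gamma> x $ i))" for i
    using assms test_function_L2 test_function_partial_L2
    by (auto simp: is_weak_grad_def has_weak_partial_def L2.ip_left)
  then show ?thesis by (simp add: is_weak_grad_def scaleR_fun_def)
qed

lemma has_weak_div_add:
  assumes "\<sigma> \<in> L2 \<Omega>" "\<tau> \<in> L2 \<Omega>" "has_weak_div \<Omega> \<sigma> f" "has_weak_div \<Omega> \<tau> g"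
  shows "has_weak_div \<Omega> (\<sigma> + \<tau>) (f + g)"
  using assms test_function_L2 cgrad_L2
  by (auto simp: has_weak_div_def cgrad_def[symmetric] L2.ip_left)

lemma has_weak_div_scale:
  assumes "\<sigma> \<in> L2 \<Omega>" "has_weak_div \<Omega> \<sigma> f"
  shows "has_weak_div \<Omega> (c *\<^sub>R \<sigma>) (c *\<^sub>R f)"
  using assms test_function_L2 cgrad_L2
  by (auto simp: has_weak_div_def cgrad_def[symmetric] L2.ip_left)

lemma is_weak_grad_0: "is_weak_grad \<Omega> 0 0"
  using test_function_L2 test_function_partial_L2 L2.V_zero[of \<Omega>, unfolded zero_fun_def]
  by (auto simp: is_weak_grad_def has_weak_partial_def L2_inner_def zero_fun_def)

lemma subspace_sobolev_1: "subspace (sobolev 1 \<Omega>)"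
  using is_weak_grad_add is_weak_grad_scale is_weak_grad_0
  by (intro subspaceI) (fastforce simp: sobolev_1_iff)+

lemma subspace_Hdiv: "subspace (Hdiv \<Omega>)"
proof (rule subspaceI)
  have "has_weak_div \<Omega> 0 0"
    using L2.V_zero[of \<Omega>, unfolded zero_fun_def]
    by (auto simp: has_weak_div_def L2_inner_def zero_fun_def)
  then show "0 \<in> Hdiv \<Omega>" by (auto simp: Hdiv_def)
next
  fix \<sigma> \<tau> assume "\<sigma> \<in> Hdiv \<Omega>" "\<tau> \<in> Hdiv \<Omega>"
  then show "\<sigma> + \<tau> \<in> Hdiv \<Omega>" using has_weak_div_add by (fastforce simp: Hdiv_def)
next
  fix c \<sigma> assume "\<sigma> \<in> Hdiv \<Omega>"
  then show "c *\<^sub>R \<sigma> \<in> Hdiv \<Omega>" using has_weak_div_scale by (fastforce simp: Hdiv_def)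
qed

lemma weak_grad_add:
  assumes "u \<in> sobolev 1 \<Omega>" "v \<in> sobolev 1 \<Omega>"
  shows "L2_norm \<Omega> (weak_grad \<Omega> (u + v) - (weak_grad \<Omega> u + weak_grad \<Omega> v)) = 0"
  using assms sobolev_1_L2[of _ \<Omega>] is_weak_grad_weak_grad
  by (auto intro!: weak_gradI(2) is_weak_grad_add)

lemma weak_grad_scale:
  assumes "u \<in> sobolev 1 \<Omega>"
  shows "L2_norm \<Omega> (weak_grad \<Omega> (c *\<^sub>R u) - c *\<^sub>R weak_grad \<Omega> u) = 0"
  using assms sobolev_1_L2[of _ \<Omega>] is_weak_grad_weak_grad
  by (auto intro!: weak_gradI(2) is_weak_grad_scale)

lemma weak_div_add:
  assumes "\<sigma> \<in> Hdiv \<Omega>" "\<tau> \<in> Hdiv \<Omega>"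
  shows "L2_norm \<Omega> (weak_div \<Omega> (\<sigma> + \<tau>) - (weak_div \<Omega> \<sigma> + weak_div \<Omega> \<tau>)) = 0"
  using assms Hdiv_L2[of _ \<Omega>] has_weak_div_weak_div
  by (auto intro!: weak_divI(2) has_weak_div_add)

lemma weak_div_scale:
  assumes "\<sigma> \<in> Hdiv \<Omega>"
  shows "L2_norm \<Omega> (weak_div \<Omega> (c *\<^sub>R \<sigma>) - c *\<^sub>R weak_div \<Omega> \<sigma>) = 0"
  using assms Hdiv_L2[of _ \<Omega>] has_weak_div_weak_div
  by (auto intro!: weak_divI(2) has_weak_div_scale)

lemma sobolev_1_mem [simp]:
  shows "0 \<in> sobolev 1 \<Omega>"
    and "\<lbrakk>u \<in> sobolev 1 \<Omega>; v \<in> sobolev 1 \<Omega>\<rbrakk> \<Longrightarrow> u + v \<in> sobolev 1 \<Omega>"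
    and "\<lbrakk>u \<in> sobolev 1 \<Omega>; v \<in> sobolev 1 \<Omega>\<rbrakk> \<Longrightarrow> u - v \<in> sobolev 1 \<Omega>"
    and "u \<in> sobolev 1 \<Omega> \<Longrightarrow> c *\<^sub>R u \<in> sobolev 1 \<Omega>"
  using subspace_sobolev_1 by (auto simp: subspace_def subspace_diff)

lemma Hdiv_mem [simp]:
  shows "0 \<in> Hdiv \<Omega>"
    and "\<lbrakk>\<sigma> \<in> Hdiv \<Omega>; \<tau> \<in> Hdiv \<Omega>\<rbrakk> \<Longrightarrow> \<sigma> + \<tau> \<in> Hdiv \<Omega>"
    and "\<lbrakk>\<sigma> \<in> Hdiv \<Omega>; \<tau> \<in> Hdiv \<Omega>\<rbrakk> \<Longrightarrow> \<sigma> - \<tau> \<in> Hdiv \<Omega>"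
    and "\<sigma> \<in> Hdiv \<Omega> \<Longrightarrow> c *\<^sub>R \<sigma> \<in> Hdiv \<Omega>"
  using subspace_Hdiv by (auto simp: subspace_def subspace_diff)

text \<open>The gradients themselves are additive and homogeneous only up to null sets; after
  pairing with an element of \<open>L2\<close> the identities become exact and usable for
  rewriting.\<close>

lemma L2_inner_weak_grad:
  assumes "\<tau> \<in> L2 \<Omega>"
  shows L2_inner_weak_grad_add: "\<lbrakk>u \<in> sobolev 1 \<Omega>; v \<in> sobolev 1 \<Omega>\<rbrakk> \<Longrightarrow>
      L2_inner \<Omega> (weak_grad \<Omega> (u + v)) \<tau> = L2_inner \<Omega> (weak_grad \<Omega> u) \<tau> + L2_inner \<Omega> (weak_grad \<Omega> v) \<tau>"
    and L2_inner_weak_grad_scale: "u \<in> sobolev 1 \<Omega> \<Longrightarrow>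
      L2_inner \<Omega> (weak_grad \<Omega> (c *\<^sub>R u)) \<tau> = c * L2_inner \<Omega> (weak_grad \<Omega> u) \<tau>"
    and L2_inner_weak_grad_diff: "\<lbrakk>u \<in> sobolev 1 \<Omega>; v \<in> sobolev 1 \<Omega>\<rbrakk> \<Longrightarrow>
      L2_inner \<Omega> (weak_grad \<Omega> (u - v)) \<tau> = L2_inner \<Omega> (weak_grad \<Omega> u) \<tau> - L2_inner \<Omega> (weak_grad \<Omega> v) \<tau>"
proof -
  have add: "L2_inner \<Omega> (weak_grad \<Omega> (u + v)) \<tau> = L2_inner \<Omega> (weak_grad \<Omega> u) \<tau> + L2_inner \<Omega> (weak_grad \<Omega> v) \<tau>"
    if "u \<in> sobolev 1 \<Omega>" "v \<in> sobolev 1 \<Omega>" for u v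
    using L2_inner_cong_left[OF _ _ weak_grad_add[OF that] assms] that assms
    by (simp add: weak_grad_L2 L2.ip_left)
  show "\<lbrakk>u \<in> sobolev 1 \<Omega>; v \<in> sobolev 1 \<Omega>\<rbrakk> \<Longrightarrow>
      L2_inner \<Omega> (weak_grad \<Omega> (u + v)) \<tau> = L2_inner \<Omega> (weak_grad \<Omega> u) \<tau> + L2_inner \<Omega> (weak_grad \<Omega> v) \<tau>"
    by (rule add)
  show "L2_inner \<Omega> (weak_grad \<Omega> (c *\<^sub>R u)) \<tau> = c * L2_inner \<Omega> (weak_grad \<Omega> u) \<tau>"
    if "u \<in> sobolev 1 \<Omega>"
    using L2_inner_cong_left[OF _ _ weak_grad_scale[OF that] assms] that assms
    by (simp add: weak_grad_L2 L2.ip_left)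
  show "L2_inner \<Omega> (weak_grad \<Omega> (u - v)) \<tau> = L2_inner \<Omega> (weak_grad \<Omega> u) \<tau> - L2_inner \<Omega> (weak_grad \<Omega> v) \<tau>"
    if "u \<in> sobolev 1 \<Omega>" "v \<in> sobolev 1 \<Omega>"
    using add[of "u - v" v] that by simp
qed

lemma L2_inner_weak_div:
  assumes "g \<in> L2 \<Omega>"
  shows L2_inner_weak_div_add: "\<lbrakk>\<sigma> \<in> Hdiv \<Omega>; \<tau> \<in> Hdiv \<Omega>\<rbrakk> \<Longrightarrow>
      L2_inner \<Omega> (weak_div \<Omega> (\<sigma> + \<tau>)) g = L2_inner \<Omega> (weak_div \<Omega> \<sigma>) g + L2_inner \<Omega> (weak_div \<Omega> \<tau>) g"
    and L2_inner_weak_div_scale: "\<sigma> \<in> Hdiv \<Omega> \<Longrightarrow>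
      L2_inner \<Omega> (weak_div \<Omega> (c *\<^sub>R \<sigma>)) g = c * L2_inner \<Omega> (weak_div \<Omega> \<sigma>) g"
proof -
  show "L2_inner \<Omega> (weak_div \<Omega> (\<sigma> + \<tau>)) g = L2_inner \<Omega> (weak_div \<Omega> \<sigma>) g + L2_inner \<Omega> (weak_div \<Omega> \<tau>) g"
    if "\<sigma> \<in> Hdiv \<Omega>" "\<tau> \<in> Hdiv \<Omega>"
    using L2_inner_cong_left[OF _ _ weak_div_add[OF that] assms] that assms
    by (simp add: weak_div_L2 L2.ip_left)
  show "L2_inner \<Omega> (weak_div \<Omega> (c *\<^sub>R \<sigma>)) g = c * L2_inner \<Omega> (weak_div \<Omega> \<sigma>) g"
    if "\<sigma> \<in> Hdiv \<Omega>"
    using L2_inner_cong_left[OF _ _ weak_div_scale[OF that] assms] that assms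
    by (simp add: weak_div_L2 L2.ip_left)
qed

end

lemma LIMSEQ_null_le:
  fixes f g :: "nat \<Rightarrow> real"
  assumes "\<And>n. 0 \<le> f n" "\<And>n. f n \<le> g n" "g \<longlonglongrightarrow> 0"
  shows "f \<longlonglongrightarrow> 0"
  by (rule tendsto_sandwich[OF _ _ tendsto_const assms(3)]) (simp_all add: assms(1,2))

context bounded_open_set
begin

section \<open>The space of functions vanishing on the boundary\<close>

lemma is_weak_grad_test_function:
  assumes "\<phi> \<in> test_functions \<Omega>"
  shows "is_weak_grad \<Omega> \<phi> (cgrad \<phi>)"
  using assms L2_inner_partial_test_function[of _ \<phi>] test_function_C1[OF assms] test_function_partial_L2
  by (auto simp: is_weak_grad_def has_weak_partial_def cgrad_def)

lemma test_function_sobolev_1: "\<phi> \<in> test_functions \<Omega> \<Longrightarrow> \<phi> \<in> sobolev 1 \<Omega>"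
  using weak_gradI(1)[OF test_function_L2 is_weak_grad_test_function] .

lemma weak_grad_test_function: "\<phi> \<in> test_functions \<Omega> \<Longrightarrow> L2_norm \<Omega> (weak_grad \<Omega> \<phi> - cgrad \<phi>) = 0"
  using weak_gradI(2)[OF test_function_L2 is_weak_grad_test_function] .

lemma L2_norm_weak_grad_diff:
  assumes "u \<in> sobolev 1 \<Omega>" "v \<in> sobolev 1 \<Omega>"
  shows "L2_norm \<Omega> (weak_grad \<Omega> (u - v)) = L2_norm \<Omega> (weak_grad \<Omega> u - weak_grad \<Omega> v)"
  using assms
  by (intro L2_norm_cong L2_norm_diff_eq_0I) (auto simp: L2_inner_weak_grad L2.ip_left weak_grad_L2)

lemma sobolev_norm_1_bounds:
  assumes "u \<in> sobolev 1 \<Omega>"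
  shows "L2_norm \<Omega> u \<le> sobolev_norm 1 \<Omega> u"
    and "L2_norm \<Omega> (weak_grad \<Omega> u) \<le> sobolev_norm 1 \<Omega> u"
    and "sobolev_norm 1 \<Omega> u \<le> L2_norm \<Omega> u + L2_norm \<Omega> (weak_grad \<Omega> u)"
  unfolding sobolev_norm_1[OF assms]
  by (auto intro!: real_le_rsqrt sqrt_sum_squares_le_sum)

lemma H10_sobolev_1: "u \<in> H10 \<Omega> \<Longrightarrow> u \<in> sobolev 1 \<Omega>"
  and H10_L2: "u \<in> H10 \<Omega> \<Longrightarrow> u \<in> L2 \<Omega>"
  and H10_weak_grad_L2: "u \<in> H10 \<Omega> \<Longrightarrow> weak_grad \<Omega> u \<in> L2 \<Omega>"
  by (auto simp: H10_def sobolev_1_L2 weak_grad_L2)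

lemma H10D:
  assumes "u \<in> H10 \<Omega>"
  obtains \<phi> where "\<And>n. \<phi> n \<in> test_functions \<Omega>"
    "(\<lambda>n. L2_norm \<Omega> (u - \<phi> n)) \<longlonglongrightarrow> 0" "(\<lambda>n. L2_norm \<Omega> (weak_grad \<Omega> u - weak_grad \<Omega> (\<phi> n))) \<longlonglongrightarrow> 0"
proof -
  obtain \<phi> where \<phi>: "\<And>n. \<phi> n \<in> test_functions \<Omega>"
    and lim: "(\<lambda>n. sobolev_norm 1 \<Omega> (u - \<phi> n)) \<longlonglongrightarrow> 0"
    using assms by (auto simp: H10_def fun_diff_def)
  have S: "u \<in> sobolev 1 \<Omega>" "\<And>n. \<phi> n \<in> sobolev 1 \<Omega>"
    using H10_sobolev_1[OF assms] test_function_sobolev_1[OF \<phi>] by auto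
  have "(\<lambda>n. L2_norm \<Omega> (u - \<phi> n)) \<longlonglongrightarrow> 0"
    by (rule LIMSEQ_null_le[OF _ _ lim])
      (use S in \<open>simp_all add: sobolev_norm_1_bounds\<close>)
  moreover have "(\<lambda>n. L2_norm \<Omega> (weak_grad \<Omega> u - weak_grad \<Omega> (\<phi> n))) \<longlonglongrightarrow> 0"
    by (rule LIMSEQ_null_le[OF _ _ lim])
      (use S in \<open>simp_all add: sobolev_norm_1_bounds flip: L2_norm_weak_grad_diff\<close>)
  ultimately show ?thesis using that \<phi> by blast
qed

lemma H10I:
  assumes u: "u \<in> sobolev 1 \<Omega>" and \<phi>: "\<And>n. \<phi> n \<in> test_functions \<Omega>"
    and "(\<lambda>n. L2_norm \<Omega> (u - \<phi> n)) \<longlonglongrightarrow> 0" "(\<lambda>n. L2_norm \<Omega> (weak_grad \<Omega> u - weak_grad \<Omega> (\<phi> n))) \<longlonglongrightarrow> 0"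
  shows "u \<in> H10 \<Omega>"
proof -
  have S: "\<And>n. \<phi> n \<in> sobolev 1 \<Omega>" using test_function_sobolev_1[OF \<phi>] .
  have sum: "(\<lambda>n. L2_norm \<Omega> (u - \<phi> n) + L2_norm \<Omega> (weak_grad \<Omega> u - weak_grad \<Omega> (\<phi> n))) \<longlonglongrightarrow> 0"
    using tendsto_add[OF assms(3,4)] by simp
  have nonneg: "0 \<le> sobolev_norm 1 \<Omega> (u - \<phi> n)" for n
    using order_trans[OF L2_norm_nonneg sobolev_norm_1_bounds(1)] u S by simp
  have "(\<lambda>n. sobolev_norm 1 \<Omega> (u - \<phi> n)) \<longlonglongrightarrow> 0"
    by (rule LIMSEQ_null_le[OF _ _ sum])
      (use u S nonneg in \<open>simp_all add: sobolev_norm_1_bounds flip: L2_norm_weak_grad_diff\<close>)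
  then show ?thesis using u \<phi> by (auto simp: H10_def fun_diff_def)
qed

lemma subspace_H10: "subspace (H10 \<Omega>)"
proof (rule subspaceI)
  have "(0 :: real ^ 'd \<Rightarrow> real) \<in> test_functions \<Omega>" by (rule subspace_0[OF subspace_test_functions])
  then show "0 \<in> H10 \<Omega>" by (intro H10I[of 0 "\<lambda>n. 0"]) auto
next
  fix u v assume uv: "u \<in> H10 \<Omega>" "v \<in> H10 \<Omega>"
  obtain \<phi> where \<phi>: "\<And>n. \<phi> n \<in> test_functions \<Omega>"
    "(\<lambda>n. L2_norm \<Omega> (u - \<phi> n)) \<longlonglongrightarrow> 0" "(\<lambda>n. L2_norm \<Omega> (weak_grad \<Omega> u - weak_grad \<Omega> (\<phi> n))) \<longlonglongrightarrow> 0"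
    using H10D[OF uv(1)] by blast
  obtain \<psi> where \<psi>: "\<And>n. \<psi> n \<in> test_functions \<Omega>"
    "(\<lambda>n. L2_norm \<Omega> (v - \<psi> n)) \<longlonglongrightarrow> 0" "(\<lambda>n. L2_norm \<Omega> (weak_grad \<Omega> v - weak_grad \<Omega> (\<psi> n))) \<longlonglongrightarrow> 0"
    using H10D[OF uv(2)] by blast
  have S: "u \<in> sobolev 1 \<Omega>" "v \<in> sobolev 1 \<Omega>" "\<phi> n \<in> sobolev 1 \<Omega>" "\<psi> n \<in> sobolev 1 \<Omega>" for n
    using uv \<phi> \<psi> H10_sobolev_1 test_function_sobolev_1 by auto
  show "u + v \<in> H10 \<Omega>"
  proof (rule H10I[of _ "\<lambda>n. \<phi> n + \<psi> n"])
    show "\<phi> n + \<psi> n \<in> test_functions \<Omega>" for n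
      using \<phi> \<psi> by (simp add: subspace_add subspace_test_functions)
    have "L2_norm \<Omega> (u + v - (\<phi> n + \<psi> n)) \<le> L2_norm \<Omega> (u - \<phi> n) + L2_norm \<Omega> (v - \<psi> n)" for n
      using L2.nm_add_le[of "u - \<phi> n" \<Omega> "v - \<psi> n"] S by (simp add: sobolev_1_L2 algebra_simps)
    then show "(\<lambda>n. L2_norm \<Omega> (u + v - (\<phi> n + \<psi> n))) \<longlonglongrightarrow> 0"
      using tendsto_add[OF \<phi>(2) \<psi>(2)] by (intro LIMSEQ_null_le[OF L2_norm_nonneg]) simp_all
    have "L2_norm \<Omega> (weak_grad \<Omega> (u + v) - weak_grad \<Omega> (\<phi> n + \<psi> n)) \<le>
        L2_norm \<Omega> (weak_grad \<Omega> u - weak_grad \<Omega> (\<phi> n)) + L2_norm \<Omega> (weak_grad \<Omega> v - weak_grad \<Omega> (\<psi> n))" for n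
    proof -
      have "L2_norm \<Omega> (weak_grad \<Omega> (u + v) - weak_grad \<Omega> (\<phi> n + \<psi> n)) =
        L2_norm \<Omega> ((weak_grad \<Omega> u - weak_grad \<Omega> (\<phi> n)) + (weak_grad \<Omega> v - weak_grad \<Omega> (\<psi> n)))"
        using S
        by (intro L2_norm_cong L2_norm_diff_eq_0I) (simp_all add: L2_inner_weak_grad L2.ip_left weak_grad_L2)
      then show ?thesis
        using L2.nm_add_le[of "weak_grad \<Omega> u - weak_grad \<Omega> (\<phi> n)" \<Omega> "weak_grad \<Omega> v - weak_grad \<Omega> (\<psi> n)"] S
        by (simp add: weak_grad_L2)
    qed
    then show "(\<lambda>n. L2_norm \<Omega> (weak_grad \<Omega> (u + v) - weak_grad \<Omega> (\<phi> n + \<psi> n))) \<longlonglongrightarrow> 0"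
      using tendsto_add[OF \<phi>(3) \<psi>(3)] by (intro LIMSEQ_null_le[OF L2_norm_nonneg]) simp_all
  qed (use S in auto)
next
  fix c u assume u: "u \<in> H10 \<Omega>"
  obtain \<phi> where \<phi>: "\<And>n. \<phi> n \<in> test_functions \<Omega>"
    "(\<lambda>n. L2_norm \<Omega> (u - \<phi> n)) \<longlonglongrightarrow> 0" "(\<lambda>n. L2_norm \<Omega> (weak_grad \<Omega> u - weak_grad \<Omega> (\<phi> n))) \<longlonglongrightarrow> 0"
    using H10D[OF u] by blast
  have S: "u \<in> sobolev 1 \<Omega>" "\<phi> n \<in> sobolev 1 \<Omega>" for n
    using u \<phi> H10_sobolev_1 test_function_sobolev_1 by auto
  show "c *\<^sub>R u \<in> H10 \<Omega>"
  proof (rule H10I[of _ "\<lambda>n. c *\<^sub>R \<phi> n"])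
    show "c *\<^sub>R \<phi> n \<in> test_functions \<Omega>" for n
      using \<phi> by (simp add: subspace_scale subspace_test_functions)
    have "L2_norm \<Omega> (c *\<^sub>R u - c *\<^sub>R \<phi> n) = \<bar>c\<bar> * L2_norm \<Omega> (u - \<phi> n)" for n
      using L2.nm_scale[of "u - \<phi> n" \<Omega> c] S by (simp add: sobolev_1_L2 scaleR_right_diff_distrib)
    then show "(\<lambda>n. L2_norm \<Omega> (c *\<^sub>R u - c *\<^sub>R \<phi> n)) \<longlonglongrightarrow> 0"
      using tendsto_mult_right_zero[OF \<phi>(2)] by simp
    have "L2_norm \<Omega> (weak_grad \<Omega> (c *\<^sub>R u) - weak_grad \<Omega> (c *\<^sub>R \<phi> n)) =
        \<bar>c\<bar> * L2_norm \<Omega> (weak_grad \<Omega> u - weak_grad \<Omega> (\<phi> n))" for n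
    proof -
      have "L2_norm \<Omega> (weak_grad \<Omega> (c *\<^sub>R u) - weak_grad \<Omega> (c *\<^sub>R \<phi> n)) =
        L2_norm \<Omega> (c *\<^sub>R (weak_grad \<Omega> u - weak_grad \<Omega> (\<phi> n)))"
        using S
        by (intro L2_norm_cong L2_norm_diff_eq_0I) (simp_all add: L2_inner_weak_grad L2.ip_left weak_grad_L2 right_diff_distrib)
      then show ?thesis
        using L2.nm_scale[of "weak_grad \<Omega> u - weak_grad \<Omega> (\<phi> n)" \<Omega> c] S by (simp add: weak_grad_L2)
    qed
    then show "(\<lambda>n. L2_norm \<Omega> (weak_grad \<Omega> (c *\<^sub>R u) - weak_grad \<Omega> (c *\<^sub>R \<phi> n))) \<longlonglongrightarrow> 0"
      using tendsto_mult_right_zero[OF \<phi>(3)] by simp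
  qed (use S in auto)
qed

lemma test_function_H10: "\<phi> \<in> test_functions \<Omega> \<Longrightarrow> \<phi> \<in> H10 \<Omega>"
  by (rule H10I[of \<phi> "\<lambda>n. \<phi>"]) (auto intro: test_function_sobolev_1)

text \<open>For test functions this is the definition of the weak divergence. Both sides are
  continuous along an approximating sequence that converges together with its gradients, so no
  boundary term appears.\<close>

lemma weak_div_weak_grad:
  assumes u: "u \<in> H10 \<Omega>" and \<tau>: "\<tau> \<in> Hdiv \<Omega>"
  shows "L2_inner \<Omega> \<tau> (weak_grad \<Omega> u) = - L2_inner \<Omega> (weak_div \<Omega> \<tau>) u"
proof -
  obtain \<phi> where \<phi>: "\<And>n. \<phi> n \<in> test_functions \<Omega>"
    and lim0: "(\<lambda>n. L2_norm \<Omega> (u - \<phi> n)) \<longlonglongrightarrow> 0" "(\<lambda>n. L2_norm \<Omega> (weak_grad \<Omega> u - weak_grad \<Omega> (\<phi> n))) \<longlonglongrightarrow> 0"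
    using H10D[OF u] by blast
  have S: "\<phi> n \<in> sobolev 1 \<Omega>" for n using test_function_sobolev_1[OF \<phi>] .
  have lim: "(\<lambda>n. L2_norm \<Omega> (\<phi> n - u)) \<longlonglongrightarrow> 0" "(\<lambda>n. L2_norm \<Omega> (weak_grad \<Omega> (\<phi> n) - weak_grad \<Omega> u)) \<longlonglongrightarrow> 0"
    using lim0 L2.nm_diff_commute[OF H10_L2[OF u] sobolev_1_L2[OF S]]
      L2.nm_diff_commute[OF H10_weak_grad_L2[OF u] weak_grad_L2[OF S]]
    by simp_all
  have eq: "L2_inner \<Omega> (weak_grad \<Omega> (\<phi> n)) \<tau> = - L2_inner \<Omega> (\<phi> n) (weak_div \<Omega> \<tau>)" for n
  proof -
    have "L2_inner \<Omega> (weak_grad \<Omega> (\<phi> n)) \<tau> = L2_inner \<Omega> \<tau> (cgrad (\<phi> n))"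
      using L2_inner_cong_right[OF _ _ weak_grad_test_function[OF \<phi>] Hdiv_L2[OF \<tau>]]
        L2.ip_commute[OF weak_grad_L2[OF S] Hdiv_L2[OF \<tau>]] cgrad_L2[OF \<phi>] weak_grad_L2[OF S] by simp
    also have "\<dots> = - L2_inner \<Omega> (weak_div \<Omega> \<tau>) (\<phi> n)"
      using has_weak_div_weak_div[OF \<tau>] \<phi> by (simp add: has_weak_div_def cgrad_def)
    finally show ?thesis
      using L2.ip_commute[OF weak_div_L2[OF \<tau>] sobolev_1_L2[OF S]] by simp
  qed
  have "(\<lambda>n. L2_inner \<Omega> (weak_grad \<Omega> (\<phi> n)) \<tau>) \<longlonglongrightarrow> L2_inner \<Omega> (weak_grad \<Omega> u) \<tau>"
    by (rule L2.ip_tendsto[OF weak_grad_L2[OF S] H10_weak_grad_L2[OF u] Hdiv_L2[OF \<tau>] lim(2)])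
  moreover have "(\<lambda>n. - L2_inner \<Omega> (\<phi> n) (weak_div \<Omega> \<tau>)) \<longlonglongrightarrow> - L2_inner \<Omega> u (weak_div \<Omega> \<tau>)"
    by (intro tendsto_minus L2.ip_tendsto[OF sobolev_1_L2[OF S] H10_L2[OF u] weak_div_L2[OF \<tau>] lim(1)])
  ultimately have "L2_inner \<Omega> (weak_grad \<Omega> u) \<tau> = - L2_inner \<Omega> u (weak_div \<Omega> \<tau>)"
    unfolding eq by (rule LIMSEQ_unique)
  then show ?thesis
    using L2.ip_commute[OF H10_weak_grad_L2[OF u] Hdiv_L2[OF \<tau>]]
      L2.ip_commute[OF H10_L2[OF u] weak_div_L2[OF \<tau>]] by simp
qed

lemma friedrichs: "\<exists>c\<ge>0. \<forall>u\<in>H10 \<Omega>. L2_norm \<Omega> u \<le> c * L2_norm \<Omega> (weak_grad \<Omega> u)"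
proof -
  obtain c where c: "\<And>\<phi> i. \<phi> \<in> test_functions \<Omega> \<Longrightarrow> L2_norm \<Omega> \<phi> \<le> c * L2_norm \<Omega> (partial i \<phi>)"
    using friedrichs_test_function by blast
  have test: "L2_norm \<Omega> \<phi> \<le> \<bar>c\<bar> * L2_norm \<Omega> (weak_grad \<Omega> \<phi>)" if \<phi>: "\<phi> \<in> test_functions \<Omega>" for \<phi>
  proof -
    \<comment> \<open>Any one direction will do: its derivative is dominated by the full gradient.
      The absolute value is taken because the sign of c is unknown.\<close>
    fix i :: 'd
    have "(L2_norm \<Omega> (partial i \<phi>))\<^sup>2 \<le> (\<Sum>i\<in>UNIV. (L2_norm \<Omega> (partial i \<phi>))\<^sup>2)"
      by (rule member_le_sum) auto
    also have "\<dots> = (L2_norm \<Omega> (cgrad \<phi>))\<^sup>2"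
      using L2_inner_vec[OF cgrad_L2[OF \<phi>] cgrad_L2[OF \<phi>]] cgrad_L2[OF \<phi>] test_function_partial_L2[OF \<phi>]
      by (simp add: L2.nm_sq) (simp add: cgrad_def)
    finally have "L2_norm \<Omega> (partial i \<phi>) \<le> L2_norm \<Omega> (cgrad \<phi>)"
      by (rule power2_le_imp_le) simp
    also have "\<dots> = L2_norm \<Omega> (weak_grad \<Omega> \<phi>)"
      using L2_norm_cong[OF _ _ weak_grad_test_function[OF \<phi>]] \<phi>
      by (simp add: cgrad_L2 weak_grad_L2 test_function_sobolev_1)
    finally have "\<bar>c\<bar> * L2_norm \<Omega> (partial i \<phi>) \<le> \<bar>c\<bar> * L2_norm \<Omega> (weak_grad \<Omega> \<phi>)"
      by (rule mult_left_mono) simp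
    moreover have "c * L2_norm \<Omega> (partial i \<phi>) \<le> \<bar>c\<bar> * L2_norm \<Omega> (partial i \<phi>)"
      by (rule mult_right_mono) auto
    ultimately show ?thesis using c[OF \<phi>, of i] by linarith
  qed
  have "L2_norm \<Omega> u \<le> \<bar>c\<bar> * L2_norm \<Omega> (weak_grad \<Omega> u)" if u: "u \<in> H10 \<Omega>" for u
  proof -
    obtain \<phi> where \<phi>: "\<And>n. \<phi> n \<in> test_functions \<Omega>"
      and lim: "(\<lambda>n. L2_norm \<Omega> (u - \<phi> n)) \<longlonglongrightarrow> 0" "(\<lambda>n. L2_norm \<Omega> (weak_grad \<Omega> u - weak_grad \<Omega> (\<phi> n))) \<longlonglongrightarrow> 0"
      using H10D[OF u] by blast
    have S: "\<phi> n \<in> L2 \<Omega>" "weak_grad \<Omega> (\<phi> n) \<in> L2 \<Omega>" for n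
      using test_function_sobolev_1[OF \<phi>] by (simp_all add: sobolev_1_L2 weak_grad_L2)
    have lim': "(\<lambda>n. L2_norm \<Omega> (\<phi> n - u)) \<longlonglongrightarrow> 0" "(\<lambda>n. L2_norm \<Omega> (weak_grad \<Omega> (\<phi> n) - weak_grad \<Omega> u)) \<longlonglongrightarrow> 0"
      using lim L2.nm_diff_commute[OF H10_L2[OF u] S(1)] L2.nm_diff_commute[OF H10_weak_grad_L2[OF u] S(2)]
      by simp_all
    show ?thesis
    proof (rule LIMSEQ_le)
      show "(\<lambda>n. L2_norm \<Omega> (\<phi> n)) \<longlonglongrightarrow> L2_norm \<Omega> u"
        by (rule L2.nm_tendsto[OF S(1) H10_L2[OF u] lim'(1)])
      show "(\<lambda>n. \<bar>c\<bar> * L2_norm \<Omega> (weak_grad \<Omega> (\<phi> n))) \<longlonglongrightarrow> \<bar>c\<bar> * L2_norm \<Omega> (weak_grad \<Omega> u)"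
        by (intro tendsto_intros L2.nm_tendsto[OF S(2) H10_weak_grad_L2[OF u] lim'(2)])
      show "\<exists>N. \<forall>n\<ge>N. L2_norm \<Omega> (\<phi> n) \<le> \<bar>c\<bar> * L2_norm \<Omega> (weak_grad \<Omega> (\<phi> n))"
        using test[OF \<phi>] by blast
    qed
  qed
  then show ?thesis using abs_ge_zero by blast
qed

section \<open>Solvability of the Poisson problem\<close>

definition grad_inner :: "(real ^ 'd \<Rightarrow> real) \<Rightarrow> (real ^ 'd \<Rightarrow> real) \<Rightarrow> real" where
  "grad_inner u v = L2_inner \<Omega> (weak_grad \<Omega> u) (weak_grad \<Omega> v)"

sublocale H10: semi_inner_space "H10 \<Omega>" grad_inner
  rewrites "\<And>u. sqrt (grad_inner u u) = L2_norm \<Omega> (weak_grad \<Omega> u)"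
proof -
  show "semi_inner_space (H10 \<Omega>) grad_inner"
  proof
    show "subspace (H10 \<Omega>)" by (rule subspace_H10)
  qed (auto simp: grad_inner_def L2_inner_weak_grad H10_sobolev_1 H10_weak_grad_L2 L2.ip_self_nonneg
      intro: L2.ip_commute)
qed (simp add: grad_inner_def L2_norm_def)

text \<open>Friedrichs' inequality makes the functions Cauchy in \<open>L2\<close> along with their
  gradients. The relation between a function and its weak gradient passes to the limits, and so does
  approximability by test functions.\<close>

lemma H10_complete: "H10.seq_complete"
  unfolding H10.seq_complete_def
proof (intro allI impI)
  fix X :: "nat \<Rightarrow> real ^ 'd \<Rightarrow> real" assume "\<forall>n. X n \<in> H10 \<Omega>"
    and cauchy: "\<forall>e>0. \<exists>N. \<forall>m\<ge>N. \<forall>n\<ge>N. L2_norm \<Omega> (weak_grad \<Omega> (X m - X n)) < e"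
  then have X: "X n \<in> H10 \<Omega>" for n by simp
  then have XS: "X n \<in> sobolev 1 \<Omega>" and XL: "X n \<in> L2 \<Omega>" and GL: "weak_grad \<Omega> (X n) \<in> L2 \<Omega>" for n
    by (simp_all add: H10_sobolev_1 H10_L2 H10_weak_grad_L2)
  obtain c where c: "c \<ge> 0" "\<And>u. u \<in> H10 \<Omega> \<Longrightarrow> L2_norm \<Omega> u \<le> c * L2_norm \<Omega> (weak_grad \<Omega> u)"
    using friedrichs by blast
  have cauchy_grad: "\<forall>e>0. \<exists>N. \<forall>m\<ge>N. \<forall>n\<ge>N. L2_norm \<Omega> (weak_grad \<Omega> (X m) - weak_grad \<Omega> (X n)) < e"
    using cauchy L2_norm_weak_grad_diff[OF XS XS] by simp
  obtain \<gamma> where \<gamma>: "\<gamma> \<in> L2 \<Omega>" "(\<lambda>n. L2_norm \<Omega> (weak_grad \<Omega> (X n) - \<gamma>)) \<longlonglongrightarrow> 0"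
    using L2.seq_completeD[OF L2_complete[OF lmeasurable_\<Omega>] GL cauchy_grad] by blast
  have cauchy_L2: "\<forall>e>0. \<exists>N. \<forall>m\<ge>N. \<forall>n\<ge>N. L2_norm \<Omega> (X m - X n) < e"
  proof (intro allI impI)
    fix e :: real assume "e > 0"
    \<comment> \<open>Dividing by c + 1 also covers c = 0 and makes the final inequality
      strict.\<close>
    then have "e / (c + 1) > 0" using c(1) by simp
    then obtain N where N: "\<And>m n. \<lbrakk>m \<ge> N; n \<ge> N\<rbrakk> \<Longrightarrow> L2_norm \<Omega> (weak_grad \<Omega> (X m - X n)) < e / (c + 1)"
      using cauchy by meson
    have "L2_norm \<Omega> (X m - X n) < e" if "m \<ge> N" "n \<ge> N" for m n
    proof -
      have "L2_norm \<Omega> (X m - X n) \<le> c * L2_norm \<Omega> (weak_grad \<Omega> (X m - X n))"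
        using c(2) X by simp
      also have "\<dots> \<le> c * (e / (c + 1))" using N[OF that] c(1) by (intro mult_left_mono) auto
      also have "\<dots> < e" using \<open>e > 0\<close> c(1) by (simp add: field_simps)
      finally show ?thesis .
    qed
    then show "\<exists>N. \<forall>m\<ge>N. \<forall>n\<ge>N. L2_norm \<Omega> (X m - X n) < e" by blast
  qed
  obtain u where u: "u \<in> L2 \<Omega>" "(\<lambda>n. L2_norm \<Omega> (X n - u)) \<longlonglongrightarrow> 0"
    using L2.seq_completeD[OF L2_complete[OF lmeasurable_\<Omega>] XL cauchy_L2] by blast
  have wg: "is_weak_grad \<Omega> u \<gamma>"
    unfolding is_weak_grad_def has_weak_partial_def
  proof (intro allI conjI ballI)
    fix i
    show \<gamma>i: "(\<lambda>x. \<gamma> x $ i) \<in> L2 \<Omega>" using \<gamma>(1) L2_vec_iff by blast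
    fix \<phi> assume \<phi>: "\<phi> \<in> test_functions \<Omega>"
    have Gi: "(\<lambda>x. weak_grad \<Omega> (X n) x $ i) \<in> L2 \<Omega>" for n using GL L2_vec_iff by blast
    have "(\<lambda>n. L2_norm \<Omega> ((\<lambda>x. weak_grad \<Omega> (X n) x $ i) - (\<lambda>x. \<gamma> x $ i))) \<longlonglongrightarrow> 0"
    proof (rule LIMSEQ_null_le[OF L2_norm_nonneg _ \<gamma>(2)])
      show "L2_norm \<Omega> ((\<lambda>x. weak_grad \<Omega> (X n) x $ i) - (\<lambda>x. \<gamma> x $ i))
          \<le> L2_norm \<Omega> (weak_grad \<Omega> (X n) - \<gamma>)" for n
      proof (rule power2_le_imp_le)
        have L: "weak_grad \<Omega> (X n) - \<gamma> \<in> L2 \<Omega>" using GL \<gamma> by simp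
        have Li: "(\<lambda>x. (weak_grad \<Omega> (X n) - \<gamma>) x $ j) \<in> L2 \<Omega>" for j using L L2_vec_iff by blast
        have "(L2_norm \<Omega> (\<lambda>x. (weak_grad \<Omega> (X n) - \<gamma>) x $ i))\<^sup>2
          \<le> (\<Sum>j\<in>UNIV. (L2_norm \<Omega> (\<lambda>x. (weak_grad \<Omega> (X n) - \<gamma>) x $ j))\<^sup>2)"
          by (rule member_le_sum) auto
        also have "\<dots> = (L2_norm \<Omega> (weak_grad \<Omega> (X n) - \<gamma>))\<^sup>2"
          unfolding L2.nm_sq[OF L] L2.nm_sq[OF Li] by (rule L2_inner_vec[OF L L, symmetric])
        finally show "(L2_norm \<Omega> ((\<lambda>x. weak_grad \<Omega> (X n) x $ i) - (\<lambda>x. \<gamma> x $ i)))\<^sup>2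
          \<le> (L2_norm \<Omega> (weak_grad \<Omega> (X n) - \<gamma>))\<^sup>2"
          by (simp add: fun_diff_def)
      qed simp
    qed
    then have "(\<lambda>n. L2_inner \<Omega> (\<lambda>x. weak_grad \<Omega> (X n) x $ i) \<phi>) \<longlonglongrightarrow> L2_inner \<Omega> (\<lambda>x. \<gamma> x $ i) \<phi>"
      by (rule L2.ip_tendsto[OF Gi \<gamma>i test_function_L2[OF \<phi>]])
    then have "(\<lambda>n. - L2_inner \<Omega> (\<lambda>x. weak_grad \<Omega> (X n) x $ i) \<phi>) \<longlonglongrightarrow> - L2_inner \<Omega> (\<lambda>x. \<gamma> x $ i) \<phi>"
      by (rule tendsto_minus)
    moreover have "- L2_inner \<Omega> (\<lambda>x. weak_grad \<Omega> (X n) x $ i) \<phi> = L2_inner \<Omega> (X n) (partial i \<phi>)" for n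
      using is_weak_grad_weak_grad[OF XS] \<phi> by (simp add: is_weak_grad_def has_weak_partial_def)
    moreover have "(\<lambda>n. L2_inner \<Omega> (X n) (partial i \<phi>)) \<longlonglongrightarrow> L2_inner \<Omega> u (partial i \<phi>)"
      by (rule L2.ip_tendsto[OF XL u(1) test_function_partial_L2[OF \<phi>] u(2)])
    ultimately show "L2_inner \<Omega> u (partial i \<phi>) = - L2_inner \<Omega> (\<lambda>x. \<gamma> x $ i) \<phi>"
      using LIMSEQ_unique by simp
  qed
  have uS: "u \<in> sobolev 1 \<Omega>" and u\<gamma>: "L2_norm \<Omega> (weak_grad \<Omega> u - \<gamma>) = 0"
    using weak_gradI[OF u(1) wg] by auto
  have "L2_norm \<Omega> (weak_grad \<Omega> (X n) - weak_grad \<Omega> u) = L2_norm \<Omega> (weak_grad \<Omega> (X n) - \<gamma>)" for n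
    using GL \<gamma>(1) weak_grad_L2[OF uS] L2_inner_cong_left[OF _ _ u\<gamma>]
    by (intro L2_norm_cong L2_norm_diff_eq_0I) (auto simp: L2.ip_left)
  then have lim_grad: "(\<lambda>n. L2_norm \<Omega> (weak_grad \<Omega> (X n) - weak_grad \<Omega> u)) \<longlonglongrightarrow> 0"
    using \<gamma>(2) by simp
  \<comment> \<open>Diagonal choice: each X n is replaced by a test function at distance below 1 /
    (n + 1), and these test functions approximate the limit.\<close>
  have "\<exists>\<phi>. \<phi> \<in> test_functions \<Omega> \<and> L2_norm \<Omega> (X n - \<phi>) < inverse (real (Suc n)) \<and>
      L2_norm \<Omega> (weak_grad \<Omega> (X n) - weak_grad \<Omega> \<phi>) < inverse (real (Suc n))" for n
  proof -
    obtain \<psi> where \<psi>: "\<And>n. \<psi> n \<in> test_functions \<Omega>" "(\<lambda>m. L2_norm \<Omega> (X n - \<psi> m)) \<longlonglongrightarrow> 0"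
      "(\<lambda>m. L2_norm \<Omega> (weak_grad \<Omega> (X n) - weak_grad \<Omega> (\<psi> m))) \<longlonglongrightarrow> 0"
      using H10D[OF X] by blast
    have "\<forall>\<^sub>F m in sequentially. L2_norm \<Omega> (X n - \<psi> m) < inverse (real (Suc n)) \<and>
      L2_norm \<Omega> (weak_grad \<Omega> (X n) - weak_grad \<Omega> (\<psi> m)) < inverse (real (Suc n))"
      by (intro eventually_conj order_tendstoD(2)[OF \<psi>(2)] order_tendstoD(2)[OF \<psi>(3)]) auto
    from eventually_happens'[OF sequentially_bot this] show ?thesis using \<psi>(1) by blast
  qed
  then obtain \<phi> where \<phi>_all: "\<And>n. \<phi> n \<in> test_functions \<Omega> \<and> L2_norm \<Omega> (X n - \<phi> n) < inverse (real (Suc n)) \<and>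
      L2_norm \<Omega> (weak_grad \<Omega> (X n) - weak_grad \<Omega> (\<phi> n)) < inverse (real (Suc n))"
    by metis
  then have \<phi>: "\<phi> n \<in> test_functions \<Omega>"
    and \<phi>1: "L2_norm \<Omega> (X n - \<phi> n) < inverse (real (Suc n))"
    and \<phi>2: "L2_norm \<Omega> (weak_grad \<Omega> (X n) - weak_grad \<Omega> (\<phi> n)) < inverse (real (Suc n))" for n
    by blast+
  have \<phi>L: "\<phi> n \<in> L2 \<Omega>" "weak_grad \<Omega> (\<phi> n) \<in> L2 \<Omega>" for n
    using test_function_sobolev_1[OF \<phi>] by (simp_all add: sobolev_1_L2 weak_grad_L2)
  have "u \<in> H10 \<Omega>"
  proof (rule H10I[OF uS \<phi>])
    have "(\<lambda>n. L2_norm \<Omega> (X n - u) + inverse (real (Suc n))) \<longlonglongrightarrow> 0"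
      using tendsto_add[OF u(2) LIMSEQ_inverse_real_of_nat] by simp
    moreover have "L2_norm \<Omega> (u - \<phi> n) \<le> L2_norm \<Omega> (X n - u) + inverse (real (Suc n))" for n
      using L2.nm_triangle[OF u(1) XL \<phi>L(1), of n n] L2.nm_diff_commute[OF u(1) XL, of n] \<phi>1[of n] by simp
    ultimately show "(\<lambda>n. L2_norm \<Omega> (u - \<phi> n)) \<longlonglongrightarrow> 0"
      by (intro LIMSEQ_null_le[OF L2_norm_nonneg])
    have "(\<lambda>n. L2_norm \<Omega> (weak_grad \<Omega> (X n) - weak_grad \<Omega> u) + inverse (real (Suc n))) \<longlonglongrightarrow> 0"
      using tendsto_add[OF lim_grad LIMSEQ_inverse_real_of_nat] by simp
    moreover have "L2_norm \<Omega> (weak_grad \<Omega> u - weak_grad \<Omega> (\<phi> n)) \<le>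
        L2_norm \<Omega> (weak_grad \<Omega> (X n) - weak_grad \<Omega> u) + inverse (real (Suc n))" for n
      using L2.nm_triangle[OF weak_grad_L2[OF uS] GL \<phi>L(2), of n n]
        L2.nm_diff_commute[OF weak_grad_L2[OF uS] GL, of n] \<phi>2[of n] by simp
    ultimately show "(\<lambda>n. L2_norm \<Omega> (weak_grad \<Omega> u - weak_grad \<Omega> (\<phi> n))) \<longlonglongrightarrow> 0"
      by (intro LIMSEQ_null_le[OF L2_norm_nonneg])
  qed
  moreover have "(\<lambda>n. L2_norm \<Omega> (weak_grad \<Omega> (X n - u))) \<longlonglongrightarrow> 0"
    using lim_grad L2_norm_weak_grad_diff[OF XS uS] by simp
  ultimately show "\<exists>x\<in>H10 \<Omega>. (\<lambda>n. L2_norm \<Omega> (weak_grad \<Omega> (X n - x))) \<longlonglongrightarrow> 0" by blast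
qed

text \<open>Friedrichs' inequality bounds the load functional by the gradient norm, so the Riesz
  theorem on \<open>H10\<close> applies.\<close>

lemma poisson_solution_exists:
  assumes f: "f \<in> L2 \<Omega>"
  shows "\<exists>u. poisson_solution \<Omega> f u"
proof -
  obtain c where c: "c \<ge> 0" "\<And>u. u \<in> H10 \<Omega> \<Longrightarrow> L2_norm \<Omega> u \<le> c * L2_norm \<Omega> (weak_grad \<Omega> u)"
    using friedrichs by blast
  have "\<exists>u\<in>H10 \<Omega>. \<forall>v\<in>H10 \<Omega>. grad_inner u v = L2_inner \<Omega> f v"
  proof (rule H10.riesz_complete[OF H10_complete])
    fix v assume v: "v \<in> H10 \<Omega>"
    have "\<bar>L2_inner \<Omega> f v\<bar> \<le> L2_norm \<Omega> f * L2_norm \<Omega> v"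
      by (rule L2.Cauchy_Schwarz[OF f H10_L2[OF v]])
    also have "\<dots> \<le> L2_norm \<Omega> f * (c * L2_norm \<Omega> (weak_grad \<Omega> v))"
      by (intro mult_left_mono c(2) v) simp
    finally show "\<bar>L2_inner \<Omega> f v\<bar> \<le> (L2_norm \<Omega> f * c) * L2_norm \<Omega> (weak_grad \<Omega> v)"
      by (simp add: mult.assoc)
  qed (simp_all add: L2.ip_right f H10_L2)
  then show ?thesis by (auto simp: poisson_solution_def grad_inner_def)
qed

end

section \<open>The least squares bilinear form\<close>

text \<open>The infimum need not be attained, so strict room above the bound is needed to extract an
  approximant.\<close>

lemma INF_le_obtain:
  fixes F :: "'a \<Rightarrow> real"
  assumes "(INF x\<in>A. F x) \<le> b" "b < c" "A \<noteq> {}"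
  obtains x where "x \<in> A" "F x < c"
  using cInf_lessD[of "F ` A" c] assms by auto

lemma finite_dim_space_span:
  assumes "finite_dim_space V"
  obtains B where "finite B" "V = span B"
proof -
  obtain B :: "('a \<Rightarrow> 'b) set" where B: "finite B"
    "V = range (\<lambda>c :: ('a \<Rightarrow> 'b) \<Rightarrow> real. \<lambda>x. \<Sum>b\<in>B. c b *\<^sub>R b x)"
    using assms by (auto simp: finite_dim_space_def)
  then have "V = span B" by (simp add: span_finite sum_scaleR_fun_eq)
  then show ?thesis using B(1) that by blast
qed

lemma span_Times_eq:
  fixes A :: "'a::real_vector set" and B :: "'b::real_vector set"
  shows "span ((\<lambda>a. (a, 0)) ` A \<union> (\<lambda>b. (0, b)) ` B) = span A \<times> span B"
proof -
  have lin: "linear (\<lambda>a :: 'a. (a, 0 :: 'b))" "linear (\<lambda>b :: 'b. (0 :: 'a, b))"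
    by (auto intro!: linearI)
  let ?S = "(\<lambda>a. (a, 0)) ` A \<union> (\<lambda>b. (0, b)) ` B"
  show ?thesis
  proof
    show "span ?S \<subseteq> span A \<times> span B"
      by (rule span_minimal) (auto intro: span_base span_zero subspace_Times subspace_span)
    show "span A \<times> span B \<subseteq> span ?S"
    proof clarify
      fix a b assume "a \<in> span A" "b \<in> span B"
      then have "(a, 0) \<in> span ((\<lambda>a. (a, 0 :: 'b)) ` A)" "(0, b) \<in> span ((\<lambda>b. (0 :: 'a, b)) ` B)"
        unfolding linear_span_image[OF lin(1)] linear_span_image[OF lin(2)] by simp_all
      then have "(a, 0) \<in> span ?S" "(0, b) \<in> span ?S"
        using span_mono[OF Un_upper1[of "(\<lambda>a. (a, 0)) ` A" "(\<lambda>b. (0, b)) ` B"]]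
          span_mono[OF Un_upper2[of "(\<lambda>b. (0, b)) ` B" "(\<lambda>a. (a, 0)) ` A"]] by auto
      then have "(a, 0) + (0, b) \<in> span ?S" by (rule span_add)
      then show "(a, b) \<in> span ?S" by simp
    qed
  qed
qed

context bounded_open_set
begin

text \<open>The sum of the left-hand sides of the two equations, recognised as the form of the least
  squares functional for the system \<sigma> = grad u, div \<sigma> = -f. In this shape symmetry and
  nonnegativity are visible.\<close>

definition fosls_inner ::
    "(real ^ 'd \<Rightarrow> real ^ 'd) \<times> (real ^ 'd \<Rightarrow> real) \<Rightarrow> (real ^ 'd \<Rightarrow> real ^ 'd) \<times> (real ^ 'd \<Rightarrow> real) \<Rightarrow> real" where
  "fosls_inner y z =
     L2_inner \<Omega> (fst y - weak_grad \<Omega> (snd y)) (fst z - weak_grad \<Omega> (snd z))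
       + L2_inner \<Omega> (weak_div \<Omega> (fst y)) (weak_div \<Omega> (fst z))"

sublocale fosls: semi_inner_space "Hdiv \<Omega> \<times> H10 \<Omega>" fosls_inner
proof
  show "subspace (Hdiv \<Omega> \<times> H10 \<Omega>)" by (intro subspace_Times subspace_Hdiv subspace_H10)
  show "fosls_inner y z = fosls_inner z y" if "y \<in> Hdiv \<Omega> \<times> H10 \<Omega>" "z \<in> Hdiv \<Omega> \<times> H10 \<Omega>" for y z
    unfolding fosls_inner_def using that
    by (intro arg_cong2[where f = "(+)"] L2.ip_commute L2.V_diff)
      (auto simp: Hdiv_L2 weak_div_L2 H10_weak_grad_L2)
  show "0 \<le> fosls_inner y y" if "y \<in> Hdiv \<Omega> \<times> H10 \<Omega>" for y
    unfolding fosls_inner_def using that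
    by (intro add_nonneg_nonneg L2.ip_self_nonneg L2.V_diff) (auto simp: Hdiv_L2 weak_div_L2 H10_weak_grad_L2)
qed (auto simp: fosls_inner_def Hdiv_L2 weak_div_L2 H10_weak_grad_L2 H10_sobolev_1 L2.ip_left
    L2_inner_weak_div L2_inner_weak_grad algebra_simps)

lemma L2_inner_weak_grad_0: "\<tau> \<in> L2 \<Omega> \<Longrightarrow> L2_inner \<Omega> \<tau> (weak_grad \<Omega> 0) = 0"
  using L2_inner_weak_grad_scale[of \<tau> 0 0] L2.ip_commute[of \<tau> \<Omega> "weak_grad \<Omega> 0"] weak_grad_L2[of 0 \<Omega>]
  by simp

lemma L2_inner_weak_div_0: "g \<in> L2 \<Omega> \<Longrightarrow> L2_inner \<Omega> g (weak_div \<Omega> 0) = 0"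
  using L2_inner_weak_div_scale[of g 0 0] L2.ip_commute[of g \<Omega> "weak_div \<Omega> 0"] weak_div_L2[of 0 \<Omega>]
  by simp

lemma fosls_inner_eq:
  assumes "\<sigma> \<in> Hdiv \<Omega>" "u \<in> H10 \<Omega>" "\<tau> \<in> Hdiv \<Omega>" "v \<in> H10 \<Omega>"
  shows "fosls_inner (\<sigma>, u) (\<tau>, v) =
    (L2_inner \<Omega> \<sigma> \<tau> + L2_inner \<Omega> (weak_div \<Omega> \<sigma>) (weak_div \<Omega> \<tau>) - L2_inner \<Omega> (weak_grad \<Omega> u) \<tau>)
      + (- L2_inner \<Omega> \<sigma> (weak_grad \<Omega> v) + L2_inner \<Omega> (weak_grad \<Omega> u) (weak_grad \<Omega> v))"
  using assms by (simp add: fosls_inner_def Hdiv_L2 H10_weak_grad_L2 L2.ip_left L2.ip_right)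

text \<open>Adding the two equations gives the single one; taking v = 0 or \<tau> = 0 separates them
  again. The chosen derivatives of 0 are only null functions, so their vanishing has to be read off
  from inner products.\<close>

lemma fosls_solution_iff:
  assumes "S \<subseteq> Hdiv \<Omega>" "V \<subseteq> H10 \<Omega>" "0 \<in> S" "0 \<in> V" "f \<in> L2 \<Omega>"
  shows "fosls_solution \<Omega> S V f \<sigma> u \<longleftrightarrow>
    \<sigma> \<in> S \<and> u \<in> V \<and> (\<forall>\<tau>\<in>S. \<forall>v\<in>V. fosls_inner (\<sigma>, u) (\<tau>, v) = - L2_inner \<Omega> f (weak_div \<Omega> \<tau>))"
    (is "?L \<longleftrightarrow> ?R")
proof
  assume ?L
  moreover from this have "\<sigma> \<in> Hdiv \<Omega>" "u \<in> H10 \<Omega>" using assms by (auto simp: fosls_solution_def)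
  ultimately show ?R using assms by (auto simp: fosls_solution_def fosls_inner_eq subset_iff)
next
  assume R: ?R
  then have mem: "\<sigma> \<in> Hdiv \<Omega>" "u \<in> H10 \<Omega>" using assms by auto
  then have L: "\<sigma> \<in> L2 \<Omega>" "weak_grad \<Omega> u \<in> L2 \<Omega>" "weak_div \<Omega> \<sigma> \<in> L2 \<Omega>"
    by (auto simp: Hdiv_L2 H10_weak_grad_L2 weak_div_L2)
  have "L2_inner \<Omega> \<sigma> \<tau> + L2_inner \<Omega> (weak_div \<Omega> \<sigma>) (weak_div \<Omega> \<tau>) - L2_inner \<Omega> (weak_grad \<Omega> u) \<tau>
      = - L2_inner \<Omega> f (weak_div \<Omega> \<tau>)" if "\<tau> \<in> S" for \<tau>
  proof -
    have "fosls_inner (\<sigma>, u) (\<tau>, 0) = - L2_inner \<Omega> f (weak_div \<Omega> \<tau>)" using R that assms(4) by blast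
    then show ?thesis
      using fosls_inner_eq[OF mem, of \<tau> 0] that assms L by (auto simp: L2_inner_weak_grad_0 subset_iff)
  qed
  moreover have "- L2_inner \<Omega> \<sigma> (weak_grad \<Omega> v) + L2_inner \<Omega> (weak_grad \<Omega> u) (weak_grad \<Omega> v) = 0"
    if "v \<in> V" for v
  proof -
    have "fosls_inner (\<sigma>, u) (0, v) = - L2_inner \<Omega> f (weak_div \<Omega> 0)" using R that assms(3) by blast
    then show ?thesis
      using fosls_inner_eq[OF mem, of 0 v] that assms L
      by (auto simp: L2_inner_weak_div_0 L2.ip_zero_right subset_iff)
  qed
  ultimately show ?L using R by (auto simp: fosls_solution_def)
qed

lemma weak_div_le_fosls_norm:
  assumes "y \<in> Hdiv \<Omega> \<times> H10 \<Omega>"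
  shows "L2_norm \<Omega> (weak_div \<Omega> (fst y)) \<le> fosls.nm y"
  unfolding L2_norm_def fosls_inner_def using assms
  by (intro real_sqrt_le_mono) (auto simp: Hdiv_L2 H10_weak_grad_L2 L2.ip_self_nonneg)

text \<open>The factor 2 arises because the flux and its divergence are each estimated by the full
  \<open>Hdiv_norm\<close>.\<close>

lemma fosls_norm_le:
  assumes "\<alpha> \<in> Hdiv \<Omega>" "\<beta> \<in> H10 \<Omega>"
  shows "fosls.nm (\<alpha>, \<beta>) \<le> 2 * Hdiv_norm \<Omega> \<alpha> + sobolev_norm 1 \<Omega> \<beta>"
proof -
  have L: "\<alpha> \<in> L2 \<Omega>" "weak_grad \<Omega> \<beta> \<in> L2 \<Omega>" "weak_div \<Omega> \<alpha> \<in> L2 \<Omega>"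
    using assms by (auto simp: Hdiv_L2 H10_weak_grad_L2 weak_div_L2)
  have "fosls.nm (\<alpha>, \<beta>) = sqrt ((L2_norm \<Omega> (\<alpha> - weak_grad \<Omega> \<beta>))\<^sup>2 + (L2_norm \<Omega> (weak_div \<Omega> \<alpha>))\<^sup>2)"
    using L by (simp add: fosls_inner_def L2.nm_sq)
  also have "\<dots> \<le> L2_norm \<Omega> (\<alpha> - weak_grad \<Omega> \<beta>) + L2_norm \<Omega> (weak_div \<Omega> \<alpha>)"
    by (rule sqrt_sum_squares_le_sum) auto
  also have "L2_norm \<Omega> (\<alpha> - weak_grad \<Omega> \<beta>) \<le> L2_norm \<Omega> \<alpha> + L2_norm \<Omega> (weak_grad \<Omega> \<beta>)"
    by (rule L2.nm_diff_le[OF L(1,2)])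
  also have "L2_norm \<Omega> (weak_grad \<Omega> \<beta>) \<le> sobolev_norm 1 \<Omega> \<beta>"
    by (rule sobolev_norm_1_bounds(2)[OF H10_sobolev_1[OF assms(2)]])
  finally have "fosls.nm (\<alpha>, \<beta>) \<le> L2_norm \<Omega> \<alpha> + L2_norm \<Omega> (weak_div \<Omega> \<alpha>) + sobolev_norm 1 \<Omega> \<beta>" by simp
  moreover have "L2_norm \<Omega> \<alpha> \<le> Hdiv_norm \<Omega> \<alpha>" "L2_norm \<Omega> (weak_div \<Omega> \<alpha>) \<le> Hdiv_norm \<Omega> \<alpha>"
    by (auto simp: Hdiv_norm_def intro!: real_le_rsqrt)
  ultimately show ?thesis by linarith
qed

text \<open>Test with the solution itself: the load sees only the divergence, which the seminorm
  controls, and one factor cancels. The constant 1 does not depend on the spaces and hence not on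
  h.\<close>

lemma fosls_solution_norm_le:
  assumes "S \<subseteq> Hdiv \<Omega>" "V \<subseteq> H10 \<Omega>" "0 \<in> S" "0 \<in> V" "f \<in> L2 \<Omega>"
    and sol: "fosls_solution \<Omega> S V f \<sigma> u"
  shows "fosls.nm (\<sigma>, u) \<le> L2_norm \<Omega> f"
proof -
  have mem: "\<sigma> \<in> Hdiv \<Omega>" "u \<in> H10 \<Omega>"
    and eq: "fosls_inner (\<sigma>, u) (\<sigma>, u) = - L2_inner \<Omega> f (weak_div \<Omega> \<sigma>)"
    using sol fosls_solution_iff[OF assms(1-5), of \<sigma> u] assms(1,2) by auto
  have mem2: "(\<sigma>, u) \<in> Hdiv \<Omega> \<times> H10 \<Omega>" using mem by simp
  have "fosls.nm (\<sigma>, u) * fosls.nm (\<sigma>, u) = - L2_inner \<Omega> f (weak_div \<Omega> \<sigma>)"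
    using fosls.nm_sq[OF mem2] eq by (simp add: power2_eq_square)
  also have "\<dots> \<le> L2_norm \<Omega> f * L2_norm \<Omega> (weak_div \<Omega> \<sigma>)"
    using L2.Cauchy_Schwarz[OF assms(5) weak_div_L2[OF mem(1)]] by linarith
  also have "\<dots> \<le> L2_norm \<Omega> f * fosls.nm (\<sigma>, u)"
    using weak_div_le_fosls_norm[OF mem2] by (simp add: mult_left_mono)
  finally have "fosls.nm (\<sigma>, u) * fosls.nm (\<sigma>, u) \<le> L2_norm \<Omega> f * fosls.nm (\<sigma>, u)" .
  moreover have "fosls.nm (\<sigma>, u) = 0 \<or> fosls.nm (\<sigma>, u) > 0"
    using fosls.ip_self_nonneg[OF mem2] by (auto simp: order_le_less)
  ultimately show ?thesis
    by (metis L2_norm_nonneg mult_le_cancel_right_pos)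
qed

section \<open>Existence of continuous and discrete least squares solutions\<close>

text \<open>Stated for an arbitrary weak gradient because the dual solution uses a representative
  other than \<open>weak_grad \<Omega> u\<close>.\<close>

lemma weak_div_weak_grad_poisson:
  assumes f: "f \<in> L2 \<Omega>" and sol: "poisson_solution \<Omega> f u"
    and \<gamma>: "is_weak_grad \<Omega> u \<gamma>"
  shows "has_weak_div \<Omega> \<gamma> (- f)"
  unfolding has_weak_div_def
proof (intro conjI ballI)
  show "- f \<in> L2 \<Omega>" using f by simp
  fix \<phi> assume \<phi>: "\<phi> \<in> test_functions \<Omega>"
  have u: "u \<in> H10 \<Omega>" using sol by (simp add: poisson_solution_def)
  have "L2_inner \<Omega> \<gamma> (cgrad \<phi>) = L2_inner \<Omega> (weak_grad \<Omega> u) (cgrad \<phi>)"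
    using L2_inner_cong_left[OF H10_weak_grad_L2[OF u] is_weak_grad_L2[OF \<gamma>]
        weak_gradI(2)[OF H10_L2[OF u] \<gamma>] cgrad_L2[OF \<phi>]] by simp
  also have "\<dots> = L2_inner \<Omega> (weak_grad \<Omega> u) (weak_grad \<Omega> \<phi>)"
    using L2_inner_cong_right[OF weak_grad_L2[OF test_function_sobolev_1[OF \<phi>]] cgrad_L2[OF \<phi>]
        weak_grad_test_function[OF \<phi>] H10_weak_grad_L2[OF u]] by simp
  also have "\<dots> = L2_inner \<Omega> f \<phi>"
    using sol test_function_H10[OF \<phi>] by (simp add: poisson_solution_def)
  also have "\<dots> = - L2_inner \<Omega> (- f) \<phi>"
    using f test_function_L2[OF \<phi>] by (simp add: L2.ip_left)
  finally show "L2_inner \<Omega> \<gamma> (\<lambda>x. \<chi> i. partial i \<phi> x) = - L2_inner \<Omega> (- f) \<phi>"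
    by (simp add: cgrad_def)
qed

text \<open>The gradient of the Poisson solution together with that solution makes the first
  residual vanish, and its divergence is -f, which is all the equation asks.\<close>

lemma fosls_solution_exists:
  assumes f: "f \<in> L2 \<Omega>"
  shows "\<exists>\<sigma> u. fosls_solution \<Omega> (Hdiv \<Omega>) (H10 \<Omega>) f \<sigma> u"
proof -
  obtain u where u: "poisson_solution \<Omega> f u" using poisson_solution_exists[OF f] by blast
  then have uH: "u \<in> H10 \<Omega>" by (simp add: poisson_solution_def)
  have div: "has_weak_div \<Omega> (weak_grad \<Omega> u) (- f)"
    by (rule weak_div_weak_grad_poisson[OF f u is_weak_grad_weak_grad[OF H10_sobolev_1[OF uH]]])
  note wd = weak_divI[OF H10_weak_grad_L2[OF uH] div]
  have "fosls_inner (weak_grad \<Omega> u, u) (\<tau>, v) = - L2_inner \<Omega> f (weak_div \<Omega> \<tau>)"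
    if "\<tau> \<in> Hdiv \<Omega>" "v \<in> H10 \<Omega>" for \<tau> v
  proof -
    have "L2_inner \<Omega> (weak_div \<Omega> (weak_grad \<Omega> u)) (weak_div \<Omega> \<tau>) = - L2_inner \<Omega> f (weak_div \<Omega> \<tau>)"
      using L2_inner_cong_left[OF weak_div_L2[OF wd(1)] _ wd(2) weak_div_L2[OF that(1)]] f weak_div_L2[OF that(1)]
      by (simp add: L2.ip_left)
    then show ?thesis
      using that by (simp add: fosls_inner_def L2.ip_left Hdiv_L2 H10_weak_grad_L2)
  qed
  then have "fosls_solution \<Omega> (Hdiv \<Omega>) (H10 \<Omega>) f (weak_grad \<Omega> u) u"
    using fosls_solution_iff[OF order_refl order_refl _ _ f] wd(1) uH by simp
  then show ?thesis by blast
qed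

text \<open>The discrete product space is the span of a finite set of pairs, and the load is bounded
  in the least squares seminorm with constant \<open>L2_norm \<Omega> f\<close>, so the
  finite-dimensional Riesz theorem applies even if the form degenerates.\<close>

lemma fosls_solution_exists_finite_dim:
  assumes S: "S \<subseteq> Hdiv \<Omega>" "finite_dim_space S" and V: "V \<subseteq> H10 \<Omega>" "finite_dim_space V"
    and f: "f \<in> L2 \<Omega>"
  shows "\<exists>\<sigma> u. fosls_solution \<Omega> S V f \<sigma> u"
proof -
  obtain A where A: "finite A" "S = span A" using finite_dim_space_span[OF S(2)] .
  obtain B where B: "finite B" "V = span B" using finite_dim_space_span[OF V(2)] .
  let ?B = "(\<lambda>a. (a, 0)) ` A \<union> (\<lambda>b. (0, b)) ` B"
  have span: "span ?B = S \<times> V" unfolding A(2) B(2) by (rule span_Times_eq)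
  have "\<exists>y\<in>span ?B. \<forall>z\<in>span ?B. fosls_inner y z = - L2_inner \<Omega> f (weak_div \<Omega> (fst z))"
  proof (rule fosls.riesz_finite_dim)
    show "finite ?B" using A(1) B(1) by simp
    show "?B \<subseteq> Hdiv \<Omega> \<times> H10 \<Omega>"
      using span_superset[of ?B] span S(1) V(1) by blast
    fix z assume z: "z \<in> Hdiv \<Omega> \<times> H10 \<Omega>"
    have zd: "weak_div \<Omega> (fst z) \<in> L2 \<Omega>" using z by (auto simp: weak_div_L2)
    have "\<bar>L2_inner \<Omega> f (weak_div \<Omega> (fst z))\<bar> \<le> L2_norm \<Omega> f * L2_norm \<Omega> (weak_div \<Omega> (fst z))"
      by (rule L2.Cauchy_Schwarz[OF f zd])
    also have "\<dots> \<le> L2_norm \<Omega> f * fosls.nm z"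
      by (intro mult_left_mono weak_div_le_fosls_norm z) simp
    finally show "\<bar>- L2_inner \<Omega> f (weak_div \<Omega> (fst z))\<bar> \<le> L2_norm \<Omega> f * fosls.nm z" by simp
    fix c
    show "- L2_inner \<Omega> f (weak_div \<Omega> (fst (c *\<^sub>R z))) = c * - L2_inner \<Omega> f (weak_div \<Omega> (fst z))"
      using z f L2_inner_weak_div_scale[OF f, of "fst z" c] zd weak_div_L2[of "c *\<^sub>R fst z" \<Omega>]
      by (auto simp: L2.ip_commute[OF f])
  next
    fix y z assume yz: "y \<in> Hdiv \<Omega> \<times> H10 \<Omega>" "z \<in> Hdiv \<Omega> \<times> H10 \<Omega>"
    then show "- L2_inner \<Omega> f (weak_div \<Omega> (fst (y + z))) =
        - L2_inner \<Omega> f (weak_div \<Omega> (fst y)) + - L2_inner \<Omega> f (weak_div \<Omega> (fst z))"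
      using L2_inner_weak_div_add[OF f, of "fst y" "fst z"]
      by (auto simp: L2.ip_commute[OF f] weak_div_L2)
  qed
  then obtain y where y: "y \<in> S \<times> V"
    and eq: "\<forall>z\<in>S \<times> V. fosls_inner y z = - L2_inner \<Omega> f (weak_div \<Omega> (fst z))"
    unfolding span by blast
  have zero: "0 \<in> S" "0 \<in> V" unfolding A(2) B(2) by (rule span_zero)+
  have "fosls_solution \<Omega> S V f (fst y) (snd y)"
    unfolding fosls_solution_iff[OF S(1) V(1) zero f] using y eq by auto
  then show ?thesis by blast
qed

section \<open>The dual problem\<close>

lemma sobolev_add_1:
  assumes "s > 0"
  shows "u \<in> sobolev (1 + s) \<Omega> \<longleftrightarrow> u \<in> L2 \<Omega> \<and> (\<forall>i. \<exists>g\<in>sobolev s \<Omega>. has_weak_partial \<Omega> i u g)"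
proof -
  have "nat \<lfloor>1 + s\<rfloor> = Suc (nat \<lfloor>s\<rfloor>)" "frac (1 + s) = frac s"
    using assms by (auto simp: frac_def nat_add_distrib)
  then show ?thesis by (simp add: sobolev_def)
qed

text \<open>Weak derivatives are defined by integrals and do not see null sets. This carries
  regularity from w to the chosen divergence of the dual flux.\<close>

lemma sobolev_add_1_cong:
  assumes "s > 0" "u \<in> sobolev (1 + s) \<Omega>" "v \<in> L2 \<Omega>" "L2_norm \<Omega> (v - u) = 0"
  shows "v \<in> sobolev (1 + s) \<Omega>"
proof -
  have u: "u \<in> L2 \<Omega>" using assms by (simp add: sobolev_add_1)
  have "has_weak_partial \<Omega> i v g" if "has_weak_partial \<Omega> i u g" for i g
    using that L2_inner_cong_left[OF assms(3) u assms(4)] test_function_partial_L2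
    by (auto simp: has_weak_partial_def)
  then show ?thesis using assms(1-3) by (metis sobolev_add_1)
qed

text \<open>The dual solution consists of solutions of Poisson problems: if \<open>\<Delta>w = g\<close> and \<open>\<Delta>z = w\<close>, then
  \<open>\<xi> = \<nabla>z\<close> and \<open>p = z - w\<close> satisfy \<open>\<xi> - \<nabla>p = \<nabla>w\<close> and \<open>div \<xi> = w\<close>, and integration by parts gives
  the claim. The point is that \<open>div \<xi>\<close> inherits the regularity of \<open>w\<close>.\<close>

lemma dual_solution:
  assumes s: "s > 0"
    and regularity: "\<And>f u. f \<in> L2 \<Omega> \<Longrightarrow> poisson_solution \<Omega> f u \<Longrightarrow> u \<in> sobolev (1 + s) \<Omega>"
    and g: "g \<in> L2 \<Omega>"
  obtains \<xi> p where "\<xi> \<in> sobolev_vec s \<Omega>" "\<xi> \<in> Hdiv \<Omega>" "weak_div \<Omega> \<xi> \<in> sobolev (1 + s) \<Omega>"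
    "p \<in> sobolev (1 + s) \<Omega>" "p \<in> H10 \<Omega>"
    "\<And>\<tau> v. \<lbrakk>\<tau> \<in> Hdiv \<Omega>; v \<in> H10 \<Omega>\<rbrakk> \<Longrightarrow> fosls_inner (\<tau>, v) (\<xi>, p) = L2_inner \<Omega> g v"
proof -
  have g': "- g \<in> L2 \<Omega>" using g by simp
  obtain w where w: "poisson_solution \<Omega> (- g) w" using poisson_solution_exists[OF g'] by blast
  then have wH: "w \<in> H10 \<Omega>" by (simp add: poisson_solution_def)
  have w': "- w \<in> L2 \<Omega>" using H10_L2[OF wH] by simp
  obtain z where z: "poisson_solution \<Omega> (- w) z" using poisson_solution_exists[OF w'] by blast
  then have zH: "z \<in> H10 \<Omega>" by (simp add: poisson_solution_def)
  have w_eq: "L2_inner \<Omega> (weak_grad \<Omega> w) (weak_grad \<Omega> v) = - L2_inner \<Omega> g v" if "v \<in> H10 \<Omega>" for v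
    using w that g by (simp add: poisson_solution_def L2.ip_left H10_L2)
  have z_eq: "L2_inner \<Omega> (weak_grad \<Omega> z) (weak_grad \<Omega> v) = - L2_inner \<Omega> w v" if "v \<in> H10 \<Omega>" for v
    using z that wH by (simp add: poisson_solution_def L2.ip_left H10_L2)
  define p where "p = z - w"
  have pH: "p \<in> H10 \<Omega>" using zH wH by (simp add: p_def)
  \<comment> \<open>The difference is itself a Poisson solution, so its regularity comes straight
    from the hypothesis rather than from linearity of the fractional space.\<close>
  have "poisson_solution \<Omega> (g - w) p"
    using pH w_eq z_eq g wH zH
    by (simp add: poisson_solution_def p_def L2_inner_weak_grad H10_sobolev_1 H10_weak_grad_L2 L2.ip_left H10_L2)
  then have pS: "p \<in> sobolev (1 + s) \<Omega>" using regularity[of "g - w" p] g H10_L2[OF wH] by simp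
  \<comment> \<open>The flux is assembled from derivatives known to lie in
    \<open>sobolev s \<Omega>\<close>, a property by which \<open>weak_grad \<Omega> z\<close> was
    not selected.\<close>
  have "\<forall>i. \<exists>g\<in>sobolev s \<Omega>. has_weak_partial \<Omega> i z g"
    using regularity[OF w' z] sobolev_add_1[OF s] by simp
  then obtain \<zeta> where \<zeta>: "\<And>i. \<zeta> i \<in> sobolev s \<Omega>" "\<And>i. has_weak_partial \<Omega> i z (\<zeta> i)"
    by metis
  define \<xi> :: "real ^ 'd \<Rightarrow> real ^ 'd" where "\<xi> x = (\<chi> i. \<zeta> i x)" for x
  have \<xi>S: "\<xi> \<in> sobolev_vec s \<Omega>" using \<zeta>(1) by (simp add: sobolev_vec_def \<xi>_def)
  have \<xi>grad: "is_weak_grad \<Omega> z \<xi>" using \<zeta>(2) by (simp add: is_weak_grad_def \<xi>_def)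
  have \<xi>L: "\<xi> \<in> L2 \<Omega>" by (rule is_weak_grad_L2[OF \<xi>grad])
  have \<xi>null: "L2_norm \<Omega> (weak_grad \<Omega> z - \<xi>) = 0" by (rule weak_gradI(2)[OF H10_L2[OF zH] \<xi>grad])
  have "has_weak_div \<Omega> \<xi> w" using weak_div_weak_grad_poisson[OF w' z \<xi>grad] by simp
  note \<xi>div = weak_divI[OF \<xi>L this]
  have "weak_div \<Omega> \<xi> \<in> sobolev (1 + s) \<Omega>"
    by (rule sobolev_add_1_cong[OF s regularity[OF g' w] weak_div_L2[OF \<xi>div(1)] \<xi>div(2)])
  moreover have "fosls_inner (\<tau>, v) (\<xi>, p) = L2_inner \<Omega> g v" if \<tau>: "\<tau> \<in> Hdiv \<Omega>" and v: "v \<in> H10 \<Omega>" for \<tau> v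
  proof -
    have k: "\<tau> - weak_grad \<Omega> v \<in> L2 \<Omega>" using \<tau> v by (simp add: Hdiv_L2 H10_weak_grad_L2)
    have "L2_inner \<Omega> (\<xi> - weak_grad \<Omega> p) (\<tau> - weak_grad \<Omega> v) = L2_inner \<Omega> (weak_grad \<Omega> w) (\<tau> - weak_grad \<Omega> v)"
      using L2.ip_diff_left[OF \<xi>L H10_weak_grad_L2[OF pH] k]
        L2_inner_weak_grad_diff[OF k H10_sobolev_1[OF zH] H10_sobolev_1[OF wH]]
        L2_inner_cong_left[OF H10_weak_grad_L2[OF zH] \<xi>L \<xi>null k]
      by (simp add: p_def)
    then have "L2_inner \<Omega> (\<tau> - weak_grad \<Omega> v) (\<xi> - weak_grad \<Omega> p) = L2_inner \<Omega> (weak_grad \<Omega> w) (\<tau> - weak_grad \<Omega> v)"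
      using L2.ip_commute[OF k, of "\<xi> - weak_grad \<Omega> p"] \<xi>L H10_weak_grad_L2[OF pH] by simp
    also have "\<dots> = L2_inner \<Omega> \<tau> (weak_grad \<Omega> w) + L2_inner \<Omega> g v"
      using w_eq[OF v] L2.ip_commute[OF H10_weak_grad_L2[OF wH] Hdiv_L2[OF \<tau>]]
        L2.ip_diff_right[OF Hdiv_L2[OF \<tau>] H10_weak_grad_L2[OF v] H10_weak_grad_L2[OF wH]] by simp
    \<comment> \<open>The divergence part of the form contributes the same term in w with the
      opposite sign, since div \<xi> = w; only the pairing of g with v remains.\<close>
    also have "\<dots> = - L2_inner \<Omega> (weak_div \<Omega> \<tau>) w + L2_inner \<Omega> g v"
      by (simp add: weak_div_weak_grad[OF wH \<tau>])
    finally show ?thesis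
      using L2_inner_cong_right[OF weak_div_L2[OF \<xi>div(1)] H10_L2[OF wH] \<xi>div(2) weak_div_L2[OF \<tau>]]
      by (simp add: fosls_inner_def)
  qed
  ultimately show ?thesis using that \<xi>S \<xi>div(1) pS pH by blast
qed

text \<open>The error is orthogonal to the discrete spaces, so that its inner product with \<open>g\<close> only sees how
  well the dual solution is approximated.\<close>

lemma error_weakly_bounded:
  assumes s: "s > 0"
    and regularity: "\<And>f u. f \<in> L2 \<Omega> \<Longrightarrow> poisson_solution \<Omega> f u \<Longrightarrow> u \<in> sobolev (1 + s) \<Omega>"
    and Sigma_h: "\<And>h. h > 0 \<Longrightarrow> Sigma_h h \<subseteq> Hdiv \<Omega> \<and> finite_dim_space (Sigma_h h)"
    and U_h: "\<And>h. h > 0 \<Longrightarrow> U_h h \<subseteq> H10 \<Omega> \<and> finite_dim_space (U_h h)"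
    and approx_Sigma: "\<And>h \<xi>. h > 0 \<Longrightarrow> \<xi> \<in> sobolev_vec s \<Omega> \<Longrightarrow> \<xi> \<in> Hdiv \<Omega> \<Longrightarrow>
          weak_div \<Omega> \<xi> \<in> sobolev (1 + s) \<Omega> \<Longrightarrow>
          (INF \<tau>\<in>Sigma_h h. Hdiv_norm \<Omega> (\<lambda>x. \<xi> x - \<tau> x))
            \<le> C * h powr s * (sobolev_vec_norm s \<Omega> \<xi> + sobolev_norm (1 + s) \<Omega> (weak_div \<Omega> \<xi>))"
    and approx_U: "\<And>h p. h > 0 \<Longrightarrow> p \<in> sobolev (1 + s) \<Omega> \<Longrightarrow> p \<in> H10 \<Omega> \<Longrightarrow>
          (INF v\<in>U_h h. sobolev_norm 1 \<Omega> (\<lambda>x. p x - v x))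
            \<le> C * h powr s * sobolev_norm (1 + s) \<Omega> p"
    and g: "g \<in> L2 \<Omega>"
  shows "\<exists>M. \<forall>h>0. \<forall>f\<in>L2 \<Omega>. \<forall>\<sigma> u \<sigma>\<^sub>h u\<^sub>h.
    fosls_solution \<Omega> (Hdiv \<Omega>) (H10 \<Omega>) f \<sigma> u \<longrightarrow> fosls_solution \<Omega> (Sigma_h h) (U_h h) f \<sigma>\<^sub>h u\<^sub>h \<longrightarrow>
    \<bar>L2_inner \<Omega> (u - u\<^sub>h) g\<bar> \<le> M * h powr s * L2_norm \<Omega> f"
proof -
  obtain \<xi> p where \<xi>: "\<xi> \<in> sobolev_vec s \<Omega>" "\<xi> \<in> Hdiv \<Omega>" "weak_div \<Omega> \<xi> \<in> sobolev (1 + s) \<Omega>"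
    and p: "p \<in> sobolev (1 + s) \<Omega>" "p \<in> H10 \<Omega>"
    and dual: "\<And>\<tau> v. \<lbrakk>\<tau> \<in> Hdiv \<Omega>; v \<in> H10 \<Omega>\<rbrakk> \<Longrightarrow> fosls_inner (\<tau>, v) (\<xi>, p) = L2_inner \<Omega> g v"
  proof (rule dual_solution[OF s _ g])
    show "u \<in> sobolev (1 + s) \<Omega>" if "f \<in> L2 \<Omega>" "poisson_solution \<Omega> f u" for f u
      by (rule regularity[OF that])
  qed (use that in blast)
  \<comment> \<open>The added 1 makes the bound exceed the infimum strictly, so that an approximant
    exists for every h. N depends on g only through the dual solution, not on h or f.\<close>
  define N where "N = C * (sobolev_vec_norm s \<Omega> \<xi> + sobolev_norm (1 + s) \<Omega> (weak_div \<Omega> \<xi>)) + 1"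
  define N' where "N' = C * sobolev_norm (1 + s) \<Omega> p + 1"
  show ?thesis
  proof (intro exI allI impI ballI)
    fix h :: real and f \<sigma> u \<sigma>\<^sub>h u\<^sub>h
    assume h: "h > 0" and f: "f \<in> L2 \<Omega>"
      and sol: "fosls_solution \<Omega> (Hdiv \<Omega>) (H10 \<Omega>) f \<sigma> u"
      and sol_h: "fosls_solution \<Omega> (Sigma_h h) (U_h h) f \<sigma>\<^sub>h u\<^sub>h"
    have sub: "Sigma_h h \<subseteq> Hdiv \<Omega>" "U_h h \<subseteq> H10 \<Omega>" using Sigma_h U_h h by auto
    have zero: "0 \<in> Sigma_h h" "0 \<in> U_h h"
      using Sigma_h[OF h] U_h[OF h] by (metis finite_dim_space_span span_zero)+
    have hs: "h powr s > 0" using h by simp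
    note iff = fosls_solution_iff[OF order_refl order_refl _ _ f, of \<sigma> u]
    note iff_h = fosls_solution_iff[OF sub zero f, of \<sigma>\<^sub>h u\<^sub>h]
    obtain \<tau> where \<tau>: "\<tau> \<in> Sigma_h h" "Hdiv_norm \<Omega> (\<xi> - \<tau>) < h powr s * N"
    proof (rule INF_le_obtain[OF approx_Sigma[OF h \<xi>], of "h powr s * N"])
      show "C * h powr s * (sobolev_vec_norm s \<Omega> \<xi> + sobolev_norm (1 + s) \<Omega> (weak_div \<Omega> \<xi>)) < h powr s * N"
        using hs by (simp add: N_def algebra_simps)
    qed (use zero that in \<open>auto simp: fun_diff_def\<close>)
    obtain v where v: "v \<in> U_h h" "sobolev_norm 1 \<Omega> (p - v) < h powr s * N'"
    proof (rule INF_le_obtain[OF approx_U[OF h p], of "h powr s * N'"])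
      show "C * h powr s * sobolev_norm (1 + s) \<Omega> p < h powr s * N'"
        using hs by (simp add: N'_def algebra_simps)
    qed (use zero that in \<open>auto simp: fun_diff_def\<close>)
    have mem: "\<sigma> \<in> Hdiv \<Omega>" "u \<in> H10 \<Omega>" "\<sigma>\<^sub>h \<in> Hdiv \<Omega>" "u\<^sub>h \<in> H10 \<Omega>" "\<tau> \<in> Hdiv \<Omega>" "v \<in> H10 \<Omega>"
      using sol sol_h iff iff_h sub \<tau>(1) v(1) by auto
    define e where "e = (\<sigma>, u) - (\<sigma>\<^sub>h, u\<^sub>h)"
    define d where "d = (\<xi>, p) - (\<tau>, v)"
    have W: "(\<sigma>, u) \<in> Hdiv \<Omega> \<times> H10 \<Omega>" "(\<sigma>\<^sub>h, u\<^sub>h) \<in> Hdiv \<Omega> \<times> H10 \<Omega>" "(\<tau>, v) \<in> Hdiv \<Omega> \<times> H10 \<Omega>"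
      "(\<xi>, p) \<in> Hdiv \<Omega> \<times> H10 \<Omega>" using mem \<xi> p by auto
    have eW: "e \<in> Hdiv \<Omega> \<times> H10 \<Omega>" and dW: "d \<in> Hdiv \<Omega> \<times> H10 \<Omega>"
      unfolding e_def d_def by (intro fosls.V_diff W)+
    have orth: "fosls_inner e (\<tau>, v) = 0"
    proof -
      have "fosls_inner (\<sigma>, u) (\<tau>, v) = - L2_inner \<Omega> f (weak_div \<Omega> \<tau>)"
        using sol iff mem by simp
      moreover have "fosls_inner (\<sigma>\<^sub>h, u\<^sub>h) (\<tau>, v) = - L2_inner \<Omega> f (weak_div \<Omega> \<tau>)"
        using sol_h iff_h \<tau>(1) v(1) by simp
      ultimately show ?thesis unfolding e_def using fosls.ip_diff_left[OF W(1,2,3)] by simp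
    qed
    have "L2_inner \<Omega> (u - u\<^sub>h) g = L2_inner \<Omega> g (u - u\<^sub>h)"
      using L2.ip_commute[OF _ g, of "u - u\<^sub>h"] mem H10_L2 by simp
    also have "\<dots> = fosls_inner e (\<xi>, p)"
      using dual[of "\<sigma> - \<sigma>\<^sub>h" "u - u\<^sub>h"] mem by (simp add: e_def)
    \<comment> \<open>Galerkin orthogonality allows the discrete pair to be subtracted from the dual
      solution.\<close>
    also have "\<dots> = fosls_inner e d"
      unfolding d_def using fosls.ip_diff_right[OF W(4,3) eW] orth by simp
    finally have "\<bar>L2_inner \<Omega> (u - u\<^sub>h) g\<bar> \<le> fosls.nm e * fosls.nm d"
      using fosls.Cauchy_Schwarz[OF eW dW] by simp
    \<comment> \<open>The first factor adds the stability bounds of the two solutions; the second is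
      the approximation error of the dual solution.\<close>
    also have "\<dots> \<le> (2 * L2_norm \<Omega> f) * (h powr s * (2 * N + N'))"
    proof (rule mult_mono)
      have "fosls.nm e \<le> fosls.nm (\<sigma>, u) + fosls.nm (\<sigma>\<^sub>h, u\<^sub>h)"
        unfolding e_def by (rule fosls.nm_diff_le[OF W(1,2)])
      also have "\<dots> \<le> L2_norm \<Omega> f + L2_norm \<Omega> f"
        using fosls_solution_norm_le[OF order_refl order_refl _ _ f sol] fosls_solution_norm_le[OF sub zero f sol_h]
        by (intro add_mono) simp_all
      finally show "fosls.nm e \<le> 2 * L2_norm \<Omega> f" by simp
      have "fosls.nm d \<le> 2 * Hdiv_norm \<Omega> (\<xi> - \<tau>) + sobolev_norm 1 \<Omega> (p - v)"
        using fosls_norm_le[of "\<xi> - \<tau>" "p - v"] \<xi> p mem by (simp add: d_def)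
      also have "\<dots> \<le> h powr s * (2 * N + N')" using \<tau>(2) v(2) by (simp add: algebra_simps)
      finally show "fosls.nm d \<le> h powr s * (2 * N + N')" .
    qed (use fosls.ip_self_nonneg[OF dW] in auto)
    finally show "\<bar>L2_inner \<Omega> (u - u\<^sub>h) g\<bar> \<le> (2 * (2 * N + N')) * h powr s * L2_norm \<Omega> f"
      by (simp add: mult_ac)
  qed
qed

end

section \<open>Uniform boundedness of the scaled errors and the rate\<close>

theorem theorem10:
  fixes \<Omega> :: "(real ^ 'd) set" and s C :: real
    and Sigma_h :: "real \<Rightarrow> (real ^ 'd \<Rightarrow> real ^ 'd) set"
    and U_h :: "real \<Rightarrow> (real ^ 'd \<Rightarrow> real) set"
  assumes dim: "CARD('d) = 2 \<or> CARD('d) = 3"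
    and domain: "lipschitz_polyhedron \<Omega>"
    and s: "1 / 2 < s" "s \<le> 1"
    and regularity: "\<And>f u. f \<in> L2 \<Omega> \<Longrightarrow> poisson_solution \<Omega> f u \<Longrightarrow> u \<in> sobolev (1 + s) \<Omega>"
    and Sigma_h: "\<And>h. h > 0 \<Longrightarrow> Sigma_h h \<subseteq> Hdiv \<Omega> \<and> finite_dim_space (Sigma_h h)"
    and U_h: "\<And>h. h > 0 \<Longrightarrow> U_h h \<subseteq> H10 \<Omega> \<and> finite_dim_space (U_h h)"
    and approx_Sigma: "\<And>h \<xi>. h > 0 \<Longrightarrow> \<xi> \<in> sobolev_vec s \<Omega> \<Longrightarrow> \<xi> \<in> Hdiv \<Omega> \<Longrightarrow>
          weak_div \<Omega> \<xi> \<in> sobolev (1 + s) \<Omega> \<Longrightarrow>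
          (INF \<tau>\<in>Sigma_h h. Hdiv_norm \<Omega> (\<lambda>x. \<xi> x - \<tau> x))
            \<le> C * h powr s * (sobolev_vec_norm s \<Omega> \<xi> + sobolev_norm (1 + s) \<Omega> (weak_div \<Omega> \<xi>))"
    and approx_U: "\<And>h p. h > 0 \<Longrightarrow> p \<in> sobolev (1 + s) \<Omega> \<Longrightarrow> p \<in> H10 \<Omega> \<Longrightarrow>
          (INF v\<in>U_h h. sobolev_norm 1 \<Omega> (\<lambda>x. p x - v x))
            \<le> C * h powr s * sobolev_norm (1 + s) \<Omega> p"
  shows "\<exists>\<rho> :: real \<Rightarrow> real. (\<rho> \<longlongrightarrow> 0) (at_right 0) \<and>
           (\<forall>h>0. \<forall>f \<in> L2 \<Omega>.
              L2_norm \<Omega> (\<lambda>x. T_F1 \<Omega> f x - T_F1_h \<Omega> (Sigma_h h) (U_h h) f x) \<le> \<rho> h * L2_norm \<Omega> f)"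
proof -
  interpret bounded_open_set \<Omega>
    using domain by (intro bounded_open_set.intro) (simp_all add: lipschitz_polyhedron_def)
  have s0: "s > 0" using s by simp
  define err where "err h f = T_F1 \<Omega> f - T_F1_h \<Omega> (Sigma_h h) (U_h h) f" for h f
  have T: "\<exists>\<sigma>. fosls_solution \<Omega> (Hdiv \<Omega>) (H10 \<Omega>) f \<sigma> (T_F1 \<Omega> f)" if "f \<in> L2 \<Omega>" for f
    unfolding T_F1_def
    by (rule someI_ex[of "\<lambda>u. \<exists>\<sigma>. fosls_solution \<Omega> (Hdiv \<Omega>) (H10 \<Omega>) f \<sigma> u"])
      (use fosls_solution_exists[OF that] in blast)
  have T_h: "\<exists>\<sigma>. fosls_solution \<Omega> (Sigma_h h) (U_h h) f \<sigma> (T_F1_h \<Omega> (Sigma_h h) (U_h h) f)"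
    if "f \<in> L2 \<Omega>" "h > 0" for f h
    unfolding T_F1_h_def
    by (rule someI_ex[of "\<lambda>u. \<exists>\<sigma>. fosls_solution \<Omega> (Sigma_h h) (U_h h) f \<sigma> u"])
      (use fosls_solution_exists_finite_dim[of "Sigma_h h" "U_h h" f] Sigma_h[OF that(2)] U_h[OF that(2)] that(1) in blast)
  have err_L2: "err h f \<in> L2 \<Omega>" if "f \<in> L2 \<Omega>" "h > 0" for f h
    using T[OF that(1)] T_h[OF that] U_h[OF that(2)] H10_L2 unfolding err_def
    by (intro L2.V_diff) (auto simp: fosls_solution_def)
  \<comment> \<open>A free factor c instead of a quotient avoids dividing by
    \<open>L2_norm \<Omega> f\<close>, which may be 0. One set collects the errors for all h and f,
    so a single K serves them all.\<close>
  define E where "E = {c *\<^sub>R err h f |c h f. c \<ge> 0 \<and> h > 0 \<and> f \<in> L2 \<Omega> \<and> c * (h powr s * L2_norm \<Omega> f) \<le> 1}"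
  have "\<exists>K. \<forall>e\<in>E. L2_norm \<Omega> e \<le> K"
  proof (rule L2.weakly_bounded_imp_bounded[OF L2_complete[OF lmeasurable_\<Omega>]])
    show "E \<subseteq> L2 \<Omega>" using err_L2 by (auto simp: E_def)
    fix g :: "real ^ 'd \<Rightarrow> real" assume g: "g \<in> L2 \<Omega>"
    have "\<exists>M. \<forall>h>0. \<forall>f\<in>L2 \<Omega>. \<forall>\<sigma> u \<sigma>\<^sub>h u\<^sub>h.
        fosls_solution \<Omega> (Hdiv \<Omega>) (H10 \<Omega>) f \<sigma> u \<longrightarrow> fosls_solution \<Omega> (Sigma_h h) (U_h h) f \<sigma>\<^sub>h u\<^sub>h \<longrightarrow>
        \<bar>L2_inner \<Omega> (u - u\<^sub>h) g\<bar> \<le> M * h powr s * L2_norm \<Omega> f"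
      by (rule error_weakly_bounded[OF s0 _ _ _ _ _ g])
        (fact regularity Sigma_h U_h approx_Sigma approx_U)+
    then obtain M where M: "\<And>h f \<sigma> u \<sigma>\<^sub>h u\<^sub>h. \<lbrakk>h > 0; f \<in> L2 \<Omega>; fosls_solution \<Omega> (Hdiv \<Omega>) (H10 \<Omega>) f \<sigma> u;
        fosls_solution \<Omega> (Sigma_h h) (U_h h) f \<sigma>\<^sub>h u\<^sub>h\<rbrakk> \<Longrightarrow>
        \<bar>L2_inner \<Omega> (u - u\<^sub>h) g\<bar> \<le> M * h powr s * L2_norm \<Omega> f"
      by blast
    have "\<bar>L2_inner \<Omega> e g\<bar> \<le> \<bar>M\<bar>" if "e \<in> E" for e
    proof -
      obtain c h f where e: "e = c *\<^sub>R err h f" and c: "c \<ge> 0" and h: "h > 0" and f: "f \<in> L2 \<Omega>"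
        and le: "c * (h powr s * L2_norm \<Omega> f) \<le> 1" using \<open>e \<in> E\<close> by (auto simp: E_def)
      have "\<bar>L2_inner \<Omega> (err h f) g\<bar> \<le> M * h powr s * L2_norm \<Omega> f"
        using M[OF h f] T[OF f] T_h[OF f h] unfolding err_def by blast
      then have "c * \<bar>L2_inner \<Omega> (err h f) g\<bar> \<le> M * (c * (h powr s * L2_norm \<Omega> f))"
        using mult_left_mono[OF _ c] by (fastforce simp: mult_ac)
      also have "\<dots> \<le> \<bar>M\<bar> * 1"
        using le c by (intro mult_mono) auto
      finally show ?thesis
        using c err_L2[OF f h] g by (simp add: e L2.ip_left abs_mult)
    qed
    then show "\<exists>M. \<forall>e\<in>E. \<bar>L2_inner \<Omega> e g\<bar> \<le> M" by blast
  qed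
  then obtain K where K: "\<And>e. e \<in> E \<Longrightarrow> L2_norm \<Omega> e \<le> K" by blast
  have K': "c * L2_norm \<Omega> (err h f) \<le> K"
    if "c \<ge> 0" "h > 0" "f \<in> L2 \<Omega>" "c * (h powr s * L2_norm \<Omega> f) \<le> 1" for c h f
  proof -
    have "c *\<^sub>R err h f \<in> E" using that by (auto simp: E_def)
    from K[OF this] show ?thesis using L2.nm_scale[OF err_L2[OF that(3,2)], of c] that(1) by simp
  qed
  have "L2_norm \<Omega> (err h f) \<le> K * h powr s * L2_norm \<Omega> f" if h: "h > 0" and f: "f \<in> L2 \<Omega>" for h f
  proof (cases "L2_norm \<Omega> f = 0")
    case True
    \<comment> \<open>For a null load every c is admissible, so a nonzero error could be scaled to
      norm |K| + 1, beyond the bound K.\<close>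
    have "L2_norm \<Omega> (err h f) = 0"
    proof (rule ccontr)
      assume ne: "L2_norm \<Omega> (err h f) \<noteq> 0"
      then have pos: "L2_norm \<Omega> (err h f) > 0" using L2_norm_nonneg[of \<Omega> "err h f"] by linarith
      have "(\<bar>K\<bar> + 1) / L2_norm \<Omega> (err h f) * L2_norm \<Omega> (err h f) \<le> K"
        by (rule K'[OF _ h f]) (use True pos in auto)
      then show False using ne by simp
    qed
    then show ?thesis using True by simp
  next
    case False
    then have pos: "h powr s * L2_norm \<Omega> f > 0" using h L2_norm_nonneg[of \<Omega> f] by (simp add: less_le)
    \<comment> \<open>The largest admissible c, for which the constraint in \<open>E\<close> holds
      with equality.\<close>
    have "inverse (h powr s * L2_norm \<Omega> f) * L2_norm \<Omega> (err h f) \<le> K"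
    proof (rule K'[OF _ h f])
      show "inverse (h powr s * L2_norm \<Omega> f) * (h powr s * L2_norm \<Omega> f) \<le> 1"
        by (rule eq_refl, rule left_inverse) (use pos in linarith)
    qed (use pos in \<open>simp del: inverse_mult_distrib\<close>)
    then have "L2_norm \<Omega> (err h f) \<le> K * (h powr s * L2_norm \<Omega> f)"
      using pos by (simp add: divide_inverse[symmetric] mult.commute[of "inverse _"] pos_divide_le_eq
          del: inverse_mult_distrib)
    then show ?thesis by (simp add: mult.assoc)
  qed
  moreover have "((\<lambda>h. K * h powr s) \<longlongrightarrow> 0) (at_right 0)"
  proof -
    have "((\<lambda>h::real. h powr s) \<longlongrightarrow> 0) (at_right 0)"
      by (rule tendsto_zero_powrI[OF _ tendsto_const _ s0]) (auto simp: eventually_at_filter intro: tendsto_ident_at)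
    then show ?thesis by (rule tendsto_mult_right_zero)
  qed
  ultimately show ?thesis by (auto simp: err_def fun_diff_def intro!: exI[of _ "\<lambda>h. K * h powr s"])
qed

end
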